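(* Let $c>0$ and $n\geq1$. The reverse Santaló inequality $\mathrm{IS}_n(c)$ holds if and only if \[ \inf_{\eta_1\in\mathcal{P}_1(\mathbb{R}^n)}\left\{\mathcal{T}(\nu_1,\eta_1)+H(\eta_1|\mathrm{Leb})\right\}+\inf_{\eta_2\in\mathcal{P}_1(\mathbb{R}^n)}\left\{\mathcal{T}(\nu_2,\eta_2)+H(\eta_2|\mathrm{Leb})\right\}\leq-n\log c+\mathcal{T}(\nu_1,\nu_2) \] for all $\nu_1,\nu_2\in\mathcal{P}_1(\mathbb{R}^n)$ (resp. if and only if this inequality holds for all compactly supported probability measures $\nu_1,\nu_2$ on $\mathbb{R}^n$). In the case of the reverse Santaló inequality $\mathrm{IS}_{n,u}(c)$ (resp. $\mathrm{IS}_{n,s}(c)$), the same statement holds with the extra condition that $\nu_1,\nu_2,\eta_1,\eta_2$ belong to $\mathcal{P}_{u,1}(\mathbb{R}^n)$ (resp. $\mathcal{P}_{s,1}(\mathbb{R}^n)$).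
   Context: $\mathcal{F}(\mathbb{R}^n)$ is the set of lower semicontinuous convex functions $f:\mathbb{R}^n\to\mathbb{R}\cup\{+\infty\}$ finite at at least one point, and $f^*(y)=\sup_{x\in\mathbb{R}^n}\{x\cdot y-f(x)\}$. Functions/measures are symmetric if invariant under $x\mapsto-x$, unconditional if invariant under all maps $x\mapsto(\varepsilon_1x_1,\ldots,\varepsilon_nx_n)$, $\varepsilon\in\{-1,1\}^n$; $\mathcal{F}_s(\mathbb{R}^n),\mathcal{F}_u(\mathbb{R}^n)$ are the symmetric, resp. unconditional, elements of $\mathcal{F}(\mathbb{R}^n)$. $\mathcal{P}_1(\mathbb{R}^n)$ is the set of Borel probability measures with finite first moment, and $\mathcal{P}_{s,1}(\mathbb{R}^n),\mathcal{P}_{u,1}(\mathbb{R}^n)$ its symmetric, resp. unconditional, elements. $\mathrm{IS}_n(c)$ holds if $\int e^{-f}\,dx\int e^{-f^*}\,dx\geq c^n$ for all $f\in\mathcal{F}(\mathbb{R}^n)$ with $0<\int e^{-f}\,dx$ and $0<\int e^{-f^*}\,dx$; $\mathrm{IS}_{n,s}(c)$ (resp. $\mathrm{IS}_{n,u}(c)$) holds if the same is true for all such $f\in\mathcal{F}_s(\mathbb{R}^n)$ (resp. $\mathcal{F}_u(\mathbb{R}^n)$). For $\eta\in\mathcal{P}_1(\mathbb{R}^n)$, $H(\eta|\mathrm{Leb})=\int h\log h\,dx$ (well defined in $\mathbb{R}\cup\{+\infty\}$) if $d\eta=h\,dx$, and $+\infty$ if $\eta$ is not absolutely continuous with respect to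 Lebesgue measure. For $\nu_1,\nu_2\in\mathcal{P}_1(\mathbb{R}^n)$, \[ \mathcal{T}(\nu_1,\nu_2)=\inf_{f\in\mathcal{F}(\mathbb{R}^n)}\left\{\int f\,d\nu_1+\int f^*\,d\nu_2\right\}, \] the integrals being well defined in $\mathbb{R}\cup\{+\infty\}$. *)

theory Defs
  imports "HOL-Probability.Probability"
begin

text \<open>The dimension is \<open>n = CARD('n)\<close>, so \<open>n \<ge> 1\<close> holds automatically.\<close>

definition convex_ereal :: "('a::real_vector \<Rightarrow> ereal) \<Rightarrow> bool" where
  "convex_ereal f \<longleftrightarrow>
    (\<forall>x y. \<forall>u\<ge>0. \<forall>v\<ge>0. u + v = 1 \<longrightarrow>
      f (u *\<^sub>R x + v *\<^sub>R y) \<le> ereal u * f x + ereal v * f y)"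

definition lower_semicont :: "('a::topological_space \<Rightarrow> ereal) \<Rightarrow> bool" where
  "lower_semicont f \<longleftrightarrow> (\<forall>x. \<forall>a<f x. \<forall>\<^sub>F y in nhds x. a < f y)"

definition convex_funs :: "(real ^ 'n \<Rightarrow> ereal) set" where
  "convex_funs = {f. (\<forall>x. f x \<noteq> -\<infinity>) \<and> (\<exists>x. f x \<noteq> \<infinity>) \<and> convex_ereal f \<and> lower_semicont f}"

definition sign_flip :: "real ^ 'n \<Rightarrow> real ^ 'n \<Rightarrow> real ^ 'n" where
  "sign_flip \<epsilon> x = (\<chi> i. \<epsilon> $ i * x $ i)"

definition sign_vectors :: "(real ^ 'n) set" where
  "sign_vectors = {\<epsilon>. \<forall>i. \<epsilon> $ i \<in> {-1, 1}}"

definition convex_funs_sym :: "(real ^ 'n \<Rightarrow> ereal) set" where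
  "convex_funs_sym = {f \<in> convex_funs. \<forall>x. f (- x) = f x}"

definition convex_funs_uncond :: "(real ^ 'n \<Rightarrow> ereal) set" where
  "convex_funs_uncond = {f \<in> convex_funs. \<forall>\<epsilon>\<in>sign_vectors. \<forall>x. f (sign_flip \<epsilon> x) = f x}"

definition legendre :: "(real ^ 'n \<Rightarrow> ereal) \<Rightarrow> real ^ 'n \<Rightarrow> ereal" where
  "legendre f y = (SUP x. ereal (x \<bullet> y) - f x)"

definition exp_neg :: "ereal \<Rightarrow> ennreal" where
  "exp_neg a =
    (if a = \<infinity> then 0 else if a = -\<infinity> then \<infinity> else ennreal (exp (- real_of_ereal a)))"

definition int_exp_neg :: "(real ^ 'n \<Rightarrow> ereal) \<Rightarrow> ennreal" where
  "int_exp_neg f = (\<integral>\<^sup>+ x. exp_neg (f x) \<partial>lborel)"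

text \<open>The integrals are in \<open>[0, \<infinity>]\<close>; only positivity, not finiteness, is required of them.\<close>

definition reverse_santalo :: "(real ^ 'n \<Rightarrow> ereal) set \<Rightarrow> real \<Rightarrow> bool" where
  "reverse_santalo A c \<longleftrightarrow>
    (\<forall>f\<in>A. 0 < int_exp_neg f \<longrightarrow> 0 < int_exp_neg (legendre f) \<longrightarrow>
      int_exp_neg f * int_exp_neg (legendre f) \<ge> ennreal (c ^ CARD('n)))"

definition borel_probs :: "(real ^ 'n) measure set" where
  "borel_probs = {\<nu>. prob_space \<nu> \<and> sets \<nu> = sets borel}"

definition P1 :: "(real ^ 'n) measure set" where
  "P1 = {\<nu> \<in> borel_probs. integrable \<nu> (\<lambda>x. norm x)}"

definition P1_sym :: "(real ^ 'n) measure set" where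
  "P1_sym = {\<nu> \<in> P1. distr \<nu> borel (\<lambda>x. - x) = \<nu>}"

definition P1_uncond :: "(real ^ 'n) measure set" where
  "P1_uncond = {\<nu> \<in> P1. \<forall>\<epsilon>\<in>sign_vectors. distr \<nu> borel (sign_flip \<epsilon>) = \<nu>}"

definition measure_support :: "'a::topological_space measure \<Rightarrow> 'a set" where
  "measure_support \<nu> = {x. \<forall>U. open U \<and> x \<in> U \<longrightarrow> 0 < emeasure \<nu> U}"

definition compact_probs :: "(real ^ 'n) measure set" where
  "compact_probs = {\<nu> \<in> borel_probs. compact (measure_support \<nu>)}"

text \<open>
  The integral of \<open>f\<close> as positive part minus negative part (\<open>e2ennreal\<close> sends negative values
  to 0). Unlike the Bochner integral it takes the value \<open>\<infinity>\<close> where it should. In all uses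
  below the negative part has a finite integral, so that \<open>\<infinity> - \<infinity>\<close> does not occur.
\<close>

definition ext_integral :: "'a measure \<Rightarrow> ('a \<Rightarrow> ereal) \<Rightarrow> ereal" where
  "ext_integral M f =
    enn2ereal (\<integral>\<^sup>+ x. e2ennreal (f x) \<partial>M) - enn2ereal (\<integral>\<^sup>+ x. e2ennreal (- f x) \<partial>M)"

text \<open>Here \<open>ln 0 = 0\<close>, so \<open>h * ln h\<close> vanishes where \<open>h\<close> does.\<close>

definition entropy_Leb :: "(real ^ 'n) measure \<Rightarrow> ereal" where
  "entropy_Leb \<eta> =
    (if absolutely_continuous lborel \<eta>
     then ext_integral lborel
       (\<lambda>x. let h = enn2real (RN_deriv lborel \<eta> x) in ereal (h * ln h))
     else \<infinity>)"

definition transport_cost :: "(real ^ 'n) measure \<Rightarrow> (real ^ 'n) measure \<Rightarrow> ereal" where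
  "transport_cost \<nu>1 \<nu>2 =
    (INF f\<in>convex_funs. ext_integral \<nu>1 f + ext_integral \<nu>2 (legendre f))"

text \<open>
  The transport-entropy inequality with \<open>\<nu>1, \<nu>2\<close> ranging over \<open>V\<close> and
  \<open>\<eta>1, \<eta>2\<close> over \<open>P\<close>. For the classes used below, the infima are less than
  \<open>\<infinity>\<close> and transport costs are greater than \<open>-\<infinity>\<close>, so all sums are unambiguous.
\<close>

definition transport_entropy_ineq ::
    "(real ^ 'n) measure set \<Rightarrow> (real ^ 'n) measure set \<Rightarrow> real \<Rightarrow> bool" where
  "transport_entropy_ineq V P c \<longleftrightarrow>
    (\<forall>\<nu>1\<in>V. \<forall>\<nu>2\<in>V.
      (INF \<eta>1\<in>P. transport_cost \<nu>1 \<eta>1 + entropy_Leb \<eta>1)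
      + (INF \<eta>2\<in>P. transport_cost \<nu>2 \<eta>2 + entropy_Leb \<eta>2)
      \<le> ereal (- real CARD('n) * ln c) + transport_cost \<nu>1 \<nu>2)"

end

theory Submission
  imports Defs
begin

text \<open>
  Write \<open>F \<nu>\<close> for the infimum of \<open>transport_cost \<nu> \<eta> + entropy_Leb \<eta>\<close> over \<open>\<eta>\<close>.
  Exchanging the infimum over \<open>\<eta>\<close> with the one that defines the transport cost, and using the Gibbs
  variational principle (the infimum over \<open>\<eta>\<close> of \<open>\<integral>u d\<eta> + H(\<eta>)\<close> is \<open>- ln \<integral>exp (-u)\<close>), one sees that
  \<open>F \<nu>\<close> is the infimum over convex \<open>f\<close> of \<open>\<integral>f d\<nu> - ln \<integral>exp (-f\<^sup>*)\<close>.  So \<open>F\<close> is, up to signs, the convex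
  conjugate of the functional \<open>f \<mapsto> - ln \<integral>exp (-f\<^sup>*)\<close>, and the theorem is the translation of
  an inequality between functions into an inequality between their conjugates.

  From functions to measures (\<open>reverse_santalo_imp_transport_entropy\<close>): given \<open>f\<close> competing in
  \<open>transport_cost \<nu>1 \<nu>2\<close>, use \<open>f\<close> as a test function for \<open>F \<nu>1\<close> and \<open>f\<^sup>*\<close> as one for \<open>F \<nu>2\<close>.  The
  two logarithms add up to \<open>- ln (\<integral>exp (-f) \<integral>exp (-f\<^sup>*))\<close>, which is at most \<open>- n ln c\<close>.  Since \<open>f\<close> need
  not be invariant, and since one of the two integrals may vanish, \<open>f\<close> is first averaged over the sign
  group and regularized at an arbitrarily small cost (\<open>convex_funs_inv_regularize\<close>).

  From measures to functions (\<open>transport_entropy_imp_reverse_santalo\<close>): one has to find, for given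
  \<open>f\<close>, measures \<open>\<nu>\<close> that almost attain the conjugate, that is
  \<open>F \<nu> \<ge> \<integral>f d\<nu> - ln \<integral>exp (-f\<^sup>*)\<close> up to a small error.  The functional \<open>f \<mapsto> - ln \<integral>exp (-f\<^sup>*)\<close> is
  convex by the Prekopa-Leindler inequality, so it lies above its tangents, and the slope of the tangent
  at \<open>f\<close> is, up to its sign, the moment measure of \<open>f\<^sup>*\<close>: the image of the probability density proportional to
  \<open>exp (-f\<^sup>*)\<close> under the gradient of \<open>f\<^sup>*\<close>.  To make everything elementary, \<open>f\<close> is replaced by its restriction
  to a finite set \<open>S\<close>; then \<open>f\<^sup>*\<close> becomes a maximum of finitely many affine functions with slopes in \<open>S\<close>,
  the moment measure charges each \<open>s \<in> S\<close> with the weight of the cell on which the function of slope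
  \<open>s\<close> is the largest, and the tangent inequality is \<open>int_exp_neg_legendre_le\<close>.  Such a measure has finite
  support, which settles the compactly supported version at the same time.  Along finite sets
  that exhaust a countable dense part of the graph of \<open>f\<close>, the maxima increase to \<open>f\<^sup>*\<close> and the integrals converge
  (\<open>finite_affine_sup_approximation\<close>).  Applying this to \<open>f\<close> and to \<open>f\<^sup>*\<close>, the terms \<open>\<integral>f d\<nu>1 + \<integral>f\<^sup>* d\<nu>2\<close>
  on the left cancel against the bound \<open>transport_cost \<nu>1 \<nu>2 \<le> \<integral>f d\<nu>1 + \<integral>f\<^sup>* d\<nu>2\<close>, and the reverse
  Santalo inequality remains.

  The three symmetry classes are treated at once: each is the class of objects invariant
  under a group \<open>E\<close> of sign vectors, namely the trivial group, \<open>{1, -1}\<close> and the group of all sign vectors.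
\<close>

section \<open>The Prekopa-Leindler inequality\<close>

lemma emeasure_lborel_affine_image:
  fixes S :: "real set"
  assumes "compact S"
  shows "emeasure lborel ((\<lambda>x. m * x + d) ` S) = ennreal \<bar>m\<bar> * emeasure lborel S"
proof -
  have [measurable]: "S \<in> sets borel" "(\<lambda>x. m * x + d) ` S \<in> sets borel"
    using assms by (auto intro!: borel_compact compact_continuous_image continuous_intros)
  show ?thesis
    using emeasure_lebesgue_affine[of m d S] by simp
qed

text \<open>
  Translate the two scaled sets so that the maximum of the one and the minimum of the other meet in
  a common point \<open>m\<close>.  Then they lie on different sides of \<open>m\<close>, both are contained in \<open>C\<close>, and their measures add up.
\<close>

lemma brunn_minkowski_compact_real:
  fixes K L C :: "real set"
  assumes K: "compact K" "K \<noteq> {}" and L: "compact L" "L \<noteq> {}" and C: "C \<in> sets borel"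
    and t: "0 \<le> t" "t \<le> 1"
    and sub: "\<And>a b. a \<in> K \<Longrightarrow> b \<in> L \<Longrightarrow> (1 - t) * a + t * b \<in> C"
  shows "ennreal (1 - t) * emeasure lborel K + ennreal t * emeasure lborel L \<le> emeasure lborel C"
proof -
  obtain a where a: "a \<in> K" "\<And>x. x \<in> K \<Longrightarrow> x \<le> a"
    using compact_attains_sup[OF K] by blast
  obtain b where b: "b \<in> L" "\<And>x. x \<in> L \<Longrightarrow> b \<le> x"
    using compact_attains_inf[OF L] by blast
  define m where "m = (1 - t) * a + t * b"
  define K' where "K' = (\<lambda>x. (1 - t) * x + t * b) ` K"
  define L' where "L' = (\<lambda>x. t * x + (1 - t) * a) ` L"
  have [measurable]: "K' \<in> sets borel" "L' \<in> sets borel"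
    unfolding K'_def L'_def using K L
    by (auto intro!: borel_compact compact_continuous_image continuous_intros)
  have sub': "K' \<union> L' \<subseteq> C"
    using sub a(1) b(1) by (auto simp: K'_def L'_def add.commute)
  have "K' \<inter> L' \<subseteq> {m}"
  proof
    fix z assume z: "z \<in> K' \<inter> L'"
    have "z \<le> m" using z a t by (auto simp: K'_def m_def mult_left_mono)
    moreover have "m \<le> z" using z b t by (auto simp: L'_def m_def mult_left_mono add.commute)
    ultimately show "z \<in> {m}" by simp
  qed
  then have "K' \<inter> L' \<in> null_sets lborel"
    by (meson finite_imp_null_set_lborel finite.emptyI finite.insertI finite_subset)
  then have "emeasure lborel K' + emeasure lborel L' = emeasure lborel (K' \<union> L')"
    by (intro emeasure_Un'[symmetric]) auto
  also have "\<dots> \<le> emeasure lborel C"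
    using sub' C by (intro emeasure_mono) auto
  finally show ?thesis
    using t by (simp add: K'_def L'_def emeasure_lborel_affine_image K L)
qed

lemma emeasure_lborel_inner_compact:
  fixes A :: "real set"
  assumes A: "A \<in> sets borel" and ne: "A \<noteq> {}"
  shows "emeasure lborel A = (SUP K\<in>{K. compact K \<and> K \<noteq> {} \<and> K \<subseteq> A}. emeasure lborel K)"
    (is "_ = (SUP K\<in>?\<K>. _)")
proof (rule antisym)
  obtain a where a: "a \<in> A" using ne by blast
  show "(SUP K\<in>?\<K>. emeasure lborel K) \<le> emeasure lborel A"
    using A by (auto intro!: SUP_least emeasure_mono)
  show "emeasure lborel A \<le> (SUP K\<in>?\<K>. emeasure lborel K)"
  proof (rule ennreal_le_epsilon)
    fix e :: real assume "0 < e"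
    have "A \<in> sets lebesgue" using A by simp
    from sets_lebesgue_inner_closed[OF this \<open>0 < e\<close>]
    obtain T where T: "closed T" "T \<subseteq> A" "emeasure lebesgue (A - T) < ennreal e" by metis
    have [measurable]: "T \<in> sets borel" using T by auto
    define K where "K n = insert a (T \<inter> cball 0 (real n))" for n :: nat
    have K: "K n \<in> ?\<K>" for n
      using T a by (auto simp: K_def closed_Int_compact)
    have "A = T \<union> (A - T)" using T by auto
    then have "emeasure lborel A \<le> emeasure lborel T + emeasure lborel (A - T)"
      using A by (metis \<open>T \<in> sets borel\<close> emeasure_subadditive sets.Diff sets_lborel)
    also have "\<dots> \<le> (SUP n. emeasure lborel (K n)) + ennreal e"
    proof (rule add_mono)
      have "T \<subseteq> (\<Union>n. K n)"
      proof
        fix x assume "x \<in> T"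
        moreover obtain n where "norm x \<le> real n" using real_arch_simple by blast
        ultimately show "x \<in> (\<Union>n. K n)" by (auto simp: K_def)
      qed
      moreover have "range K \<subseteq> sets lborel"
        using K by (auto intro: borel_compact)
      moreover have "incseq K" unfolding K_def incseq_def by auto
      ultimately show "emeasure lborel T \<le> (SUP n. emeasure lborel (K n))"
        by (subst SUP_emeasure_incseq) (auto intro!: emeasure_mono)
      show "emeasure lborel (A - T) \<le> ennreal e" using T A by simp
    qed
    also have "(SUP n. emeasure lborel (K n)) \<le> (SUP K\<in>?\<K>. emeasure lborel K)"
      using K by (intro SUP_mono) blast
    finally show "emeasure lborel A \<le> (SUP K\<in>?\<K>. emeasure lborel K) + ennreal e"
      by (simp add: add_right_mono)
  qed
qed

lemma brunn_minkowski_real: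
  fixes A B C :: "real set"
  assumes A: "A \<in> sets borel" "A \<noteq> {}" and B: "B \<in> sets borel" "B \<noteq> {}"
    and C: "C \<in> sets borel" and t: "0 \<le> t" "t \<le> 1"
    and sub: "\<And>a b. a \<in> A \<Longrightarrow> b \<in> B \<Longrightarrow> (1 - t) * a + t * b \<in> C"
  shows "ennreal (1 - t) * emeasure lborel A + ennreal t * emeasure lborel B \<le> emeasure lborel C"
proof -
  let ?\<K> = "\<lambda>A :: real set. {K. compact K \<and> K \<noteq> {} \<and> K \<subseteq> A}"
  have ne: "?\<K> A \<noteq> {}" "?\<K> B \<noteq> {}"
    using A(2) B(2) by (metis (mono_tags, lifting) Collect_empty_eq bot.extremum compact_sing equals0I insert_not_empty insert_subset)+
  have "ennreal (1 - t) * emeasure lborel A + ennreal t * emeasure lborel B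
      = (SUP K\<in>?\<K> A. SUP L\<in>?\<K> B. ennreal (1 - t) * emeasure lborel K + ennreal t * emeasure lborel L)"
    unfolding emeasure_lborel_inner_compact[OF A] emeasure_lborel_inner_compact[OF B]
      SUP_mult_left_ennreal
    by (simp only: ennreal_SUP_add_left[OF ne(1), symmetric] ennreal_SUP_add_right[OF ne(2)])
      (rule SUP_commute)
  also have "\<dots> \<le> emeasure lborel C"
  proof (intro SUP_least)
    fix K L assume "K \<in> ?\<K> A" "L \<in> ?\<K> B"
    then show "ennreal (1 - t) * emeasure lborel K + ennreal t * emeasure lborel L
        \<le> emeasure lborel C"
      using sub by (intro brunn_minkowski_compact_real C t) auto
  qed
  finally show ?thesis .
qed


text \<open>
  Layer-cake formulas on the unit interval.  The integration over the relative level \<open>s\<close>, with the height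
  \<open>A\<close> factored out, is what allows level sets of functions of different heights to be compared.
\<close>

lemma nn_integral_level_sets_bounded:
  fixes F :: "real \<Rightarrow> ennreal"
  assumes [measurable]: "F \<in> borel_measurable borel" and A: "0 < A" and le: "\<And>x. F x \<le> ennreal A"
  shows "(\<integral>\<^sup>+s. indicator {0<..<1} s * emeasure lborel {x. ennreal (s * A) < F x} \<partial>lborel)
    = (\<integral>\<^sup>+x. F x \<partial>lborel) * ennreal (1 / A)"
proof -
  have "(\<integral>\<^sup>+s. indicator {0<..<1} s * emeasure lborel {x. ennreal (s * A) < F x} \<partial>lborel)
      = (\<integral>\<^sup>+s. (\<integral>\<^sup>+x. indicator {0<..<1} s * indicator {x. ennreal (s * A) < F x} x \<partial>lborel) \<partial>lborel)"
    by (intro nn_integral_cong) (simp add: nn_integral_cmult)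
  also have "\<dots> = (\<integral>\<^sup>+x. (\<integral>\<^sup>+s. indicator {0<..<1} s * indicator {x. ennreal (s * A) < F x} x \<partial>lborel) \<partial>lborel)"
    by (rule lborel_pair.Fubini') simp
  also have "\<dots> = (\<integral>\<^sup>+x. F x * ennreal (1 / A) \<partial>lborel)"
  proof (intro nn_integral_cong)
    fix x
    obtain v where v: "F x = ennreal v" "0 \<le> v" "v \<le> A"
      using le[of x] A by (cases "F x") (auto simp: top_unique)
    have lt1: "s < 1" if "s * A < v" for s
      using that v(3) A by (smt (verit) mult_le_cancel_right1)
    have "(\<integral>\<^sup>+s. indicator {0<..<1} s * indicator {x. ennreal (s * A) < F x} x \<partial>lborel)
        = (\<integral>\<^sup>+s. indicator {0<..<v / A} s \<partial>lborel)"
      using A v lt1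
      by (intro nn_integral_cong) (auto simp: indicator_def field_simps ennreal_less_iff)
    also have "\<dots> = F x * ennreal (1 / A)"
      using A v by (simp add: ennreal_mult[symmetric])
    finally show "(\<integral>\<^sup>+s. indicator {0<..<1} s * indicator {x. ennreal (s * A) < F x} x \<partial>lborel)
      = F x * ennreal (1 / A)" .
  qed
  also have "\<dots> = (\<integral>\<^sup>+x. F x \<partial>lborel) * ennreal (1 / A)"
    by (rule nn_integral_multc) simp
  finally show ?thesis .
qed

lemma nn_integral_level_sets_le:
  fixes F :: "real \<Rightarrow> ennreal"
  assumes [measurable]: "F \<in> borel_measurable borel" and A: "0 < A"
  shows "(\<integral>\<^sup>+s. indicator {0<..<1} s * emeasure lborel {x. ennreal (s * A) \<le> F x} \<partial>lborel)
    \<le> (\<integral>\<^sup>+x. F x \<partial>lborel) * ennreal (1 / A)"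
proof -
  have "(\<integral>\<^sup>+s. indicator {0<..<1} s * emeasure lborel {x. ennreal (s * A) \<le> F x} \<partial>lborel)
      = (\<integral>\<^sup>+s. (\<integral>\<^sup>+x. indicator {0<..<1} s * indicator {x. ennreal (s * A) \<le> F x} x \<partial>lborel) \<partial>lborel)"
    by (intro nn_integral_cong) (simp add: nn_integral_cmult)
  also have "\<dots> = (\<integral>\<^sup>+x. (\<integral>\<^sup>+s. indicator {0<..<1} s * indicator {x. ennreal (s * A) \<le> F x} x \<partial>lborel) \<partial>lborel)"
    by (rule lborel_pair.Fubini') simp
  also have "\<dots> \<le> (\<integral>\<^sup>+x. F x * ennreal (1 / A) \<partial>lborel)"
  proof (intro nn_integral_mono)
    fix x
    show "(\<integral>\<^sup>+s. indicator {0<..<1} s * indicator {x. ennreal (s * A) \<le> F x} x \<partial>lborel)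
      \<le> F x * ennreal (1 / A)"
    proof (cases "F x")
      case (real v)
      have "(\<integral>\<^sup>+s. indicator {0<..<1} s * indicator {x. ennreal (s * A) \<le> F x} x \<partial>lborel)
          \<le> (\<integral>\<^sup>+s. indicator {0..v / A} s \<partial>lborel)"
        using A real
        by (intro nn_integral_mono) (auto simp: indicator_def field_simps)
      also have "\<dots> = F x * ennreal (1 / A)"
        using A real by (simp add: ennreal_mult[symmetric])
      finally show ?thesis .
    qed (use A in \<open>simp add: ennreal_top_mult\<close>)
  qed
  also have "\<dots> = (\<integral>\<^sup>+x. F x \<partial>lborel) * ennreal (1 / A)"
    by (rule nn_integral_multc) simp
  finally show ?thesis .
qed

lemma nn_integral_truncate:
  fixes f :: "'a \<Rightarrow> ennreal"
  assumes [measurable]: "f \<in> borel_measurable M" and "a < (\<integral>\<^sup>+x. f x \<partial>M)"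
  obtains n :: nat where "a < (\<integral>\<^sup>+x. min (f x) (of_nat n) \<partial>M)"
proof -
  have "(SUP n. min (f x) (of_nat n)) = f x" for x
    using inf_SUP[of "f x" "\<lambda>n. of_nat n" UNIV] ennreal_SUP_of_nat_eq_top by (simp add: inf_min)
  then have "(\<integral>\<^sup>+x. f x \<partial>M) = (\<integral>\<^sup>+x. (SUP n. min (f x) (of_nat n)) \<partial>M)" by simp
  also have "\<dots> = (SUP n. \<integral>\<^sup>+x. min (f x) (of_nat n) \<partial>M)"
    by (rule nn_integral_monotone_convergence_SUP)
      (auto simp: incseq_def le_fun_def min_def intro: order_trans of_nat_mono)
  finally show ?thesis
    using assms(2) that by (auto simp: less_SUP_iff)
qed

text \<open>
  The hypothesis and the conclusion of all versions of the Prekopa-Leindler inequality compare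
  extended values through strict real lower bounds \<open>a\<close> and \<open>b\<close>.  This gives a meaning to the geometric mean
  of infinite values, and it gives the conclusion the same form as the hypothesis, which is what an
  induction over the dimension needs.
  
  On the line, \<open>f\<close> and \<open>g\<close> are truncated, so that their suprema \<open>A\<close> and \<open>B\<close> are finite.  For \<open>0 < s < 1\<close> the level
  sets of \<open>f\<close> and \<open>g\<close> at the heights \<open>s A\<close> and \<open>s B\<close> are not empty, and their combination lies in a level
  set of \<open>h\<close>; the Brunn-Minkowski inequality can be integrated over \<open>s\<close>.  The resulting arithmetic mean dominates
  the geometric one.
\<close>

lemma prekopa_leindler_real:
  fixes f g h :: "real \<Rightarrow> ennreal"
  assumes meas [measurable]: "f \<in> borel_measurable borel" "g \<in> borel_measurable borel"
      "h \<in> borel_measurable borel"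
    and t: "0 < t" "t < 1"
    and fgh: "\<And>x y a b. 0 < a \<Longrightarrow> 0 < b \<Longrightarrow> ennreal a < f x \<Longrightarrow> ennreal b < g y \<Longrightarrow>
      ennreal (a powr (1 - t) * b powr t) \<le> h ((1 - t) * x + t * y)"
    and ab: "0 < a" "0 < b" "ennreal a < (\<integral>\<^sup>+x. f x \<partial>lborel)" "ennreal b < (\<integral>\<^sup>+x. g x \<partial>lborel)"
  shows "ennreal (a powr (1 - t) * b powr t) \<le> (\<integral>\<^sup>+x. h x \<partial>lborel)"
proof -
  obtain m where m: "ennreal a < (\<integral>\<^sup>+x. min (f x) (of_nat m) \<partial>lborel)"
    by (rule nn_integral_truncate[OF _ ab(3)]) (simp, blast)
  obtain n where n: "ennreal b < (\<integral>\<^sup>+x. min (g x) (of_nat n) \<partial>lborel)"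
    by (rule nn_integral_truncate[OF _ ab(4)]) (simp, blast)
  define f' where "f' x = min (f x) (of_nat m)" for x
  define g' where "g' x = min (g x) (of_nat n)" for x
  have [measurable]: "f' \<in> borel_measurable borel" "g' \<in> borel_measurable borel"
    unfolding f'_def g'_def by auto
  have sup: "\<exists>A>0. (SUP x. F x) = ennreal A"
    if "\<And>x. F x \<le> of_nat k" "0 < (\<integral>\<^sup>+x. F x \<partial>lborel)" for F :: "real \<Rightarrow> ennreal" and k
  proof -
    have "(SUP x. F x) \<le> of_nat k" using that(1) by (rule SUP_least)
    then obtain A where A: "(SUP x. F x) = ennreal A" "0 \<le> A"
      by (cases "SUP x. F x") (auto simp: top_unique)
    have "A \<noteq> 0"
    proof
      assume "A = 0"
      then have "F x = 0" for x using A SUP_upper[of x UNIV F] by simp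
      then show False using that(2) by simp
    qed
    with A show ?thesis by (intro exI[of _ A]) auto
  qed
  \<comment> \<open>Dividing by the suprema makes the level sets of both functions nonempty for the same
    range of relative heights \<open>s\<close>; without this the Brunn-Minkowski inequality would fail for empty sets.\<close>
  obtain A where A: "0 < A" "(SUP x. f' x) = ennreal A"
    using sup[of f' m] m le_less_trans[of 0] unfolding f'_def by fastforce
  obtain B where B: "0 < B" "(SUP x. g' x) = ennreal B"
    using sup[of g' n] n le_less_trans[of 0] unfolding g'_def by fastforce
  have leA: "f' x \<le> ennreal A" and leB: "g' x \<le> ennreal B" for x
    using SUP_upper[of x UNIV f'] SUP_upper[of x UNIV g'] A B by auto
  define K where "K = A powr (1 - t) * B powr t"
  have K: "0 < K" using A B by (simp add: K_def)
  have level: "ennreal (1 - t) * emeasure lborel {x. ennreal (s * A) < f' x}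
      + ennreal t * emeasure lborel {x. ennreal (s * B) < g' x}
      \<le> emeasure lborel {x. ennreal (s * K) \<le> h x}" if s: "0 < s" "s < 1" for s
  proof (rule brunn_minkowski_real)
    have "ennreal (s * A) < (SUP x. f' x)" "ennreal (s * B) < (SUP x. g' x)"
      using A B s by (auto simp: ennreal_less_iff)
    then show "{x. ennreal (s * A) < f' x} \<noteq> {}" "{x. ennreal (s * B) < g' x} \<noteq> {}"
      by (auto simp: less_SUP_iff)
    fix x y assume "x \<in> {x. ennreal (s * A) < f' x}" "y \<in> {x. ennreal (s * B) < g' x}"
    then have "ennreal ((s * A) powr (1 - t) * (s * B) powr t) \<le> h ((1 - t) * x + t * y)"
      using s A B by (intro fgh) (auto simp: f'_def g'_def)
    moreover have "(s * A) powr (1 - t) * (s * B) powr t = s * K"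
      using s A B by (simp add: K_def powr_mult powr_add[symmetric] mult_ac flip: mult.assoc)
    ultimately show "(1 - t) * x + t * y \<in> {x. ennreal (s * K) \<le> h x}" by simp
  qed (use t in auto)
  have "a powr (1 - t) * b powr t = K * ((a / A) powr (1 - t) * (b / B) powr t)"
    using A B ab by (simp add: K_def powr_divide)
  also have "\<dots> \<le> K * ((1 - t) * (a / A) + t * (b / B))"
    using K A B ab t by (intro mult_left_mono Youngs_inequality_0) auto
  finally have "ennreal (a powr (1 - t) * b powr t) \<le> ennreal (K * ((1 - t) * (a / A) + t * (b / B)))"
    by (rule ennreal_leI)
  also have "\<dots> = ennreal K * (ennreal (1 - t) * (ennreal a * ennreal (1 / A))
      + ennreal t * (ennreal b * ennreal (1 / B)))"
    using t A B ab K by (simp add: ennreal_mult'[symmetric] ennreal_plus[symmetric] del: ennreal_plus)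
  also have "\<dots> \<le> ennreal K * (ennreal (1 - t) * ((\<integral>\<^sup>+x. f' x \<partial>lborel) * ennreal (1 / A))
      + ennreal t * ((\<integral>\<^sup>+x. g' x \<partial>lborel) * ennreal (1 / B)))"
    using m n by (intro mult_left_mono add_mono mult_right_mono) (auto simp: f'_def g'_def)
  also have "\<dots> = ennreal K * (\<integral>\<^sup>+s. indicator {0<..<1} s *
      (ennreal (1 - t) * emeasure lborel {x. ennreal (s * A) < f' x}
      + ennreal t * emeasure lborel {x. ennreal (s * B) < g' x}) \<partial>lborel)"
    using A B leA leB
    by (simp add: nn_integral_level_sets_bounded[symmetric] nn_integral_cmult[symmetric]
        nn_integral_add[symmetric] distrib_left mult_ac)
  also have "\<dots> \<le> ennreal K * (\<integral>\<^sup>+s. indicator {0<..<1} s * emeasure lborel {x. ennreal (s * K) \<le> h x} \<partial>lborel)"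
    using level by (intro mult_left_mono[where c = "ennreal K"] nn_integral_mono) (auto simp: indicator_def)
  also have "\<dots> \<le> ennreal K * ((\<integral>\<^sup>+x. h x \<partial>lborel) * ennreal (1 / K))"
    using K by (intro mult_left_mono nn_integral_level_sets_le) auto
  also have "\<dots> = (\<integral>\<^sup>+x. h x \<partial>lborel)"
    using K by (simp add: mult.left_commute[of "ennreal K"] ennreal_mult'[symmetric])
  finally show ?thesis .
qed


text \<open>
  Induction over the coordinates: by the induction hypothesis, the partial integrals of \<open>f\<close>, \<open>g\<close>, \<open>h\<close>
  over the old coordinates satisfy the hypothesis of the one-dimensional inequality as functions of the new one.
\<close>

lemma prekopa_leindler_PiM:
  fixes f g h :: "('i \<Rightarrow> real) \<Rightarrow> ennreal"
  assumes I: "finite I" and t: "0 < t" "t < 1"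
    and "f \<in> borel_measurable (\<Pi>\<^sub>M i\<in>I. lborel)" "g \<in> borel_measurable (\<Pi>\<^sub>M i\<in>I. lborel)"
      "h \<in> borel_measurable (\<Pi>\<^sub>M i\<in>I. lborel)"
    and "\<And>x y a b. x \<in> extensional I \<Longrightarrow> y \<in> extensional I \<Longrightarrow> 0 < a \<Longrightarrow> 0 < b \<Longrightarrow>
      ennreal a < f x \<Longrightarrow> ennreal b < g y \<Longrightarrow>
      ennreal (a powr (1 - t) * b powr t) \<le> h (\<lambda>i\<in>I. (1 - t) * x i + t * y i)"
    and "0 < a" "0 < b" "ennreal a < (\<integral>\<^sup>+x. f x \<partial>(\<Pi>\<^sub>M i\<in>I. lborel))"
      "ennreal b < (\<integral>\<^sup>+x. g x \<partial>(\<Pi>\<^sub>M i\<in>I. lborel))"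
  shows "ennreal (a powr (1 - t) * b powr t) \<le> (\<integral>\<^sup>+x. h x \<partial>(\<Pi>\<^sub>M i\<in>I. lborel))"
  using I assms(4-)
proof (induction I arbitrary: f g h a b rule: finite_induct)
  case empty
  interpret product_sigma_finite "\<lambda>_. lborel :: real measure" by standard
  have "ennreal a < f (\<lambda>_. undefined)" "ennreal b < g (\<lambda>_. undefined)"
    using empty by (simp_all add: PiM_empty nn_integral_count_space_finite)
  from empty.prems(4)[OF _ _ _ _ this] empty.prems(5,6) show ?case
    by (simp add: PiM_empty nn_integral_count_space_finite restrict_def)
next
  case (insert i I)
  interpret product_sigma_finite "\<lambda>_. lborel :: real measure" by standard
  interpret I: finite_product_sigma_finite "\<lambda>_. lborel :: real measure" I
    using insert by unfold_locales auto
  let ?P = "\<Pi>\<^sub>M i\<in>I. (lborel :: real measure)"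
  note [measurable] = insert.prems(1-3)
  have upd [measurable]: "(\<lambda>x. x(i := y)) \<in> measurable ?P (\<Pi>\<^sub>M i\<in>insert i I. (lborel :: real measure))" for y
    by (rule measurable_fun_upd[of _ I]) auto
  have split: "(\<integral>\<^sup>+x. F x \<partial>(\<Pi>\<^sub>M i\<in>insert i I. lborel)) = (\<integral>\<^sup>+y. (\<integral>\<^sup>+x. F (x(i := y)) \<partial>?P) \<partial>lborel)"
    if "F \<in> borel_measurable (\<Pi>\<^sub>M i\<in>insert i I. (lborel :: real measure))" for F :: "_ \<Rightarrow> ennreal"
    using insert that by (intro product_nn_integral_insert_rev) auto
  show ?case
    unfolding split[OF insert.prems(3)]
  proof (rule prekopa_leindler_real[OF _ _ _ t])
    show "0 < a" "0 < b" by fact+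
    show "ennreal a < (\<integral>\<^sup>+y. (\<integral>\<^sup>+x. f (x(i := y)) \<partial>?P) \<partial>lborel)"
      "ennreal b < (\<integral>\<^sup>+y. (\<integral>\<^sup>+x. g (x(i := y)) \<partial>?P) \<partial>lborel)"
      using insert.prems by (simp_all add: split)
    fix y1 y2 a b :: real
    assume ab: "0 < a" "0 < b" "ennreal a < (\<integral>\<^sup>+x. f (x(i := y1)) \<partial>?P)"
      "ennreal b < (\<integral>\<^sup>+x. g (x(i := y2)) \<partial>?P)"
    show "ennreal (a powr (1 - t) * b powr t) \<le> (\<integral>\<^sup>+x. h (x(i := (1 - t) * y1 + t * y2)) \<partial>?P)"
    proof (rule insert.IH[OF _ _ _ _ ab])
      fix x y :: "'i \<Rightarrow> real" and a b :: real
      assume *: "x \<in> extensional I" "y \<in> extensional I" "0 < a" "0 < b"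
        "ennreal a < f (x(i := y1))" "ennreal b < g (y(i := y2))"
      have "ennreal (a powr (1 - t) * b powr t)
          \<le> h (\<lambda>j\<in>insert i I. (1 - t) * (x(i := y1)) j + t * (y(i := y2)) j)"
        using * by (intro insert.prems(4)) (auto simp: extensional_def simp del: fun_upd_apply, auto)
      also have "(\<lambda>j\<in>insert i I. (1 - t) * (x(i := y1)) j + t * (y(i := y2)) j)
          = (\<lambda>j\<in>I. (1 - t) * x j + t * y j)(i := (1 - t) * y1 + t * y2)"
        using insert.hyps by (auto simp: restrict_def)
      finally show "ennreal (a powr (1 - t) * b powr t)
          \<le> h ((\<lambda>j\<in>I. (1 - t) * x j + t * y j)(i := (1 - t) * y1 + t * y2))" .
    qed measurable
  qed measurable
qed

theorem prekopa_leindler: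
  fixes f g h :: "'a::euclidean_space \<Rightarrow> ennreal"
  assumes [measurable]: "f \<in> borel_measurable borel" "g \<in> borel_measurable borel"
      "h \<in> borel_measurable borel"
    and t: "0 < t" "t < 1"
    and fgh: "\<And>x y a b. 0 < a \<Longrightarrow> 0 < b \<Longrightarrow> ennreal a < f x \<Longrightarrow> ennreal b < g y \<Longrightarrow>
      ennreal (a powr (1 - t) * b powr t) \<le> h ((1 - t) *\<^sub>R x + t *\<^sub>R y)"
    and ab: "0 < a" "0 < b" "ennreal a < (\<integral>\<^sup>+x. f x \<partial>lborel)" "ennreal b < (\<integral>\<^sup>+x. g x \<partial>lborel)"
  shows "ennreal (a powr (1 - t) * b powr t) \<le> (\<integral>\<^sup>+x. h x \<partial>lborel)"
proof -
  define T where "T v = (\<Sum>b\<in>Basis. v b *\<^sub>R b)" for v :: "'a \<Rightarrow> real"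
  have [measurable]: "T \<in> measurable (\<Pi>\<^sub>M b\<in>Basis. lborel) borel"
    unfolding T_def by measurable
  have int: "(\<integral>\<^sup>+x. F x \<partial>lborel) = (\<integral>\<^sup>+v. F (T v) \<partial>(\<Pi>\<^sub>M b\<in>Basis. lborel))"
    if [measurable]: "F \<in> borel_measurable borel" for F :: "'a \<Rightarrow> ennreal"
    by (subst lborel_eq) (simp add: nn_integral_distr T_def[symmetric])
  have comb: "T (\<lambda>b\<in>Basis. (1 - t) * x b + t * y b) = (1 - t) *\<^sub>R T x + t *\<^sub>R T y" for x y
    by (simp add: T_def scaleR_add_left sum.distrib scaleR_sum_right)
  show ?thesis
    unfolding int[OF assms(3)]
    by (rule prekopa_leindler_PiM[OF finite_Basis t, where f = "\<lambda>v. f (T v)" and g = "\<lambda>v. g (T v)"])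
      (use ab fgh comb in \<open>simp_all add: int\<close>)
qed

section \<open>Suprema of affine functions and convex conjugation\<close>

text \<open>
  All convex functions below are of this form: a conjugate is an \<open>affine_sup\<close> over the domain of the
  original function, and a maximum of finitely many affine functions is one over a finite set.
\<close>

definition affine_sup :: "'a::real_inner set \<Rightarrow> ('a \<Rightarrow> real) \<Rightarrow> 'a \<Rightarrow> ereal" where
  "affine_sup S a x = (SUP s\<in>S. ereal (s \<bullet> x - a s))"

lemma affine_sup_upper: "s \<in> S \<Longrightarrow> ereal (s \<bullet> x - a s) \<le> affine_sup S a x"
  unfolding affine_sup_def by (rule SUP_upper)

lemma affine_sup_le_iff: "affine_sup S a x \<le> c \<longleftrightarrow> (\<forall>s\<in>S. ereal (s \<bullet> x - a s) \<le> c)"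
  unfolding affine_sup_def by (rule SUP_le_iff)

lemma affine_sup_not_minf: "S \<noteq> {} \<Longrightarrow> affine_sup S a x \<noteq> -\<infinity>"
  using affine_sup_upper[of _ S x a] by fastforce

lemma convex_ereal_affine_sup:
  assumes "S \<noteq> {}"
  shows "convex_ereal (affine_sup S a)"
  unfolding convex_ereal_def
proof (intro allI impI)
  fix x y and u v :: real assume uv: "0 \<le> u" "0 \<le> v" "u + v = 1"
  show "affine_sup S a (u *\<^sub>R x + v *\<^sub>R y) \<le> ereal u * affine_sup S a x + ereal v * affine_sup S a y"
    unfolding affine_sup_le_iff
  proof
    fix s assume s: "s \<in> S"
    have "s \<bullet> (u *\<^sub>R x + v *\<^sub>R y) - a s = u * (s \<bullet> x - a s) + v * (s \<bullet> y - a s)"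
    proof -
      have "a s = u * a s + v * a s" using uv(3) by (metis distrib_right mult_1)
      then show ?thesis by (simp add: inner_add_right right_diff_distrib)
    qed
    then have "ereal (s \<bullet> (u *\<^sub>R x + v *\<^sub>R y) - a s)
        = ereal u * ereal (s \<bullet> x - a s) + ereal v * ereal (s \<bullet> y - a s)" by simp
    also have "\<dots> \<le> ereal u * affine_sup S a x + ereal v * affine_sup S a y"
      using uv s by (intro add_mono ereal_mult_left_mono affine_sup_upper) auto
    finally show "ereal (s \<bullet> (u *\<^sub>R x + v *\<^sub>R y) - a s)
      \<le> ereal u * affine_sup S a x + ereal v * affine_sup S a y" .
  qed
qed

lemma lower_semicont_affine_sup: "lower_semicont (affine_sup S a)"
  unfolding lower_semicont_def
proof (intro allI impI)
  fix x and c assume "c < affine_sup S a x"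
  then obtain s where s: "s \<in> S" "c < ereal (s \<bullet> x - a s)"
    unfolding affine_sup_def less_SUP_iff by blast
  have "((\<lambda>y. ereal (s \<bullet> y - a s)) \<longlongrightarrow> ereal (s \<bullet> x - a s)) (nhds x)"
    by (intro tendsto_ereal tendsto_intros) (simp add: filterlim_def)
  from order_tendstoD(1)[OF this s(2)]
  show "\<forall>\<^sub>F y in nhds x. c < affine_sup S a y"
    by eventually_elim (use s affine_sup_upper in \<open>blast intro: less_le_trans\<close>)
qed

lemma borel_measurable_lower_semicont:
  assumes "lower_semicont f"
  shows "f \<in> borel_measurable borel"
proof (rule borel_measurableI_greater)
  fix c
  have "open {x. c < f x}"
    unfolding open_subopen[of "{x. c < f x}"]
  proof safe
    fix x assume "c < f x"
    then have "\<forall>\<^sub>F y in nhds x. c < f y" using assms by (simp add: lower_semicont_def)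
    then show "\<exists>T. open T \<and> x \<in> T \<and> T \<subseteq> {x. c < f x}"
      unfolding eventually_nhds by blast
  qed
  then show "{x \<in> space borel. c < f x} \<in> sets borel" by simp
qed

lemma legendre_le_iff: "legendre f y \<le> c \<longleftrightarrow> (\<forall>x. ereal (x \<bullet> y) - f x \<le> c)"
  unfolding legendre_def by (simp add: SUP_le_iff)

lemma legendre_upper: "ereal (x \<bullet> y) - f x \<le> legendre f y"
  unfolding legendre_def by (rule SUP_upper) simp

lemma legendre_leI:
  assumes "\<And>x. f x \<noteq> -\<infinity>" "\<And>x. f x \<noteq> \<infinity> \<Longrightarrow> x \<bullet> y - real_of_ereal (f x) \<le> c"
  shows "legendre f y \<le> ereal c"
  unfolding legendre_le_iff
proof
  fix x show "ereal (x \<bullet> y) - f x \<le> ereal c"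
    using assms(1)[of x] assms(2)[of x] by (cases "f x") auto
qed

lemma legendre_eq_affine_sup:
  assumes "\<And>x. f x \<noteq> -\<infinity>"
  shows "legendre f = affine_sup {x. f x \<noteq> \<infinity>} (\<lambda>x. real_of_ereal (f x))"
proof (rule ext, rule antisym)
  fix y
  have *: "ereal (x \<bullet> y - real_of_ereal (f x)) = ereal (x \<bullet> y) - f x" if "f x \<noteq> \<infinity>" for x
    using assms[of x] that by (cases "f x") auto
  show "affine_sup {x. f x \<noteq> \<infinity>} (\<lambda>x. real_of_ereal (f x)) y \<le> legendre f y"
    by (auto simp: affine_sup_le_iff * intro: legendre_upper)
  show "legendre f y \<le> affine_sup {x. f x \<noteq> \<infinity>} (\<lambda>x. real_of_ereal (f x)) y"
    unfolding legendre_le_iff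
  proof
    fix x
    show "ereal (x \<bullet> y) - f x \<le> affine_sup {x. f x \<noteq> \<infinity>} (\<lambda>x. real_of_ereal (f x)) y"
    proof (cases "f x = \<infinity>")
      case False
      then show ?thesis using affine_sup_upper[of x "{x. f x \<noteq> \<infinity>}" y "\<lambda>x. real_of_ereal (f x)"] *[of x]
        by simp
    qed simp
  qed
qed

lemma convex_funsD:
  assumes "f \<in> convex_funs"
  shows "f x \<noteq> -\<infinity>" "\<exists>x. f x \<noteq> \<infinity>" "convex_ereal f" "lower_semicont f" "f \<in> borel_measurable borel"
  using assms by (auto simp: convex_funs_def borel_measurable_lower_semicont)

lemma affine_sup_convex_funs:
  "S \<noteq> {} \<Longrightarrow> affine_sup S a x \<noteq> \<infinity> \<Longrightarrow> affine_sup S a \<in> convex_funs"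
  by (auto simp: convex_funs_def affine_sup_not_minf convex_ereal_affine_sup lower_semicont_affine_sup)

lemma convex_epigraph:
  assumes "convex_ereal f"
  shows "convex {p. f (fst p) \<le> ereal (snd p)}"
proof (rule convexI)
  fix p q and u v :: real
  assume p: "p \<in> {p. f (fst p) \<le> ereal (snd p)}" "q \<in> {p. f (fst p) \<le> ereal (snd p)}"
    and uv: "0 \<le> u" "0 \<le> v" "u + v = 1"
  have "f (u *\<^sub>R fst p + v *\<^sub>R fst q) \<le> ereal u * f (fst p) + ereal v * f (fst q)"
    using assms uv by (simp add: convex_ereal_def)
  also have "\<dots> \<le> ereal u * ereal (snd p) + ereal v * ereal (snd q)"
    using uv p by (intro add_mono ereal_mult_left_mono) auto
  finally show "u *\<^sub>R p + v *\<^sub>R q \<in> {p. f (fst p) \<le> ereal (snd p)}" by simp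
qed

lemma closed_epigraph:
  assumes "lower_semicont f"
  shows "closed {p. f (fst p) \<le> ereal (snd p)}"
proof -
  have "open {p. ereal (snd p) < f (fst p)}"
    unfolding open_subopen[of "{p. ereal (snd p) < f (fst p)}"]
  proof safe
    fix x and s :: real assume "ereal (snd (x, s)) < f (fst (x, s))"
    then obtain r where r: "ereal s < ereal r" "ereal r < f x"
      by (metis ereal_dense2 fst_conv snd_conv)
    then have "\<forall>\<^sub>F y in nhds x. ereal r < f y" using assms by (simp add: lower_semicont_def)
    then obtain U where U: "open U" "x \<in> U" "\<And>y. y \<in> U \<Longrightarrow> ereal r < f y"
      unfolding eventually_nhds by blast
    have "open (U \<times> {..<r})" using U by (intro open_Times) auto
    moreover have "(x, s) \<in> U \<times> {..<r}" using U r by auto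
    moreover have "U \<times> {..<r} \<subseteq> {p. ereal (snd p) < f (fst p)}"
      using U by (auto intro: less_trans[of _ "ereal r"])
    ultimately show "\<exists>T. open T \<and> (x, s) \<in> T \<and> T \<subseteq> {p. ereal (snd p) < f (fst p)}" by blast
  qed
  moreover have "{p. ereal (snd p) < f (fst p)} = - {p. f (fst p) \<le> ereal (snd p)}" by auto
  ultimately show ?thesis by (simp add: closed_def)
qed

text \<open>
  A hyperplane that separates the point \<open>(x0, r)\<close> from the epigraph.  It may be vertical, which is
  the case \<open>\<mu> = 0\<close>.
\<close>

lemma convex_funs_separate:
  assumes f: "f \<in> convex_funs" and r: "ereal r < f x0"
  obtains v b and \<mu> :: real where "0 \<le> \<mu>" "v \<bullet> x0 + \<mu> * r < b"
    "\<And>x. f x \<noteq> \<infinity> \<Longrightarrow> b < v \<bullet> x + \<mu> * real_of_ereal (f x)"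
proof -
  let ?E = "{p. f (fst p) \<le> ereal (snd p)}"
  have "\<exists>w b. w \<bullet> (x0, r) < b \<and> (\<forall>p\<in>?E. w \<bullet> p > b)"
    using convex_epigraph closed_epigraph convex_funsD[OF f] r
    by (intro separating_hyperplane_closed_point) auto
  then obtain v \<mu> b where *: "(v, \<mu>) \<bullet> (x0, r) < b" "\<And>p. p \<in> ?E \<Longrightarrow> (v, \<mu>) \<bullet> p > b"
    by (metis surj_pair)
  have le: "f x \<le> ereal (real_of_ereal (f x) + k)" if "f x \<noteq> \<infinity>" "0 \<le> k" for x and k :: real
    using that convex_funsD(1)[OF f, of x] by (cases "f x") auto
  have b: "b < v \<bullet> x + \<mu> * (real_of_ereal (f x) + k)" if "f x \<noteq> \<infinity>" "0 \<le> k" for x and k :: real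
    using *(2)[of "(x, real_of_ereal (f x) + k)"] le that by simp
  have "0 \<le> \<mu>"
  proof (rule ccontr)
    assume neg: "\<not> 0 \<le> \<mu>"
    obtain x where x: "f x \<noteq> \<infinity>" using convex_funsD(2)[OF f] by blast
    define d where "d = v \<bullet> x + \<mu> * real_of_ereal (f x) - b"
    have "0 < d" using b[OF x, of 0] by (simp add: d_def)
    then have "b < v \<bullet> x + \<mu> * (real_of_ereal (f x) + d / (- \<mu>))"
      using neg by (intro b x) (simp add: field_simps)
    then show False using neg by (simp add: d_def field_simps)
  qed
  then show ?thesis using that[of \<mu> v b] *(1) b[of _ 0] by simp
qed

text \<open>
  A separating hyperplane that is not vertical is the graph of an affine minorant.  At a point of
  the domain it is never vertical, hence some affine minorant exists; a vertical hyperplane at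
  \<open>x0\<close> is then tilted by adding a large multiple of it to that minorant, which changes the latter
  in the right direction on the domain and as much as desired at \<open>x0\<close>.
\<close>

lemma convex_funs_affine_minorant_below:
  assumes f: "f \<in> convex_funs" and r: "ereal r < f x0"
  obtains y a where "\<And>x. ereal (y \<bullet> x - a) \<le> f x" "r < y \<bullet> x0 - a"
proof -
  have minor: "\<exists>y a. (\<forall>x. ereal (y \<bullet> x - a) \<le> f x) \<and> r < y \<bullet> x0 - a"
    if "0 < \<mu>" "v \<bullet> x0 + \<mu> * r < b"
      "\<And>x. f x \<noteq> \<infinity> \<Longrightarrow> b < v \<bullet> x + \<mu> * real_of_ereal (f x)"
    for v x0 and \<mu> b r :: real
  proof (intro exI[of _ "(-1 / \<mu>) *\<^sub>R v"] exI[of _ "- b / \<mu>"] conjI allI)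
    fix x
    show "ereal (((-1 / \<mu>) *\<^sub>R v) \<bullet> x - - b / \<mu>) \<le> f x"
      using that(1) that(3)[of x] convex_funsD(1)[OF f, of x]
      by (cases "f x") (auto simp: field_simps)
    show "r < ((-1 / \<mu>) *\<^sub>R v) \<bullet> x0 - - b / \<mu>"
      using that(1,2) by (simp add: field_simps)
  qed
  obtain v b and \<mu> :: real where sep: "0 \<le> \<mu>" "v \<bullet> x0 + \<mu> * r < b"
    "\<And>x. f x \<noteq> \<infinity> \<Longrightarrow> b < v \<bullet> x + \<mu> * real_of_ereal (f x)"
    using convex_funs_separate[OF f r] by metis
  show ?thesis
  proof (cases "\<mu> = 0")
    case False
    then show ?thesis using minor[of \<mu> v x0 r b] sep that by auto
  next
    case True
    obtain x1 where x1: "f x1 \<noteq> \<infinity>" using convex_funsD(2)[OF f] by blast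
    define r1 where "r1 = real_of_ereal (f x1) - 1"
    have "ereal r1 < f x1"
      using x1 convex_funsD(1)[OF f, of x1] by (cases "f x1") (auto simp: r1_def)
    from convex_funs_separate[OF f this]
    obtain v' b' and \<mu>' :: real where sep': "0 \<le> \<mu>'" "v' \<bullet> x1 + \<mu>' * r1 < b'"
      "\<And>x. f x \<noteq> \<infinity> \<Longrightarrow> b' < v' \<bullet> x + \<mu>' * real_of_ereal (f x)" by metis
    have "\<mu>' \<noteq> 0" using sep'(2) sep'(3)[OF x1] by auto
    then obtain y a where ya: "\<And>x. ereal (y \<bullet> x - a) \<le> f x"
      using minor[of \<mu>' v' x1 r1 b'] sep' by auto
    \<comment> \<open>The multiple for which the tilted minorant exceeds \<open>r\<close> at \<open>x0\<close>.\<close>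
    define k where "k = (\<bar>r - (y \<bullet> x0 - a)\<bar> + 1) / (b - v \<bullet> x0)"
    have pos: "0 < b - v \<bullet> x0" using sep(2) True by simp
    then have k: "0 \<le> k" "k * (b - v \<bullet> x0) = \<bar>r - (y \<bullet> x0 - a)\<bar> + 1" by (auto simp: k_def)
    show ?thesis
    proof (rule that[of "y - k *\<^sub>R v" "a - k * b"])
      fix x
      have eq: "(y - k *\<^sub>R v) \<bullet> x - (a - k * b) = (y \<bullet> x - a) + k * (b - v \<bullet> x)" for x
        by (simp add: inner_diff_left algebra_simps)
      show "ereal ((y - k *\<^sub>R v) \<bullet> x - (a - k * b)) \<le> f x"
      proof (cases "f x = \<infinity>")
        case False
        then have "k * (b - v \<bullet> x) \<le> 0"
          using sep(3)[of x] True k(1) by (intro mult_nonneg_nonpos) auto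
        then have "ereal ((y - k *\<^sub>R v) \<bullet> x - (a - k * b)) \<le> ereal (y \<bullet> x - a)" unfolding eq by simp
        also have "\<dots> \<le> f x" by (rule ya)
        finally show ?thesis .
      qed simp
      show "r < (y - k *\<^sub>R v) \<bullet> x0 - (a - k * b)" unfolding eq using k(2) by auto
    qed
  qed
qed

lemma convex_funs_affine_minorant:
  assumes "f \<in> convex_funs"
  obtains y a where "\<And>x. ereal (y \<bullet> x - a) \<le> f x"
proof -
  obtain x1 where x1: "f x1 \<noteq> \<infinity>" using convex_funsD(2)[OF assms] by blast
  have "ereal (real_of_ereal (f x1) - 1) < f x1"
    using x1 convex_funsD(1)[OF assms, of x1] by (cases "f x1") auto
  from convex_funs_affine_minorant_below[OF assms this] that show ?thesis by metis
qed

lemma legendre_convex_funs: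
  assumes f: "f \<in> convex_funs"
  shows "legendre f \<in> convex_funs"
proof -
  obtain y a where ya: "\<And>x. ereal (y \<bullet> x - a) \<le> f x" using convex_funs_affine_minorant[OF f] by metis
  have "legendre f y \<le> ereal a"
  proof (rule legendre_leI)
    fix x assume "f x \<noteq> \<infinity>"
    then show "x \<bullet> y - real_of_ereal (f x) \<le> a"
      using ya[of x] convex_funsD(1)[OF f, of x] by (cases "f x") (auto simp: inner_commute)
  qed (rule convex_funsD[OF f])
  then have "legendre f y \<noteq> \<infinity>" by auto
  then show ?thesis
    using convex_funsD(1,2)[OF f] by (auto simp: legendre_eq_affine_sup intro!: affine_sup_convex_funs)
qed

text \<open>
  The affine minorants of \<open>f\<close> are exactly the affine functions which the biconjugate takes into
  account, and by the previous separation they come arbitrarily close to \<open>f\<close> at each point.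
\<close>

theorem fenchel_moreau:
  assumes f: "f \<in> convex_funs"
  shows "legendre (legendre f) = f"
proof (rule ext, rule antisym)
  fix x0
  show "legendre (legendre f) x0 \<le> f x0"
    unfolding legendre_le_iff
  proof
    fix y
    have "ereal (x0 \<bullet> y) - f x0 \<le> legendre f y" by (rule legendre_upper)
    then show "ereal (y \<bullet> x0) - legendre f y \<le> f x0"
      using convex_funsD(1)[OF f, of x0]
      by (cases "f x0"; cases "legendre f y") (auto simp: inner_commute)
  qed
  show "f x0 \<le> legendre (legendre f) x0"
  proof (rule ereal_le_real)
    fix r :: real assume "legendre (legendre f) x0 \<le> ereal r"
    show "f x0 \<le> ereal r"
    proof (rule ccontr)
      assume "\<not> f x0 \<le> ereal r"
      then obtain y a where ya: "\<And>x. ereal (y \<bullet> x - a) \<le> f x" "r < y \<bullet> x0 - a"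
        using convex_funs_affine_minorant_below[OF f, of r x0] by (metis not_le)
      have "legendre f y \<le> ereal a"
      proof (rule legendre_leI)
        fix x assume "f x \<noteq> \<infinity>"
        then show "x \<bullet> y - real_of_ereal (f x) \<le> a"
          using ya(1)[of x] convex_funsD(1)[OF f, of x] by (cases "f x") (auto simp: inner_commute)
      qed (rule convex_funsD[OF f])
      then have "ereal (y \<bullet> x0) - ereal a \<le> ereal (y \<bullet> x0) - legendre f y"
        by (rule ereal_minus_mono[OF order_refl])
      also have "\<dots> \<le> legendre (legendre f) x0" by (rule legendre_upper)
      also have "\<dots> \<le> ereal r" by fact
      finally show False using ya(2) by simp
    qed
  qed
qed

lemma convex_funs_add_continuous:
  assumes f: "f \<in> convex_funs" and r: "continuous_on UNIV r" "convex_on UNIV r"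
  shows "(\<lambda>x. f x + ereal (r x)) \<in> convex_funs"
  unfolding convex_funs_def
proof (intro CollectI conjI allI)
  fix x show "f x + ereal (r x) \<noteq> -\<infinity>" using convex_funsD(1)[OF f, of x] by (cases "f x") auto
next
  obtain x where "f x \<noteq> \<infinity>" using convex_funsD(2)[OF f] by blast
  then show "\<exists>x. f x + ereal (r x) \<noteq> \<infinity>" by (intro exI[of _ x]) (cases "f x", auto)
next
  show "convex_ereal (\<lambda>x. f x + ereal (r x))"
    unfolding convex_ereal_def
  proof (intro allI impI)
    fix x y and u v :: real assume uv: "0 \<le> u" "0 \<le> v" "u + v = 1"
    have "f (u *\<^sub>R x + v *\<^sub>R y) + ereal (r (u *\<^sub>R x + v *\<^sub>R y))
      \<le> (ereal u * f x + ereal v * f y) + ereal (u * r x + v * r y)"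
      using convex_funsD(3)[OF f] r(2) uv
      by (intro add_mono) (auto simp: convex_ereal_def convex_on_def)
    also have "\<dots> = ereal u * (f x + ereal (r x)) + ereal v * (f y + ereal (r y))"
      using convex_funsD(1)[OF f, of x] convex_funsD(1)[OF f, of y] uv
      by (cases "f x"; cases "f y"; cases "u = 0"; cases "v = 0") (auto simp: algebra_simps)
    finally show "f (u *\<^sub>R x + v *\<^sub>R y) + ereal (r (u *\<^sub>R x + v *\<^sub>R y))
      \<le> ereal u * (f x + ereal (r x)) + ereal v * (f y + ereal (r y))" .
  qed
next
  show "lower_semicont (\<lambda>x. f x + ereal (r x))"
    unfolding lower_semicont_def
  proof (intro allI impI)
    fix x and c assume c: "c < f x + ereal (r x)"
    then have "c - ereal (r x) < f x" by (cases c; cases "f x") auto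
    then obtain s where s: "c - ereal (r x) < ereal s" "ereal s < f x" by (metis ereal_dense2)
    then have "c - ereal s < ereal (r x)" by (cases c) auto
    moreover have "((\<lambda>y. ereal (r y)) \<longlongrightarrow> ereal (r x)) (nhds x)"
      using r(1) by (intro tendsto_ereal) (simp add: continuous_on_eq_continuous_at continuous_at tendsto_at_iff_tendsto_nhds)
    ultimately have "\<forall>\<^sub>F y in nhds x. c - ereal s < ereal (r y)" by (rule order_tendstoD(1)[rotated])
    moreover have "\<forall>\<^sub>F y in nhds x. ereal s < f y"
      using convex_funsD(4)[OF f] s by (simp add: lower_semicont_def)
    ultimately show "\<forall>\<^sub>F y in nhds x. c < f y + ereal (r y)"
    proof eventually_elim
      fix y assume "c - ereal s < ereal (r y)" "ereal s < f y"
      then show "c < f y + ereal (r y)" by (cases c; cases "f y") auto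
    qed
  qed
qed

section \<open>Sign flips and invariant functions\<close>

lemma sign_flip_nth [simp]: "sign_flip e x $ i = e $ i * x $ i"
  by (simp add: sign_flip_def)

lemma linear_sign_flip: "linear (sign_flip e)"
  by (rule linearI) (simp_all add: vec_eq_iff algebra_simps)

lemma borel_measurable_sign_flip [measurable]: "sign_flip e \<in> borel_measurable borel"
  by (intro borel_measurable_continuous_onI linear_continuous_on linear_conv_bounded_linear[THEN iffD1]
      linear_sign_flip)

lemma sign_flip_sign_flip: "sign_flip d (sign_flip e x) = sign_flip (sign_flip d e) x"
  by (simp add: vec_eq_iff mult.assoc)

lemma sign_vectors_square:
  assumes "e \<in> sign_vectors"
  shows "e $ i * e $ i = 1"
  using assms by (auto simp: sign_vectors_def dest!: spec[of _ i])

lemma sign_flip_involution [simp]: "e \<in> sign_vectors \<Longrightarrow> sign_flip e (sign_flip e x) = x"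
  by (simp add: vec_eq_iff sign_vectors_square flip: mult.assoc)

lemma inner_sign_flip_swap: "sign_flip e x \<bullet> y = x \<bullet> sign_flip e y"
  by (simp add: inner_vec_def mult_ac)

lemma inner_sign_flip [simp]: "e \<in> sign_vectors \<Longrightarrow> sign_flip e x \<bullet> sign_flip e y = x \<bullet> y"
  by (simp add: inner_sign_flip_swap)

lemma norm_sign_flip [simp]: "e \<in> sign_vectors \<Longrightarrow> norm (sign_flip e x) = norm x"
  by (simp add: norm_eq_sqrt_inner)

lemma distr_lborel_sign_flip:
  fixes e :: "real ^ 'n"
  assumes "e \<in> sign_vectors"
  shows "distr lborel borel (sign_flip e) = lborel"
proof -
  define c where "c j = e \<bullet> j" for j :: "real ^ 'n"
  have abs_c: "\<bar>c j\<bar> = 1" if "j \<in> Basis" for j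
    using that assms by (auto simp: c_def Basis_vec_def sign_vectors_def cart_eq_inner_axis[symmetric])
      (metis abs_minus_cancel abs_one)
  have flip: "(\<lambda>x. 0 + (\<Sum>j\<in>Basis. (c j * (x \<bullet> j)) *\<^sub>R j)) = sign_flip e"
  proof
    fix x :: "real ^ 'n"
    have "sign_flip e x \<bullet> j = c j * (x \<bullet> j)" if "j \<in> Basis" for j
      using that by (auto simp: c_def Basis_vec_def cart_eq_inner_axis[symmetric])
    then have "(\<Sum>j\<in>Basis. (c j * (x \<bullet> j)) *\<^sub>R j) = (\<Sum>j\<in>Basis. (sign_flip e x \<bullet> j) *\<^sub>R j)"
      by (intro sum.cong) auto
    then show "0 + (\<Sum>j\<in>Basis. (c j * (x \<bullet> j)) *\<^sub>R j) = sign_flip e x"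
      by (simp add: euclidean_representation)
  qed
  have "c j \<noteq> 0" if "j \<in> Basis" for j using abs_c[OF that] by auto
  from lborel_affine_euclidean[of c 0, OF this]
  have "lborel = density (distr lborel borel (sign_flip e)) (\<lambda>_. \<Prod>j\<in>Basis. \<bar>c j\<bar>)"
    unfolding flip .
  moreover have "(\<Prod>j\<in>Basis. \<bar>c j\<bar>) = 1" using abs_c by simp
  ultimately show ?thesis by (simp add: density_1)
qed

lemma nn_integral_lborel_sign_flip:
  assumes [measurable]: "f \<in> borel_measurable borel" and "e \<in> sign_vectors"
  shows "(\<integral>\<^sup>+x. f (sign_flip e x) \<partial>lborel) = (\<integral>\<^sup>+x. f x \<partial>lborel)"
  by (subst (2) distr_lborel_sign_flip[OF assms(2), symmetric]) (simp add: nn_integral_distr)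

text \<open>
  Closure under \<open>sign_flip\<close> is closure under the coordinatewise product; every sign vector
  is its own inverse.
\<close>

definition sign_group :: "(real ^ 'n) set \<Rightarrow> bool" where
  "sign_group E \<longleftrightarrow> finite E \<and> E \<subseteq> sign_vectors \<and> 1 \<in> E \<and> (\<forall>d\<in>E. \<forall>e\<in>E. sign_flip d e \<in> E)"

lemma sign_groupD:
  assumes "sign_group E"
  shows "finite E" "e \<in> E \<Longrightarrow> e \<in> sign_vectors" "1 \<in> E"
    "d \<in> E \<Longrightarrow> e \<in> E \<Longrightarrow> sign_flip d e \<in> E" "0 < card E"
  using assms by (auto simp: sign_group_def card_gt_0_iff)

lemma sign_flip_one [simp]: "sign_flip 1 x = x"
  by (simp add: vec_eq_iff)

lemma sign_flip_commute: "sign_flip d e = sign_flip e d"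
  by (simp add: vec_eq_iff mult.commute)

lemma sum_sign_group_shift:
  assumes E: "sign_group E" and d: "d \<in> E"
  shows "(\<Sum>e\<in>E. F (sign_flip e (sign_flip d x))) = (\<Sum>e\<in>E. F (sign_flip e x))"
proof (rule sum.reindex_bij_witness[of _ "\<lambda>e. sign_flip d e" "\<lambda>e. sign_flip d e"])
  fix e assume "e \<in> E"
  show "F (sign_flip (sign_flip d e) x) = F (sign_flip e (sign_flip d x))"
    by (simp add: sign_flip_sign_flip sign_flip_commute[of d e])
qed (use E d in \<open>auto simp: sign_groupD\<close>)

lemma affine_sup_sign_flip:
  assumes e: "e \<in> sign_vectors" and S: "\<And>s. s \<in> S \<Longrightarrow> sign_flip e s \<in> S \<and> a (sign_flip e s) = a s"
  shows "affine_sup S a (sign_flip e x) = affine_sup S a x"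
proof -
  have le: "affine_sup S a (sign_flip e x) \<le> affine_sup S a x" for x
    unfolding affine_sup_le_iff
    using S affine_sup_upper[of "sign_flip e _" S x a] by (metis inner_sign_flip_swap)
  show ?thesis using le[of x] le[of "sign_flip e x"] e by (intro antisym) auto
qed

definition convex_funs_inv :: "(real ^ 'n) set \<Rightarrow> (real ^ 'n \<Rightarrow> ereal) set" where
  "convex_funs_inv E = {f \<in> convex_funs. \<forall>e\<in>E. \<forall>x. f (sign_flip e x) = f x}"

definition P1_inv :: "(real ^ 'n) set \<Rightarrow> (real ^ 'n) measure set" where
  "P1_inv E = {\<nu> \<in> P1. \<forall>e\<in>E. distr \<nu> borel (sign_flip e) = \<nu>}"

lemma legendre_sign_flip:
  assumes e: "e \<in> sign_vectors"
  shows "legendre f (sign_flip e y) = legendre (\<lambda>x. f (sign_flip e x)) y"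
proof -
  have bij: "bij (sign_flip e)" using e by (intro o_bij[of "sign_flip e"]) auto
  have "legendre f (sign_flip e y) = (SUP x\<in>range (sign_flip e). ereal (x \<bullet> sign_flip e y) - f x)"
    using bij unfolding legendre_def by (simp add: bij_is_surj)
  also have "\<dots> = legendre (\<lambda>x. f (sign_flip e x)) y"
    using e by (simp add: legendre_def image_comp)
  finally show ?thesis .
qed

lemma legendre_convex_funs_inv:
  assumes "sign_group E" "f \<in> convex_funs_inv E"
  shows "legendre f \<in> convex_funs_inv E"
  using assms legendre_sign_flip[of _ f]
  by (auto simp: convex_funs_inv_def legendre_convex_funs sign_groupD)

section \<open>Integrals of extended real functions\<close>

lemma exp_neg_ereal [simp]: "exp_neg (ereal r) = ennreal (exp (- r))"
  and exp_neg_PInf [simp]: "exp_neg \<infinity> = 0"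
  and exp_neg_MInf [simp]: "exp_neg (-\<infinity>) = \<infinity>"
  by (simp_all add: exp_neg_def)

lemma exp_neg_antimono: "a \<le> b \<Longrightarrow> exp_neg b \<le> exp_neg a"
  by (cases a; cases b) (auto simp: exp_neg_def)

lemma exp_neg_pos_iff: "0 < exp_neg a \<longleftrightarrow> a \<noteq> \<infinity>"
  by (cases a) auto

lemma borel_measurable_exp_neg [measurable (raw)]:
  assumes "f \<in> borel_measurable M"
  shows "(\<lambda>x. exp_neg (f x)) \<in> borel_measurable M"
proof -
  have "exp_neg \<in> borel_measurable borel"
    unfolding exp_neg_def by (intro measurable_If) auto
  from measurable_compose[OF assms this] show ?thesis .
qed

lemma ennreal_nn_integrals_of_integrable:
  fixes r :: "'a \<Rightarrow> real"
  assumes r: "integrable M r"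
  shows "(\<integral>\<^sup>+x. ennreal (r x) \<partial>M) \<noteq> \<infinity>" "(\<integral>\<^sup>+x. ennreal (- r x) \<partial>M) \<noteq> \<infinity>"
    "enn2ereal (\<integral>\<^sup>+x. ennreal (r x) \<partial>M) - enn2ereal (\<integral>\<^sup>+x. ennreal (- r x) \<partial>M) = ereal (\<integral>x. r x \<partial>M)"
proof -
  show fin: "(\<integral>\<^sup>+x. ennreal (r x) \<partial>M) \<noteq> \<infinity>" "(\<integral>\<^sup>+x. ennreal (- r x) \<partial>M) \<noteq> \<infinity>"
    using r real_integrable_def by blast+
  obtain p where p: "(\<integral>\<^sup>+x. ennreal (r x) \<partial>M) = ennreal p" "0 \<le> p"
    using fin(1) by (cases "\<integral>\<^sup>+x. ennreal (r x) \<partial>M") auto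
  obtain q where q: "(\<integral>\<^sup>+x. ennreal (- r x) \<partial>M) = ennreal q" "0 \<le> q"
    using fin(2) by (cases "\<integral>\<^sup>+x. ennreal (- r x) \<partial>M") auto
  show "enn2ereal (\<integral>\<^sup>+x. ennreal (r x) \<partial>M) - enn2ereal (\<integral>\<^sup>+x. ennreal (- r x) \<partial>M)
      = ereal (\<integral>x. r x \<partial>M)"
    unfolding real_lebesgue_integral_def[OF r] using p q by (simp add: enn2ereal_ennreal)
qed

lemma ext_integral_le:
  assumes r: "integrable M r" and le: "AE x in M. f x \<le> ereal (r x)"
  shows "ext_integral M f \<le> ereal (\<integral>x. r x \<partial>M)"
proof -
  have "ext_integral M f \<le> enn2ereal (\<integral>\<^sup>+x. ennreal (r x) \<partial>M) - enn2ereal (\<integral>\<^sup>+x. ennreal (- r x) \<partial>M)"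
    unfolding ext_integral_def
  proof (intro ereal_minus_mono)
    show "enn2ereal (\<integral>\<^sup>+x. e2ennreal (f x) \<partial>M) \<le> enn2ereal (\<integral>\<^sup>+x. ennreal (r x) \<partial>M)"
      unfolding less_eq_ennreal.rep_eq[symmetric]
      using le by (intro nn_integral_mono_AE, eventually_elim) (simp only: e2ennreal_mono flip: e2ennreal_ereal)
    show "enn2ereal (\<integral>\<^sup>+x. ennreal (- r x) \<partial>M) \<le> enn2ereal (\<integral>\<^sup>+x. e2ennreal (- f x) \<partial>M)"
      unfolding less_eq_ennreal.rep_eq[symmetric]
      using le by (intro nn_integral_mono_AE, eventually_elim)
        (simp only: e2ennreal_mono ereal_minus_le_minus flip: e2ennreal_ereal uminus_ereal.simps(1))
  qed
  then show ?thesis by (simp add: ennreal_nn_integrals_of_integrable[OF r])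
qed

lemma ext_integral_ge:
  assumes r: "integrable M r" and le: "AE x in M. ereal (r x) \<le> f x"
  shows "ereal (\<integral>x. r x \<partial>M) \<le> ext_integral M f"
proof -
  have "enn2ereal (\<integral>\<^sup>+x. ennreal (r x) \<partial>M) - enn2ereal (\<integral>\<^sup>+x. ennreal (- r x) \<partial>M) \<le> ext_integral M f"
    unfolding ext_integral_def
  proof (intro ereal_minus_mono)
    show "enn2ereal (\<integral>\<^sup>+x. ennreal (r x) \<partial>M) \<le> enn2ereal (\<integral>\<^sup>+x. e2ennreal (f x) \<partial>M)"
      unfolding less_eq_ennreal.rep_eq[symmetric]
      using le by (intro nn_integral_mono_AE, eventually_elim) (simp only: e2ennreal_mono flip: e2ennreal_ereal)
    show "enn2ereal (\<integral>\<^sup>+x. e2ennreal (- f x) \<partial>M) \<le> enn2ereal (\<integral>\<^sup>+x. ennreal (- r x) \<partial>M)"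
      unfolding less_eq_ennreal.rep_eq[symmetric]
      using le by (intro nn_integral_mono_AE, eventually_elim)
        (simp only: e2ennreal_mono ereal_minus_le_minus flip: e2ennreal_ereal uminus_ereal.simps(1))
  qed
  then show ?thesis by (simp add: ennreal_nn_integrals_of_integrable[OF r])
qed

lemma ext_integral_eq:
  assumes r: "integrable M r" and eq: "AE x in M. f x = ereal (r x)"
  shows "ext_integral M f = ereal (\<integral>x. r x \<partial>M)"
proof (rule antisym)
  show "ext_integral M f \<le> ereal (\<integral>x. r x \<partial>M)"
    using eq by (intro ext_integral_le r) (auto elim: eventually_mono)
  show "ereal (\<integral>x. r x \<partial>M) \<le> ext_integral M f"
    using eq by (intro ext_integral_ge r) (auto elim: eventually_mono)
qed

text \<open>
  An extended integral with an integrable minorant is either infinite or an ordinary Bochner integral.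
\<close>

lemma ext_integral_cases:
  assumes [measurable]: "f \<in> borel_measurable M" and l: "integrable M l" "\<And>x. ereal (l x) \<le> f x"
  obtains "ext_integral M f = \<infinity>"
  | "integrable M (\<lambda>x. real_of_ereal (f x))" "AE x in M. f x = ereal (real_of_ereal (f x))"
    "ext_integral M f = ereal (\<integral>x. real_of_ereal (f x) \<partial>M)"
proof (cases "(\<integral>\<^sup>+x. e2ennreal (f x) \<partial>M) = \<infinity>")
  case True
  then show ?thesis using that(1) by (simp add: ext_integral_def)
next
  case False
  have "AE x in M. e2ennreal (f x) \<noteq> \<infinity>"
    using False by (intro nn_integral_noteq_infinite) auto
  then have fin: "AE x in M. f x = ereal (real_of_ereal (f x))"
  proof eventually_elim
    case (elim x)
    then show ?case using l(2)[of x] by (cases "f x") auto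
  qed
  have neg: "(\<integral>\<^sup>+x. ennreal (- real_of_ereal (f x)) \<partial>M) \<noteq> \<infinity>"
  proof -
    have "(\<integral>\<^sup>+x. ennreal (- real_of_ereal (f x)) \<partial>M) \<le> (\<integral>\<^sup>+x. ennreal (- l x) \<partial>M)"
      using fin
    proof (intro nn_integral_mono_AE, eventually_elim)
      case (elim x)
      then show ?case using l(2)[of x] by (intro ennreal_leI) (cases "f x", auto)
    qed
    then show ?thesis using ennreal_nn_integrals_of_integrable(2)[OF l(1)] by (auto simp: top_unique)
  qed
  have "(\<integral>\<^sup>+x. ennreal (real_of_ereal (f x)) \<partial>M) = (\<integral>\<^sup>+x. e2ennreal (f x) \<partial>M)"
    using fin
  proof (intro nn_integral_cong_AE, eventually_elim)
    case (elim x)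
    then show ?case by (cases "f x") (auto simp flip: e2ennreal_ereal)
  qed
  with False neg have "integrable M (\<lambda>x. real_of_ereal (f x))"
    by (simp add: real_integrable_def)
  from that(2)[OF this fin ext_integral_eq[OF this fin]] show ?thesis .
qed

section \<open>The Gibbs variational principle\<close>

lemma nn_integral_exp_abs_finite:
  assumes d: "0 < d"
  shows "(\<integral>\<^sup>+s. ennreal (exp (- d * \<bar>s\<bar>)) \<partial>lborel) < \<infinity>"
proof -
  let ?e = "\<lambda>s. ennreal (exponential_density d s)"
  interpret prob_space "density lborel (exponential_density d)"
    by (rule prob_space_exponential_density[OF d])
  have one: "(\<integral>\<^sup>+s. ?e s \<partial>lborel) = 1"
    using emeasure_space_1 by (simp add: emeasure_density)
  have "(\<integral>\<^sup>+s. ?e (- s) \<partial>lborel) = (\<integral>\<^sup>+s. ?e s \<partial>distr lborel borel uminus)"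
    by (simp add: nn_integral_distr)
  also have "\<dots> = 1" using one by (simp add: lborel_distr_uminus)
  finally have one': "(\<integral>\<^sup>+s. ?e (- s) \<partial>lborel) = 1" .
  have "(\<integral>\<^sup>+s. ennreal (exp (- d * \<bar>s\<bar>)) \<partial>lborel) \<le> (\<integral>\<^sup>+s. ennreal (1 / d) * (?e s + ?e (- s)) \<partial>lborel)"
  proof (intro nn_integral_mono)
    fix s
    have "exp (- d * \<bar>s\<bar>) \<le> (1 / d) * (exponential_density d s + exponential_density d (- s))"
      using d by (auto simp: exponential_density_def mult.commute abs_if)
    then show "ennreal (exp (- d * \<bar>s\<bar>)) \<le> ennreal (1 / d) * (?e s + ?e (- s))"
      using d by (simp add: ennreal_mult'[symmetric] exponential_density_nonneg ennreal_leI flip: ennreal_plus)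
  qed
  also have "\<dots> = ennreal (1 / d) * (1 + 1)"
    by (simp add: nn_integral_cmult nn_integral_add one one')
  also have "\<dots> < \<infinity>"
    by (simp add: ennreal_mult_less_top)
  finally show ?thesis .
qed

text \<open>
  The norm dominates the mean of the absolute values of the coordinates, so the
  integrand is at most a product of one-dimensional exponentials.
\<close>

lemma nn_integral_exp_norm_finite:
  assumes d: "0 < d"
  shows "(\<integral>\<^sup>+x. ennreal (exp (- d * norm (x :: 'a::euclidean_space))) \<partial>lborel) < \<infinity>"
proof -
  interpret product_sigma_finite "\<lambda>_ :: 'a. lborel :: real measure" by standard
  define k where "k = d / DIM('a)"
  have k: "0 < k" using d by (simp add: k_def)
  have "(\<integral>\<^sup>+x. ennreal (exp (- d * norm (x :: 'a))) \<partial>lborel)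
      \<le> (\<integral>\<^sup>+x. (\<Prod>b\<in>Basis. ennreal (exp (- k * \<bar>(x :: 'a) \<bullet> b\<bar>))) \<partial>lborel)"
  proof (intro nn_integral_mono)
    fix x :: 'a
    have "(\<Sum>b\<in>Basis. \<bar>x \<bullet> b\<bar>) \<le> (\<Sum>b\<in>(Basis :: 'a set). norm x)"
      by (intro sum_mono Basis_le_norm)
    then have "k * (\<Sum>b\<in>Basis. \<bar>x \<bullet> b\<bar>) \<le> d * norm x"
      using d by (simp add: k_def field_simps mult_left_mono)
    then have "exp (- d * norm x) \<le> (\<Prod>b\<in>Basis. exp (- k * \<bar>x \<bullet> b\<bar>))"
      by (simp add: exp_sum[symmetric] sum_distrib_left sum_negf)
    then show "ennreal (exp (- d * norm x)) \<le> (\<Prod>b\<in>Basis. ennreal (exp (- k * \<bar>x \<bullet> b\<bar>)))"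
      by (simp add: prod_ennreal ennreal_leI)
  qed
  also have "\<dots> = (\<integral>\<^sup>+v. (\<Prod>b\<in>Basis. ennreal (exp (- k * \<bar>v b\<bar>))) \<partial>(\<Pi>\<^sub>M b\<in>(Basis :: 'a set). lborel))"
    by (subst lborel_eq) (simp add: nn_integral_distr)
  also have "\<dots> = (\<Prod>b\<in>(Basis :: 'a set). \<integral>\<^sup>+s. ennreal (exp (- k * \<bar>s\<bar>)) \<partial>lborel)"
    by (rule product_nn_integral_prod) auto
  also have "\<dots> < \<infinity>"
    using nn_integral_exp_abs_finite[OF k] by (simp add: power_less_top_ennreal)
  finally show ?thesis .
qed

lemma P1D:
  assumes "\<nu> \<in> P1"
  shows "prob_space \<nu>" "sets \<nu> = sets borel" "space \<nu> = UNIV" "integrable \<nu> norm"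
    "integrable \<nu> (\<lambda>x. y \<bullet> x - a)"
proof -
  show *: "prob_space \<nu>" "sets \<nu> = sets borel" "integrable \<nu> norm"
    using assms by (auto simp: P1_def borel_probs_def)
  then show "space \<nu> = UNIV" by (metis sets_eq_imp_space_eq space_borel)
  interpret prob_space \<nu> by fact
  have [measurable_cong]: "sets \<nu> = sets borel" by fact
  have "integrable \<nu> (\<lambda>x. y \<bullet> x)"
    by (rule Bochner_Integration.integrable_bound[of \<nu> "\<lambda>x. norm y * norm x"])
      (use * in \<open>auto simp: Cauchy_Schwarz_ineq2\<close>)
  then show "integrable \<nu> (\<lambda>x. y \<bullet> x - a)" by simp
qed

text \<open>
  This half of the Gibbs variational principle is the nonnegativity of relative entropy.  For the
  density \<open>h\<close> of \<open>\<eta>\<close> and \<open>w = exp (- u - k)\<close>, whose integral is at most 1, the pointwise inequality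
  \<open>h ln h \<ge> h - w - h (u + k)\<close> is integrated.
\<close>

lemma gibbs_lower:
  assumes \<eta>: "\<eta> \<in> P1" and u: "u \<in> borel_measurable borel" "\<And>x. ereal (y \<bullet> x - a) \<le> u x"
    and E: "int_exp_neg u \<le> ennreal (exp k)"
  shows "ereal (- k) \<le> ext_integral \<eta> u + entropy_Leb \<eta>"
proof (cases "ext_integral \<eta> u = \<infinity> \<or> \<not> absolutely_continuous lborel \<eta>")
  case True
  then show ?thesis by (auto simp: entropy_Leb_def)
next
  case False
  then have ac: "absolutely_continuous lborel \<eta>" by blast
  interpret prob_space \<eta> using P1D[OF \<eta>] by blast
  have sets_\<eta>: "sets \<eta> = sets borel" by (rule P1D[OF \<eta>])
  note [measurable] = u(1)
  define U where "U x = real_of_ereal (u x)" for x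
  have [measurable]: "U \<in> borel_measurable borel" unfolding U_def by measurable
  have "u \<in> borel_measurable \<eta>" using u(1) sets_\<eta> by (simp cong: measurable_cong_sets)
  from ext_integral_cases[OF this P1D(5)[OF \<eta>] u(2)] False
  have U: "integrable \<eta> U" "AE x in \<eta>. u x = ereal (U x)" "ext_integral \<eta> u = ereal (\<integral>x. U x \<partial>\<eta>)"
    unfolding U_def by blast+
  define h where "h x = enn2real (RN_deriv lborel \<eta> x)" for x
  have [measurable]: "h \<in> borel_measurable borel"
    unfolding h_def by measurable
  have h0: "0 \<le> h x" for x by (simp add: h_def)
  have "AE x in lborel. RN_deriv lborel \<eta> x \<noteq> \<infinity>"
    using ac sets_\<eta> by (intro sigma_finite_measure.RN_deriv_finite[OF lborel.sigma_finite_measure_axioms]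
        sigma_finite_measure_axioms) auto
  then have "density lborel (RN_deriv lborel \<eta>) = density lborel (\<lambda>x. ennreal (h x))"
    by (intro density_cong) (auto simp: h_def less_top)
  then have dens: "\<eta> = density lborel (\<lambda>x. ennreal (h x))"
    using sigma_finite_measure.density_RN_deriv[OF lborel.sigma_finite_measure_axioms ac] sets_\<eta> by simp
  have "(\<integral>\<^sup>+x. ennreal (h x) \<partial>lborel) = 1"
    using emeasure_space_1 by (subst (asm) (1) dens) (simp add: emeasure_density P1D(3)[OF \<eta>])
  then have int_h: "integrable lborel h" "(\<integral>x. h x \<partial>lborel) = 1"
    using h0 by (auto intro!: integrableI_nonneg simp: integral_eq_nn_integral)
  have "integrable (density lborel (\<lambda>x. ennreal (h x))) U" using U(1) dens by simp
  then have int_hU: "integrable lborel (\<lambda>x. h x * U x)"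
    using h0 by (simp add: integrable_density)
  have "(\<integral>x. U x \<partial>\<eta>) = (\<integral>x. h x * U x \<partial>lborel)"
    using h0 by (subst dens) (simp add: integral_density)
  note int_U = this
  have "AE x in density lborel (\<lambda>x. ennreal (h x)). u x = ereal (U x)"
    unfolding dens[symmetric] by (rule U(2))
  then have u_eq: "AE x in lborel. 0 < h x \<longrightarrow> u x = ereal (U x)"
    by (simp add: AE_density)
  define w where "w x = enn2real (exp_neg (u x)) * exp (- k)" for x
  have [measurable]: "w \<in> borel_measurable borel" unfolding w_def by measurable
  have w0: "0 \<le> w x" for x by (simp add: w_def)
  have "(\<integral>\<^sup>+x. ennreal (w x) \<partial>lborel) \<le> (\<integral>\<^sup>+x. exp_neg (u x) * ennreal (exp (- k)) \<partial>lborel)"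
  proof (intro nn_integral_mono)
    fix x
    have "ennreal (enn2real (exp_neg (u x))) \<le> exp_neg (u x)"
      by (cases "exp_neg (u x)") auto
    then show "ennreal (w x) \<le> exp_neg (u x) * ennreal (exp (- k))"
      by (simp add: w_def ennreal_mult mult_right_mono)
  qed
  also have "\<dots> = int_exp_neg u * ennreal (exp (- k))"
    by (simp add: nn_integral_multc int_exp_neg_def)
  also have "\<dots> \<le> ennreal (exp k) * ennreal (exp (- k))"
    by (intro mult_right_mono E) simp
  also have "\<dots> = 1" by (simp add: ennreal_mult[symmetric] exp_minus)
  finally have w1: "(\<integral>\<^sup>+x. ennreal (w x) \<partial>lborel) \<le> 1" .
  then have int_w: "integrable lborel w"
    using w0 by (intro integrableI_nonneg) (auto simp: top_unique intro: le_less_trans)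
  have "(\<integral>x. w x \<partial>lborel) \<le> 1"
    using w1 w0 int_w by (simp add: nn_integral_eq_integral)
  note int_w = int_w this
  define \<psi> where "\<psi> x = h x - w x - (h x * U x + h x * k)" for x
  have int_\<psi>: "integrable lborel \<psi>"
    unfolding \<psi>_def using int_h int_w int_hU by auto
  have eq_\<psi>: "(\<integral>x. \<psi> x \<partial>lborel) = 1 - (\<integral>x. w x \<partial>lborel) - ((\<integral>x. U x \<partial>\<eta>) + k)"
    unfolding \<psi>_def int_U using int_h int_w int_hU by simp
  have "ereal (\<integral>x. \<psi> x \<partial>lborel) \<le> ext_integral lborel (\<lambda>x. ereal (h x * ln (h x)))"
  proof (rule ext_integral_ge[OF int_\<psi>])
    show "AE x in lborel. ereal (\<psi> x) \<le> ereal (h x * ln (h x))"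
      using u_eq
    proof eventually_elim
      case (elim x)
      show ?case
      proof (cases "h x = 0")
        case True
        then show ?thesis using w0[of x] by (simp add: \<psi>_def)
      next
        case False
        then have h: "0 < h x" using h0[of x] by simp
        with elim have "w x = exp (- (U x + k))" by (simp add: w_def exp_add[symmetric])
        \<comment> \<open>The bound \<open>ln z \<ge> 1 - 1 / z\<close> at \<open>z = h x / w x\<close>.\<close>
        moreover have "ln (h x) \<ge> - (U x + k) + 1 - exp (- (U x + k)) / h x"
          using ln_le_minus_one[of "exp (- (U x + k)) / h x"] h by (simp add: ln_div)
        then have "h x * ln (h x) \<ge> h x * (- (U x + k) + 1 - exp (- (U x + k)) / h x)"
          using h by (simp add: mult_left_mono)
        moreover have "h x * (- (U x + k) + 1 - exp (- (U x + k)) / h x)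
            = h x - exp (- (U x + k)) - (h x * U x + h x * k)"
          using h by (simp add: field_simps)
        ultimately show ?thesis by (simp add: \<psi>_def)
      qed
    qed
  qed
  also have "\<dots> = entropy_Leb \<eta>"
    using ac by (simp add: entropy_Leb_def h_def Let_def)
  finally have "ereal (\<integral>x. \<psi> x \<partial>lborel) \<le> entropy_Leb \<eta>" .
  then have "ereal (\<integral>x. U x \<partial>\<eta>) + ereal (\<integral>x. \<psi> x \<partial>lborel) \<le> ext_integral \<eta> u + entropy_Leb \<eta>"
    unfolding U(3) by (rule add_left_mono)
  moreover have "ereal (- k) \<le> ereal (\<integral>x. U x \<partial>\<eta>) + ereal (\<integral>x. \<psi> x \<partial>lborel)"
    using int_w(2) by (simp add: eq_\<psi>)
  ultimately show ?thesis by (rule order_trans[rotated])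
qed

text \<open>
  Needed whenever an entropy is moved to the other side of an inequality.  The reason is the Gibbs
  bound with the norm as potential, whose integral is finite because \<open>\<eta>\<close> has a first moment.
\<close>

lemma entropy_not_minf:
  fixes \<eta> :: "(real ^ 'n) measure"
  assumes \<eta>: "\<eta> \<in> P1"
  shows "entropy_Leb \<eta> \<noteq> -\<infinity>"
proof -
  have "int_exp_neg (\<lambda>x :: real ^ 'n. ereal (norm x)) < \<infinity>"
    using nn_integral_exp_norm_finite[of 1, where ?'a = "real ^ 'n"] by (simp add: int_exp_neg_def)
  then obtain K where K: "int_exp_neg (\<lambda>x :: real ^ 'n. ereal (norm x)) = ennreal K" "0 \<le> K"
    by (cases "int_exp_neg (\<lambda>x :: real ^ 'n. ereal (norm x))") auto
  have "K \<le> exp K" using exp_ge_add_one_self[of K] by linarith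
  then have "ereal (- K) \<le> ext_integral \<eta> (\<lambda>x. ereal (norm x)) + entropy_Leb \<eta>"
    using K by (intro gibbs_lower[OF \<eta>, of _ 0 0]) (auto intro: ennreal_leI)
  moreover have "ext_integral \<eta> (\<lambda>x. ereal (norm x)) = ereal (\<integral>x. norm x \<partial>\<eta>)"
    by (rule ext_integral_eq[OF P1D(4)[OF \<eta>]]) simp
  ultimately show ?thesis by auto
qed

lemma integrable_lborel_bounded_cball:
  fixes g :: "'a::euclidean_space \<Rightarrow> real"
  assumes [measurable]: "g \<in> borel_measurable borel"
    and bound: "\<And>x. \<bar>g x\<bar> \<le> M" and supp: "\<And>x. r < norm x \<Longrightarrow> g x = 0"
  shows "integrable lborel g"
proof (rule Bochner_Integration.integrable_bound)
  show "integrable lborel (\<lambda>x :: 'a. M * indicator (cball 0 r) x)"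
    by (intro integrable_mult_right integrable_real_indicator emeasure_bounded_finite) auto
  have "0 \<le> M" using bound[of 0] by linarith
  then show "AE x in lborel. norm (g x) \<le> norm (M * indicator (cball 0 r) x)"
    using bound supp by (intro AE_I2) (auto simp: indicator_def not_le)
qed simp

text \<open>
  The optimal \<open>\<eta>\<close> has a density proportional to \<open>exp (-\<phi>)\<close>.  Cutting it off outside a large ball makes all
  integrals finite, even if \<open>\<phi>\<close> has an infinite \<open>int_exp_neg\<close>, and preserves the invariance because
  sign flips are isometries; the price is that the normalizing constant is only almost attained, which is
  the role of \<open>z\<close>.
\<close>

lemma gibbs_upper:
  fixes \<phi> :: "real ^ 'n \<Rightarrow> ereal"
  assumes E: "sign_group E" and \<phi>: "\<phi> \<in> convex_funs_inv E" and z: "0 < z" "ennreal z < int_exp_neg \<phi>"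
  obtains \<eta> where "\<eta> \<in> P1_inv E" "ext_integral \<eta> \<phi> + entropy_Leb \<eta> \<le> ereal (- ln z)"
proof -
  have conv: "\<phi> \<in> convex_funs" and inv: "\<And>e x. e \<in> E \<Longrightarrow> \<phi> (sign_flip e x) = \<phi> x"
    using \<phi> by (auto simp: convex_funs_inv_def)
  note [measurable] = convex_funsD(5)[OF conv]
  obtain y a where ya: "\<And>x. ereal (y \<bullet> x - a) \<le> \<phi> x" using convex_funs_affine_minorant[OF conv] by metis
  have "(SUP n. exp_neg (\<phi> x) * indicator (cball 0 (real n)) x) = exp_neg (\<phi> x)" for x
  proof (rule antisym)
    obtain n where "norm x \<le> real n" using real_arch_simple by blast
    then show "exp_neg (\<phi> x) \<le> (SUP n. exp_neg (\<phi> x) * indicator (cball 0 (real n)) x)"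
      by (intro SUP_upper2[of n]) auto
  qed (auto intro!: SUP_least simp: indicator_def)
  then have "int_exp_neg \<phi> = (\<integral>\<^sup>+x. (SUP n. exp_neg (\<phi> x) * indicator (cball 0 (real n)) x) \<partial>lborel)"
    by (simp add: int_exp_neg_def)
  also have "\<dots> = (SUP n. \<integral>\<^sup>+x. exp_neg (\<phi> x) * indicator (cball 0 (real n)) x \<partial>lborel)"
    by (intro nn_integral_monotone_convergence_SUP)
      (auto simp: incseq_def le_fun_def indicator_def)
  finally obtain n :: nat where n: "ennreal z < (\<integral>\<^sup>+x. exp_neg (\<phi> x) * indicator (cball 0 (real n)) x \<partial>lborel)"
    using z(2) by (auto simp: less_SUP_iff)
  define q where "q x = real_of_ereal (\<phi> x)" for x
  define B where "B = {x. norm x \<le> real n \<and> \<phi> x \<noteq> \<infinity>}"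
  have [measurable]: "B \<in> sets borel"
  proof -
    have "B = cball 0 (real n) \<inter> (\<phi> -` (- {\<infinity>}) \<inter> space borel)" by (auto simp: B_def)
    moreover have "\<phi> -` (- {\<infinity>}) \<inter> space borel \<in> sets borel"
      by (rule measurable_sets[OF convex_funsD(5)[OF conv]]) simp
    ultimately show ?thesis by simp
  qed
  have [measurable]: "q \<in> borel_measurable borel" unfolding q_def by measurable
  have qB: "\<phi> x = ereal (q x)" if "x \<in> B" for x
    using that convex_funsD(1)[OF conv, of x] by (cases "\<phi> x") (auto simp: q_def B_def)
  define C where "C = norm y * real n + \<bar>a\<bar>"
  have C0: "0 \<le> C" by (simp add: C_def)
  have qC: "- C \<le> q x" if "x \<in> B" for x
  proof -
    have "\<bar>y \<bullet> x\<bar> \<le> norm y * norm x" by (rule Cauchy_Schwarz_ineq2)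
    also have "\<dots> \<le> norm y * real n" using that by (intro mult_left_mono) (auto simp: B_def)
    finally show ?thesis using ya[of x] qB[OF that] by (simp add: C_def)
  qed
  have exp_ind: "exp_neg (\<phi> x) * indicator (cball 0 (real n)) x = ennreal (indicator B x * exp (- q x))" for x
    using qB[of x] by (cases "x \<in> B") (auto simp: B_def indicator_def)
  have int_e: "integrable lborel (\<lambda>x. indicator B x * exp (- q x))"
  proof (rule integrable_lborel_bounded_cball[where r = "real n"])
    show "\<bar>indicator B x * exp (- q x)\<bar> \<le> exp C" for x using qC[of x] by (auto simp: indicator_def)
  qed (auto simp: B_def)
  define Z where "Z = (\<integral>x. indicator B x * exp (- q x) \<partial>lborel)"
  have nnZ: "(\<integral>\<^sup>+x. ennreal (indicator B x * exp (- q x)) \<partial>lborel) = ennreal Z"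
    unfolding Z_def by (rule nn_integral_eq_integral[OF int_e]) auto
  have zZ: "z < Z" using n z(1) unfolding exp_ind nnZ by (simp add: ennreal_less_iff)
  have Z: "0 < Z" using zZ z by simp
  define h where "h x = indicator B x * exp (- q x) / Z" for x
  have [measurable]: "h \<in> borel_measurable borel" unfolding h_def by measurable
  have h0: "0 \<le> h x" for x using Z by (simp add: h_def)
  define \<eta> where "\<eta> = density lborel (\<lambda>x. ennreal (h x))"
  have sets_\<eta>: "sets \<eta> = sets borel" by (simp add: \<eta>_def)
  have nn1: "(\<integral>\<^sup>+x. ennreal (h x) \<partial>lborel) = 1"
  proof -
    have "(\<integral>\<^sup>+x. ennreal (h x) \<partial>lborel) = (\<integral>\<^sup>+x. ennreal (indicator B x * exp (- q x)) * ennreal (1 / Z) \<partial>lborel)"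
      using Z by (intro nn_integral_cong) (simp add: h_def ennreal_mult'[symmetric] del: ennreal_1)
    also have "\<dots> = ennreal Z * ennreal (1 / Z)" by (subst nn_integral_multc) (simp_all add: nnZ)
    also have "\<dots> = 1" using Z by (simp add: ennreal_mult'[symmetric])
    finally show ?thesis .
  qed
  have prob: "prob_space \<eta>"
    by (rule prob_spaceI) (simp add: \<eta>_def emeasure_density nn1)
  have int_h: "integrable lborel h" "(\<integral>x. h x \<partial>lborel) = 1"
    using h0 nn1 by (auto intro!: integrableI_nonneg simp: integral_eq_nn_integral)
  have hb: "h x \<le> exp C / Z" for x
    using qC[of x] Z by (auto simp: h_def indicator_def divide_right_mono)
  have "integrable lborel (\<lambda>x. h x * norm x)"
  proof (rule integrable_lborel_bounded_cball[where r = "real n"])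
    fix x
    have "h x * norm x \<le> exp C / Z * real n"
    proof (cases "x \<in> B")
      case True
      then show ?thesis using hb[of x] Z by (intro mult_mono) (auto simp: B_def)
    qed (use Z in \<open>simp add: h_def\<close>)
    then show "\<bar>h x * norm x\<bar> \<le> exp C / Z * real n" using h0[of x] by (simp add: abs_mult)
  qed (auto simp: h_def B_def)
  then have "integrable \<eta> norm" unfolding \<eta>_def using h0 by (simp add: integrable_density)
  then have P1: "\<eta> \<in> P1" using prob sets_\<eta> by (simp add: P1_def borel_probs_def)
  have "distr \<eta> borel (sign_flip e) = \<eta>" if e: "e \<in> E" for e
  proof (rule measure_eqI)
    note es = sign_groupD(2)[OF E e]
    have h_inv: "h (sign_flip e x) = h x" for x
      using inv[OF e, of x] es by (simp add: h_def q_def B_def indicator_def)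
    fix A assume "A \<in> sets (distr \<eta> borel (sign_flip e))"
    then have [measurable]: "A \<in> sets borel" by simp
    have "emeasure (distr \<eta> borel (sign_flip e)) A = emeasure \<eta> (sign_flip e -` A)"
      by (subst emeasure_distr) (auto simp: \<eta>_def)
    also have "\<dots> = (\<integral>\<^sup>+x. ennreal (h x) * indicator (sign_flip e -` A) x \<partial>lborel)"
      unfolding \<eta>_def using measurable_sets[OF borel_measurable_sign_flip \<open>A \<in> sets borel\<close>, of e]
      by (subst emeasure_density) auto
    also have "\<dots> = (\<integral>\<^sup>+x. ennreal (h (sign_flip e x)) * indicator A (sign_flip e x) \<partial>lborel)"
      by (intro nn_integral_cong) (simp add: h_inv indicator_def)
    also have "\<dots> = (\<integral>\<^sup>+x. ennreal (h x) * indicator A x \<partial>lborel)"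
      by (rule nn_integral_lborel_sign_flip[OF _ es]) simp
    also have "\<dots> = emeasure \<eta> A" by (simp add: \<eta>_def emeasure_density)
    finally show "emeasure (distr \<eta> borel (sign_flip e)) A = emeasure \<eta> A" .
  qed (simp add: \<eta>_def)
  with P1 have P: "\<eta> \<in> P1_inv E" by (simp add: P1_inv_def)
  have int_hq: "integrable lborel (\<lambda>x. h x * q x)"
  proof (rule integrable_lborel_bounded_cball[where r = "real n"])
    fix x
    show "\<bar>h x * q x\<bar> \<le> (C * exp C + 1) / Z"
    proof (cases "x \<in> B")
      case True
      have "\<bar>exp (- q x) * q x\<bar> \<le> C * exp C + 1"
      proof (cases "0 \<le> q x")
        case True
        have "q x \<le> exp (q x)" using exp_ge_add_one_self[of "q x"] by linarith
        then have "exp (- q x) * q x \<le> 1" by (simp add: exp_minus field_simps)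
        moreover have "0 \<le> C * exp C" using C0 by simp
        ultimately show ?thesis using True by (simp add: abs_mult)
      next
        case False
        have "exp (- q x) * \<bar>q x\<bar> \<le> exp C * C"
          using qC[OF True] False C0 by (intro mult_mono) auto
        then show ?thesis by (simp add: abs_mult mult.commute)
      qed
      then show ?thesis using Z True by (simp add: h_def abs_mult divide_right_mono)
    next
      case False
      then show ?thesis using Z C0 by (simp add: h_def)
    qed
  qed (auto simp: h_def B_def)
  have ent: "entropy_Leb \<eta> = ereal (- (\<integral>x. h x * q x \<partial>lborel) - ln Z)"
  proof -
    have ac: "absolutely_continuous lborel \<eta>"
      unfolding \<eta>_def by (intro absolutely_continuousI_density) simp
    have RN: "AE x in lborel. ennreal (h x) = RN_deriv lborel \<eta> x"
      by (rule sigma_finite_measure.RN_deriv_unique[OF lborel.sigma_finite_measure_axioms]) (simp_all add: \<eta>_def)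
    have int: "integrable lborel (\<lambda>x. - (h x * q x) - h x * ln Z)"
      using int_h int_hq by simp
    have "ext_integral lborel (\<lambda>x. let h = enn2real (RN_deriv lborel \<eta> x) in ereal (h * ln h))
        = ereal (\<integral>x. - (h x * q x) - h x * ln Z \<partial>lborel)"
    proof (rule ext_integral_eq[OF int])
      show "AE x in lborel. (let h = enn2real (RN_deriv lborel \<eta> x) in ereal (h * ln h))
          = ereal (- (h x * q x) - h x * ln Z)"
        using RN
      proof eventually_elim
        case (elim x)
        then have "enn2real (RN_deriv lborel \<eta> x) = h x" using h0[of x] by (metis enn2real_ennreal)
        moreover have "h x * ln (h x) = - (h x * q x) - h x * ln Z"
          using Z by (cases "x \<in> B") (auto simp: h_def ln_div field_simps)
        ultimately show ?case by (simp add: Let_def)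
      qed
    qed
    then show ?thesis using ac int_h int_hq by (simp add: entropy_Leb_def)
  qed
  have int_q: "integrable \<eta> q" unfolding \<eta>_def using int_hq h0 by (simp add: integrable_density)
  have "AE x in \<eta>. \<phi> x = ereal (q x)"
    unfolding \<eta>_def by (subst AE_density) (auto simp: h_def indicator_def qB intro!: AE_I2)
  then have "ext_integral \<eta> \<phi> = ereal (\<integral>x. q x \<partial>\<eta>)" by (rule ext_integral_eq[OF int_q])
  also have "(\<integral>x. q x \<partial>\<eta>) = (\<integral>x. h x * q x \<partial>lborel)"
    unfolding \<eta>_def using h0 by (simp add: integral_density)
  finally have "ext_integral \<eta> \<phi> + entropy_Leb \<eta> = ereal (- ln Z)" by (simp add: ent)
  also have "\<dots> \<le> ereal (- ln z)" using zZ z by simp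
  finally show ?thesis using that P by blast
qed

text \<open>
  The easy half of the duality: every \<open>g\<close> gives an upper bound for the infimum over \<open>\<eta>\<close>.
\<close>

lemma free_energy_le:
  assumes E: "sign_group E" and g: "g \<in> convex_funs_inv E"
    and r: "ext_integral \<nu> g \<le> ereal r" and z: "0 < z" "ennreal z < int_exp_neg (legendre g)"
  shows "(INF \<eta>\<in>P1_inv E. transport_cost \<nu> \<eta> + entropy_Leb \<eta>) \<le> ereal (r - ln z)"
proof -
  obtain \<eta> where \<eta>: "\<eta> \<in> P1_inv E"
    "ext_integral \<eta> (legendre g) + entropy_Leb \<eta> \<le> ereal (- ln z)"
    using gibbs_upper[OF E legendre_convex_funs_inv[OF E g] z] by metis
  have "(INF \<eta>\<in>P1_inv E. transport_cost \<nu> \<eta> + entropy_Leb \<eta>) \<le> transport_cost \<nu> \<eta> + entropy_Leb \<eta>"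
    using \<eta>(1) by (rule INF_lower)
  also have "transport_cost \<nu> \<eta> \<le> ext_integral \<nu> g + ext_integral \<eta> (legendre g)"
    unfolding transport_cost_def using g by (intro INF_lower) (simp add: convex_funs_inv_def)
  also have "ext_integral \<nu> g + ext_integral \<eta> (legendre g) + entropy_Leb \<eta> \<le> ereal r + ereal (- ln z)"
    unfolding add.assoc by (intro add_mono r \<eta>(2))
  finally show ?thesis by (simp add: add_right_mono)
qed

section \<open>From the reverse Santalo inequality to the transport-entropy inequality\<close>

lemma int_exp_neg_pos:
  fixes u :: "real ^ 'n \<Rightarrow> ereal"
  assumes [measurable]: "u \<in> borel_measurable borel"
    and d: "0 < d" and fin: "\<And>w. norm w \<le> d \<Longrightarrow> u (x0 + w) \<noteq> \<infinity>"
  shows "0 < int_exp_neg u"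
proof (rule ccontr)
  assume "\<not> 0 < int_exp_neg u"
  then have "AE x in lborel. exp_neg (u x) = 0"
    by (simp add: int_exp_neg_def nn_integral_0_iff_AE)
  then have "AE x in lborel. x \<notin> ball x0 d"
  proof eventually_elim
    case (elim x)
    show ?case
    proof
      assume "x \<in> ball x0 d"
      then have "norm (x - x0) \<le> d" by (simp add: dist_norm norm_minus_commute)
      from fin[OF this] show False using elim exp_neg_pos_iff[of "u x"] by simp
    qed
  qed
  then have "ball x0 d \<in> null_sets lborel"
    by (subst AE_iff_null_sets) auto
  then have "emeasure lborel (ball x0 d) = 0" by auto
  then show False using d unit_ball_vol_pos[of "real CARD('n)"] by (simp add: emeasure_ball)
qed

lemma P1_invD:
  assumes "\<nu> \<in> P1_inv E"
  shows "\<nu> \<in> P1" "e \<in> E \<Longrightarrow> distr \<nu> borel (sign_flip e) = \<nu>"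
  using assms by (auto simp: P1_inv_def)

lemma AE_P1_inv_flip:
  assumes E: "sign_group E" and \<nu>: "\<nu> \<in> P1_inv E"
    and [measurable]: "f \<in> borel_measurable borel" and ae: "AE x in \<nu>. f x = ereal (real_of_ereal (f x))"
  shows "AE x in \<nu>. \<forall>e\<in>E. f (sign_flip e x) \<noteq> \<infinity>"
proof (rule AE_finite_allI[OF sign_groupD(1)[OF E]])
  fix e assume e: "e \<in> E"
  have [measurable_cong]: "sets \<nu> = sets borel" using P1D P1_invD[OF \<nu>] by blast
  have "AE x in distr \<nu> borel (sign_flip e). f x = ereal (real_of_ereal (f x))"
    unfolding P1_invD(2)[OF \<nu> e] by (rule ae)
  then have "AE x in \<nu>. f (sign_flip e x) = ereal (real_of_ereal (f (sign_flip e x)))"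
    by (subst (asm) AE_distr_iff) auto
  then show "AE x in \<nu>. f (sign_flip e x) \<noteq> \<infinity>" by eventually_elim auto
qed

lemma integral_P1_inv_average:
  assumes E: "sign_group E" and \<nu>: "\<nu> \<in> P1_inv E"
    and [measurable]: "F \<in> borel_measurable borel" and F: "integrable \<nu> F"
  shows "integrable \<nu> (\<lambda>x. (\<Sum>e\<in>E. F (sign_flip e x)) / card E + d * norm x)"
    "(\<integral>x. (\<Sum>e\<in>E. F (sign_flip e x)) / card E + d * norm x \<partial>\<nu>) = (\<integral>x. F x \<partial>\<nu>) + d * (\<integral>x. norm x \<partial>\<nu>)"
proof -
  have [measurable_cong]: "sets \<nu> = sets borel" using P1D P1_invD[OF \<nu>] by blast
  have int: "integrable \<nu> (\<lambda>x. F (sign_flip e x))" "(\<integral>x. F (sign_flip e x) \<partial>\<nu>) = (\<integral>x. F x \<partial>\<nu>)" if "e \<in> E" for e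
  proof -
    note eq = P1_invD(2)[OF \<nu> that]
    show "integrable \<nu> (\<lambda>x. F (sign_flip e x))"
      using F by (subst (asm) eq[symmetric]) (simp add: integrable_distr_eq)
    show "(\<integral>x. F (sign_flip e x) \<partial>\<nu>) = (\<integral>x. F x \<partial>\<nu>)"
      by (subst (2) eq[symmetric]) (simp add: integral_distr)
  qed
  have int_sum: "integrable \<nu> (\<lambda>x. (\<Sum>e\<in>E. F (sign_flip e x)) / card E)"
    using int by (intro integrable_divide Bochner_Integration.integrable_sum) auto
  have int_norm: "integrable \<nu> (\<lambda>x. d * norm x)"
    using P1D(4)[OF P1_invD(1)[OF \<nu>]] by simp
  show "integrable \<nu> (\<lambda>x. (\<Sum>e\<in>E. F (sign_flip e x)) / card E + d * norm x)"
    using int_sum int_norm by simp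
  have "(\<integral>x. (\<Sum>e\<in>E. F (sign_flip e x)) / card E + d * norm x \<partial>\<nu>)
      = (\<integral>x. (\<Sum>e\<in>E. F (sign_flip e x)) / card E \<partial>\<nu>) + (\<integral>x. d * norm x \<partial>\<nu>)"
    by (rule Bochner_Integration.integral_add[OF int_sum int_norm])
  also have "(\<integral>x. (\<Sum>e\<in>E. F (sign_flip e x)) / card E \<partial>\<nu>) = (\<Sum>e\<in>E. (\<integral>x. F (sign_flip e x) \<partial>\<nu>)) / card E"
    using int by simp
  also have "\<dots> = (\<integral>x. F x \<partial>\<nu>)" using int sign_groupD(5)[OF E] by simp
  finally show "(\<integral>x. (\<Sum>e\<in>E. F (sign_flip e x)) / card E + d * norm x \<partial>\<nu>)
    = (\<integral>x. F x \<partial>\<nu>) + d * (\<integral>x. norm x \<partial>\<nu>)" by simp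
qed

lemma legendre_young_real:
  assumes f: "f \<in> convex_funs" and "f x \<noteq> \<infinity>" "legendre f y \<noteq> \<infinity>"
  shows "x \<bullet> y \<le> real_of_ereal (f x) + real_of_ereal (legendre f y)"
  using legendre_upper[of x y f] assms convex_funsD(1)[OF f, of x]
    convex_funsD(1)[OF legendre_convex_funs[OF f], of y]
  by (cases "f x"; cases "legendre f y") auto

text \<open>
  Let \<open>b\<close> and \<open>a'\<close> be the averages of \<open>f\<close> and of its conjugate over the sign group.  By Young's inequality
  \<open>b x + a' y \<ge> x \<bullet> y\<close>, so the conjugate \<open>g0\<close> of \<open>a = a' + d |\<cdot>|\<close>, taken over the common domain \<open>Y\<close>, is at most \<open>b\<close>, even after a shift by a vector
  of length at most \<open>d\<close>.  Adding \<open>d |x|\<close> to \<open>g0\<close> does the same for the conjugate: it stays below \<open>a\<close> after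
  such a shift.  Hence the domains of \<open>g\<close> and of its conjugate both contain a ball, so that both integrals of
  exponentials are positive, while the integrals against the invariant measures grow by at most \<open>d\<close>
  times the first moments.
\<close>

lemma convex_funs_inv_regularize:
  fixes f :: "real ^ 'n \<Rightarrow> ereal"
  assumes E: "sign_group E" and f: "f \<in> convex_funs"
    and \<nu>: "\<nu>1 \<in> P1_inv E" "\<nu>2 \<in> P1_inv E" and d: "0 < d"
    and int1: "integrable \<nu>1 (\<lambda>x. real_of_ereal (f x))" "AE x in \<nu>1. f x = ereal (real_of_ereal (f x))"
    and int2: "integrable \<nu>2 (\<lambda>y. real_of_ereal (legendre f y))"
      "AE y in \<nu>2. legendre f y = ereal (real_of_ereal (legendre f y))"
  obtains g where "g \<in> convex_funs_inv E" "0 < int_exp_neg g" "0 < int_exp_neg (legendre g)"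
    "ext_integral \<nu>1 g \<le> ereal ((\<integral>x. real_of_ereal (f x) \<partial>\<nu>1) + d * (\<integral>x. norm x \<partial>\<nu>1))"
    "ext_integral \<nu>2 (legendre g) \<le> ereal ((\<integral>y. real_of_ereal (legendre f y) \<partial>\<nu>2) + d * (\<integral>x. norm x \<partial>\<nu>2))"
proof -
  have fs: "legendre f \<in> convex_funs" by (rule legendre_convex_funs[OF f])
  note [measurable] = convex_funsD(5)[OF f] convex_funsD(5)[OF fs]
  define N where "N = real (card E)"
  have N: "0 < N" using sign_groupD(5)[OF E] by (simp add: N_def)
  define X where "X = {x. \<forall>e\<in>E. f (sign_flip e x) \<noteq> \<infinity>}"
  define Y where "Y = {y. \<forall>e\<in>E. legendre f (sign_flip e y) \<noteq> \<infinity>}"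
  define b where "b x = (\<Sum>e\<in>E. real_of_ereal (f (sign_flip e x))) / N" for x
  define a' where "a' y = (\<Sum>e\<in>E. real_of_ereal (legendre f (sign_flip e y))) / N" for y
  define a where "a y = a' y + d * norm y" for y
  have aeX: "AE x in \<nu>1. x \<in> X"
    using AE_P1_inv_flip[OF E \<nu>(1) convex_funsD(5)[OF f] int1(2)] by (simp add: X_def)
  have aeY: "AE y in \<nu>2. y \<in> Y"
    using AE_P1_inv_flip[OF E \<nu>(2) convex_funsD(5)[OF fs] int2(2)] by (simp add: Y_def)
  obtain x0 where x0: "x0 \<in> X"
    using eventually_happens'[OF prob_space.ae_filter_bot[OF P1D(1)[OF P1_invD(1)[OF \<nu>(1)]]] aeX] by blast
  obtain y0 where y0: "y0 \<in> Y"
    using eventually_happens'[OF prob_space.ae_filter_bot[OF P1D(1)[OF P1_invD(1)[OF \<nu>(2)]]] aeY] by blast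
  have young: "x \<bullet> y \<le> b x + a' y" if "x \<in> X" "y \<in> Y" for x y
  proof -
    have "N * (x \<bullet> y) = (\<Sum>e\<in>E. sign_flip e x \<bullet> sign_flip e y)"
      using sign_groupD(2)[OF E] by (simp add: N_def)
    also have "\<dots> \<le> (\<Sum>e\<in>E. real_of_ereal (f (sign_flip e x)) + real_of_ereal (legendre f (sign_flip e y)))"
      using that by (intro sum_mono legendre_young_real[OF f]) (auto simp: X_def Y_def)
    also have "\<dots> = N * (b x + a' y)"
      using N by (simp add: sum.distrib b_def a'_def field_simps)
    finally show ?thesis using N by simp
  qed
  define g0 where "g0 = affine_sup Y a"
  have g0_le: "g0 (x + w) \<le> ereal (b x)" if "x \<in> X" "norm w \<le> d" for x w
    unfolding g0_def affine_sup_le_iff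
  proof
    fix y assume y: "y \<in> Y"
    have "y \<bullet> w \<le> norm y * norm w" by (rule norm_cauchy_schwarz)
    also have "\<dots> \<le> norm y * d" using that(2) by (rule mult_left_mono) simp
    finally show "ereal (y \<bullet> (x + w) - a y) \<le> ereal (b x)"
      using young[OF that(1) y] by (simp add: a_def inner_add_right inner_commute mult.commute)
  qed
  have g0_fin: "g0 (x + w) \<noteq> \<infinity>" if "x \<in> X" "norm w \<le> d" for x w
    using g0_le[OF that] by auto
  have g0: "g0 \<in> convex_funs"
    using y0 g0_fin[OF x0, of 0] d unfolding g0_def by (intro affine_sup_convex_funs[of _ _ "x0 + 0"]) auto
  define g where "g x = g0 x + ereal (d * norm x)" for x
  have "convex_on UNIV (\<lambda>x :: real ^ 'n. d * norm x)"
    using d convex_on_dist[of UNIV "0 :: real ^ 'n"] by (intro convex_on_cmul) auto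
  then have g: "g \<in> convex_funs"
    unfolding g_def by (intro convex_funs_add_continuous[OF g0] continuous_intros)
  have gs: "legendre g \<in> convex_funs" by (rule legendre_convex_funs[OF g])
  have "g0 (sign_flip e x) = g0 x" if e: "e \<in> E" for e x
    unfolding g0_def
  proof (rule affine_sup_sign_flip)
    show es: "e \<in> sign_vectors" by (rule sign_groupD(2)[OF E e])
    fix y assume "y \<in> Y"
    then show "sign_flip e y \<in> Y \<and> a (sign_flip e y) = a y"
      using e es sum_sign_group_shift[OF E e, of "\<lambda>y. real_of_ereal (legendre f y)"]
      by (auto simp: a_def a'_def Y_def sign_flip_sign_flip dest: sign_groupD(4)[OF E])
  qed
  then have g_inv: "g \<in> convex_funs_inv E"
    using g sign_groupD(2)[OF E] by (auto simp: convex_funs_inv_def g_def)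
  have gs_le: "legendre g (y + w) \<le> ereal (a y)" if "y \<in> Y" "norm w \<le> d" for y w
  proof (rule legendre_leI)
    show "g x \<noteq> -\<infinity>" for x by (rule convex_funsD[OF g])
    fix x assume x: "g x \<noteq> \<infinity>"
    have "ereal (y \<bullet> x - a y) \<le> g0 x" unfolding g0_def by (rule affine_sup_upper[OF that(1)])
    then have "y \<bullet> x - a y + d * norm x \<le> real_of_ereal (g x)"
      using x by (cases "g0 x") (auto simp: g_def)
    moreover have "x \<bullet> w \<le> norm x * norm w" by (rule norm_cauchy_schwarz)
    moreover have "norm x * norm w \<le> norm x * d" using that(2) by (rule mult_left_mono) simp
    ultimately show "x \<bullet> (y + w) - real_of_ereal (g x) \<le> a y"
      by (simp add: inner_add_right inner_commute mult.commute)
  qed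
  have "0 < int_exp_neg g"
  proof (rule int_exp_neg_pos[OF convex_funsD(5)[OF g] d])
    show "g (x0 + w) \<noteq> \<infinity>" if "norm w \<le> d" for w
      using g0_fin[OF x0 that] by (simp add: g_def)
  qed
  moreover have "0 < int_exp_neg (legendre g)"
  proof (rule int_exp_neg_pos[OF convex_funsD(5)[OF gs] d])
    show "legendre g (y0 + w) \<noteq> \<infinity>" if "norm w \<le> d" for w
      using gs_le[OF y0 that] by auto
  qed
  moreover have "ext_integral \<nu>1 g \<le> ereal ((\<integral>x. real_of_ereal (f x) \<partial>\<nu>1) + d * (\<integral>x. norm x \<partial>\<nu>1))"
  proof -
    have "integrable \<nu>1 (\<lambda>x. b x + d * norm x)"
      "(\<integral>x. b x + d * norm x \<partial>\<nu>1) = (\<integral>x. real_of_ereal (f x) \<partial>\<nu>1) + d * (\<integral>x. norm x \<partial>\<nu>1)"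
      unfolding b_def N_def by (rule integral_P1_inv_average[OF E \<nu>(1) _ int1(1)], measurable)+
    moreover have "AE x in \<nu>1. g x \<le> ereal (b x + d * norm x)"
      using aeX
    proof eventually_elim
      case (elim x)
      have "g0 x + ereal (d * norm x) \<le> ereal (b x) + ereal (d * norm x)"
        using g0_le[OF elim, of 0] d by (intro add_right_mono) simp
      then show ?case by (simp add: g_def)
    qed
    ultimately show ?thesis using ext_integral_le[of \<nu>1 "\<lambda>x. b x + d * norm x" g] by simp
  qed
  moreover have "ext_integral \<nu>2 (legendre g)
      \<le> ereal ((\<integral>y. real_of_ereal (legendre f y) \<partial>\<nu>2) + d * (\<integral>x. norm x \<partial>\<nu>2))"
  proof -
    have "integrable \<nu>2 a"
      "(\<integral>y. a y \<partial>\<nu>2) = (\<integral>y. real_of_ereal (legendre f y) \<partial>\<nu>2) + d * (\<integral>x. norm x \<partial>\<nu>2)"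
      unfolding a_def a'_def N_def by (rule integral_P1_inv_average[OF E \<nu>(2) _ int2(1)], measurable)+
    moreover have "AE y in \<nu>2. legendre g y \<le> ereal (a y)"
      using aeY
    proof eventually_elim
      case (elim y)
      show ?case using gs_le[OF elim, of 0] d by simp
    qed
    ultimately show ?thesis using ext_integral_le[of \<nu>2 a "legendre g"] by simp
  qed
  ultimately show ?thesis using that g_inv by blast
qed

lemma ennreal_mult_greater_split:
  fixes I J :: ennreal
  assumes I: "0 < I" and J: "0 < J" and k: "0 < k" "ennreal k < I * J"
  obtains z w where "0 < z" "0 < w" "ennreal z < I" "ennreal w < J" "k \<le> z * w"
proof -
  have "\<exists>w>0. ennreal w < J \<and> ennreal k < I * ennreal w"
  proof (cases "J")
    case (real j)
    show ?thesis
    proof (cases I)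
      case (real i)
      then have "k < i * j" "0 < i" "0 < j"
        using k I J \<open>J = ennreal j\<close> \<open>0 \<le> j\<close> by (auto simp: ennreal_mult[symmetric] ennreal_less_iff)
      then have "k / i < j" by (simp add: field_simps)
      then obtain w where "k / i < w" "w < j" using dense by blast
      moreover have "0 < w" using \<open>k / i < w\<close> k \<open>0 < i\<close> by (meson divide_pos_pos less_trans)
      ultimately show ?thesis
        using real \<open>J = ennreal j\<close> \<open>0 < i\<close> k
        by (intro exI[of _ w]) (auto simp: ennreal_mult[symmetric] ennreal_less_iff field_simps)
    next
      case top
      then show ?thesis using J real
        by (intro exI[of _ "j / 2"]) (auto simp: ennreal_less_iff ennreal_top_mult)
    qed
  next
    case top
    show ?thesis
    proof (cases I)
      case (real i)
      then have "0 < i" using I by simp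
      then show ?thesis using k top real
        by (intro exI[of _ "2 * k / i"]) (auto simp: ennreal_mult[symmetric] ennreal_less_iff)
    qed (use top in \<open>auto intro!: exI[of _ 1]\<close>)
  qed
  then obtain w where w: "0 < w" "ennreal w < J" "ennreal k < I * ennreal w" by blast
  have "ennreal (k / w) < I"
  proof (cases I)
    case (real i)
    then have "k < i * w" using w k by (auto simp: ennreal_mult[symmetric] ennreal_less_iff)
    then show ?thesis using real w k by (auto simp: ennreal_less_iff field_simps)
  qed simp
  then show ?thesis using that[of "k / w" w] w k by simp
qed

lemma reverse_santalo_imp_transport_entropy:
  fixes E :: "(real ^ 'n) set"
  assumes E: "sign_group E" and c: "0 < c" and RS: "reverse_santalo (convex_funs_inv E) c"
  shows "transport_entropy_ineq (P1_inv E) (P1_inv E) c"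
  unfolding transport_entropy_ineq_def
proof (intro ballI)
  fix \<nu>1 \<nu>2 assume \<nu>: "\<nu>1 \<in> P1_inv E" "\<nu>2 \<in> P1_inv E"
  let ?L = "(INF \<eta>1\<in>P1_inv E. transport_cost \<nu>1 \<eta>1 + entropy_Leb \<eta>1)
      + (INF \<eta>2\<in>P1_inv E. transport_cost \<nu>2 \<eta>2 + entropy_Leb \<eta>2)"
  define K where "K = - real CARD('n) * ln c"
  have "?L \<le> ereal K + (ext_integral \<nu>1 f + ext_integral \<nu>2 (legendre f))" if f: "f \<in> convex_funs" for f
  proof -
    have fs: "legendre f \<in> convex_funs" by (rule legendre_convex_funs[OF f])
    have meas: "f \<in> borel_measurable \<nu>1" "legendre f \<in> borel_measurable \<nu>2"
      using convex_funsD(5)[OF f] convex_funsD(5)[OF fs]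
      by (simp_all only: measurable_cong_sets[OF P1D(2)[OF P1_invD(1)[OF \<nu>(1)]] refl]
          measurable_cong_sets[OF P1D(2)[OF P1_invD(1)[OF \<nu>(2)]] refl])
    obtain y a where ya: "\<And>x. ereal (y \<bullet> x - a) \<le> f x" using convex_funs_affine_minorant[OF f] by metis
    obtain y' a' where ya': "\<And>x. ereal (y' \<bullet> x - a') \<le> legendre f x"
      using convex_funs_affine_minorant[OF fs] by metis
    show ?thesis
    proof (rule ext_integral_cases[OF meas(1) P1D(5)[OF P1_invD(1)[OF \<nu>(1)]] ya])
      assume "ext_integral \<nu>1 f = \<infinity>"
      then show ?thesis by simp
    next
      assume int1: "integrable \<nu>1 (\<lambda>x. real_of_ereal (f x))" "AE x in \<nu>1. f x = ereal (real_of_ereal (f x))"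
        "ext_integral \<nu>1 f = ereal (\<integral>x. real_of_ereal (f x) \<partial>\<nu>1)"
      show ?thesis
      proof (rule ext_integral_cases[OF meas(2) P1D(5)[OF P1_invD(1)[OF \<nu>(2)]] ya'])
        assume "ext_integral \<nu>2 (legendre f) = \<infinity>"
        then show ?thesis by simp
      next
        assume int2: "integrable \<nu>2 (\<lambda>y. real_of_ereal (legendre f y))"
          "AE y in \<nu>2. legendre f y = ereal (real_of_ereal (legendre f y))"
          "ext_integral \<nu>2 (legendre f) = ereal (\<integral>y. real_of_ereal (legendre f y) \<partial>\<nu>2)"
        define r1 r2 where "r1 = (\<integral>x. real_of_ereal (f x) \<partial>\<nu>1)" and "r2 = (\<integral>y. real_of_ereal (legendre f y) \<partial>\<nu>2)"
        define m1 m2 where "m1 = (\<integral>x. norm x \<partial>\<nu>1)" and "m2 = (\<integral>x. norm x \<partial>\<nu>2)"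
        have m: "0 \<le> m1" "0 \<le> m2" by (simp_all add: m1_def m2_def)
        have "?L \<le> ereal (K + (r1 + r2))"
        proof (rule ereal_le_epsilon2)
          fix \<epsilon> :: real assume \<epsilon>: "0 < \<epsilon>"
          \<comment> \<open>The total error consists of \<open>d m1\<close> and \<open>d m2\<close> from the regularization and of \<open>d\<close> from
            replacing \<open>c\<^sup>n\<close> by the smaller \<open>\<kappa>\<close>.\<close>
          define d where "d = \<epsilon> / (1 + m1 + m2)"
          have d: "0 < d" "d + d * m1 + d * m2 = \<epsilon>"
            using \<epsilon> m by (auto simp: d_def divide_simps distrib_left[symmetric]) (simp add: field_simps)
          obtain g where g: "g \<in> convex_funs_inv E" "0 < int_exp_neg g" "0 < int_exp_neg (legendre g)"
            "ext_integral \<nu>1 g \<le> ereal (r1 + d * m1)" "ext_integral \<nu>2 (legendre g) \<le> ereal (r2 + d * m2)"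
            using convex_funs_inv_regularize[OF E f \<nu> d(1) int1(1,2) int2(1,2)]
            unfolding r1_def r2_def m1_def m2_def by metis
          define \<kappa> where "\<kappa> = c ^ CARD('n) * exp (- d)"
          have \<kappa>: "0 < \<kappa>" "\<kappa> < c ^ CARD('n)" using c d by (auto simp: \<kappa>_def)
          have ln\<kappa>: "- ln \<kappa> = K + d" using c by (simp add: \<kappa>_def K_def ln_mult ln_realpow)
          have "ennreal \<kappa> < ennreal (c ^ CARD('n))" using \<kappa> by (simp add: ennreal_less_iff)
          also have "\<dots> \<le> int_exp_neg g * int_exp_neg (legendre g)"
            using RS g by (simp add: reverse_santalo_def)
          finally obtain z w where zw: "0 < z" "0 < w" "ennreal z < int_exp_neg g"
            "ennreal w < int_exp_neg (legendre g)" "\<kappa> \<le> z * w"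
            using ennreal_mult_greater_split[OF g(2,3) \<kappa>(1)] by metis
          have gg: "legendre (legendre g) = g" using g(1) by (intro fenchel_moreau) (simp add: convex_funs_inv_def)
          have "ln \<kappa> \<le> ln (z * w)" using zw \<kappa> by (intro ln_mono) auto
          then have ln: "- ln z - ln w \<le> K + d" using zw ln\<kappa> by (simp add: ln_mult)
          have "?L \<le> ereal (r1 + d * m1 - ln w) + ereal (r2 + d * m2 - ln z)"
          proof (rule add_mono)
            show "(INF \<eta>1\<in>P1_inv E. transport_cost \<nu>1 \<eta>1 + entropy_Leb \<eta>1) \<le> ereal (r1 + d * m1 - ln w)"
              by (rule free_energy_le[OF E g(1) g(4) zw(2,4)])
            show "(INF \<eta>2\<in>P1_inv E. transport_cost \<nu>2 \<eta>2 + entropy_Leb \<eta>2) \<le> ereal (r2 + d * m2 - ln z)"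
              using zw(3) by (intro free_energy_le[OF E legendre_convex_funs_inv[OF E g(1)] g(5) zw(1)]) (simp add: gg)
          qed
          also have "\<dots> \<le> ereal (K + (r1 + r2)) + ereal \<epsilon>"
            using ln d(2) by simp
          finally show "?L \<le> ereal (K + (r1 + r2)) + ereal \<epsilon>" .
        qed
        then show ?thesis by (simp add: int1(3) int2(3) r1_def r2_def)
      qed
    qed
  qed
  note le = this
  have shift: "x \<le> ereal K + y \<longleftrightarrow> x - ereal K \<le> y" for x y :: ereal
    by (cases x; cases y) auto
  have "?L - ereal K \<le> transport_cost \<nu>1 \<nu>2"
    unfolding transport_cost_def[of \<nu>1 \<nu>2] using le unfolding shift by (rule INF_greatest)
  then show "?L \<le> ereal (- real CARD('n) * ln c) + transport_cost \<nu>1 \<nu>2"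
    unfolding K_def[symmetric] shift .
qed

section \<open>Finite suprema of affine functions and their cells\<close>

definition argmax :: "'a::real_inner set \<Rightarrow> ('a \<Rightarrow> real) \<Rightarrow> 'a \<Rightarrow> 'a set" where
  "argmax S a y = {s \<in> S. \<forall>t\<in>S. t \<bullet> y - a t \<le> s \<bullet> y - a s}"

text \<open>
  Where several affine functions attain the maximum, the mass is split evenly among them.  This avoids any
  statement about the cell boundaries being null sets, and it makes the weights of the cells
  invariant under sign flips.
\<close>

definition argmax_share :: "'a::real_inner set \<Rightarrow> ('a \<Rightarrow> real) \<Rightarrow> 'a \<Rightarrow> 'a \<Rightarrow> real" where
  "argmax_share S a s y = (if s \<in> argmax S a y then 1 / real (card (argmax S a y)) else 0)"

lemma argmax_nonempty:
  assumes "finite S" "S \<noteq> {}"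
  shows "argmax S a y \<noteq> {}"
proof -
  let ?f = "\<lambda>s. s \<bullet> y - a s"
  have "Max (?f ` S) \<in> ?f ` S" using assms by (intro Max_in) auto
  then obtain s where s: "s \<in> S" "?f s = Max (?f ` S)" by auto
  have "?f t \<le> ?f s" if "t \<in> S" for t
    unfolding s(2) using that assms by (intro Max_ge) auto
  with s(1) show ?thesis by (auto simp: argmax_def)
qed

lemma affine_sup_argmax: "s \<in> argmax S a y \<Longrightarrow> affine_sup S a y = ereal (s \<bullet> y - a s)"
  by (intro antisym) (auto simp: argmax_def affine_sup_le_iff intro: affine_sup_upper)

lemma affine_sup_finite:
  assumes "finite S" "S \<noteq> {}"
  shows "affine_sup S a y = ereal (real_of_ereal (affine_sup S a y))"
  using argmax_nonempty[OF assms, of a y] affine_sup_argmax[of _ S a y] by fastforce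

lemma argmax_share_nonneg: "0 \<le> argmax_share S a s y"
  by (simp add: argmax_share_def)

lemma sum_argmax_share:
  assumes "finite S" "S \<noteq> {}"
  shows "(\<Sum>s\<in>S. argmax_share S a s y) = 1"
proof -
  have fin: "finite (argmax S a y)" using assms by (simp add: argmax_def)
  have "(\<Sum>s\<in>S. argmax_share S a s y) = (\<Sum>s\<in>argmax S a y. 1 / real (card (argmax S a y)))"
    unfolding argmax_share_def
    by (subst sum.inter_filter[symmetric, OF assms(1)]) (auto intro!: sum.cong simp: argmax_def)
  also have "\<dots> = 1" using argmax_nonempty[OF assms] fin by simp
  finally show ?thesis .
qed

lemma borel_measurable_argmax_share:
  fixes S :: "'a::euclidean_space set"
  assumes "finite S"
  shows "argmax_share S a s \<in> borel_measurable borel"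
proof -
  have [measurable]: "{y. t \<in> argmax S a y} \<in> sets borel" for t
  proof -
    have "closed {y. t \<in> argmax S a y}"
    proof (cases "t \<in> S")
      case True
      then have "{y. t \<in> argmax S a y} = (\<Inter>r\<in>S. {y. r \<bullet> y - a r \<le> t \<bullet> y - a t})"
        by (auto simp: argmax_def)
      then show ?thesis by (auto intro!: closed_INT closed_Collect_le continuous_intros)
    qed (simp add: argmax_def)
    then show ?thesis by simp
  qed
  have "real (card (argmax S a y)) = (\<Sum>t\<in>S. indicator {y. t \<in> argmax S a y} y)" for y
  proof -
    have "(\<Sum>t\<in>S. indicator {y. t \<in> argmax S a y} y) = (\<Sum>t\<in>argmax S a y. 1 :: real)"
      using assms by (intro sum.mono_neutral_cong_right) (auto simp: argmax_def)
    then show ?thesis by simp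
  qed
  then have "argmax_share S a s = (\<lambda>y. indicator {y. s \<in> argmax S a y} y * (1 / (\<Sum>t\<in>S. indicator {y. t \<in> argmax S a y} y)))"
    by (auto simp: argmax_share_def)
  also have "\<dots> \<in> borel_measurable borel" by measurable
  finally show ?thesis .
qed

lemma argmax_share_sign_flip:
  assumes e: "e \<in> sign_vectors" and S: "\<And>s. s \<in> S \<Longrightarrow> sign_flip e s \<in> S \<and> a (sign_flip e s) = a s"
  shows "argmax_share S a (sign_flip e s) (sign_flip e y) = argmax_share S a s y"
proof -
  have iff: "sign_flip e s \<in> argmax S a (sign_flip e y) \<longleftrightarrow> s \<in> argmax S a y" for s
  proof -
    have sub: "sign_flip e s \<in> argmax S a (sign_flip e y)" if "s \<in> argmax S a y" for s y
      using that S e by (auto simp: argmax_def) (metis inner_sign_flip_swap)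
    from sub[of s y] sub[of "sign_flip e s" "sign_flip e y"] e show ?thesis by auto
  qed
  have "argmax S a (sign_flip e y) = sign_flip e ` argmax S a y"
  proof (intro set_eqI iffI)
    fix x assume "x \<in> argmax S a (sign_flip e y)"
    then have "sign_flip e x \<in> argmax S a y" using iff[of "sign_flip e x"] e by simp
    then show "x \<in> sign_flip e ` argmax S a y" using e by (intro image_eqI[of _ _ "sign_flip e x"]) simp_all
  qed (use iff in blast)
  moreover have "inj (sign_flip e)" using e by (intro inj_on_inverseI[of _ "sign_flip e"]) simp
  ultimately have "card (argmax S a (sign_flip e y)) = card (argmax S a y)"
    by (metis card_image inj_on_subset subset_UNIV)
  then show ?thesis by (simp add: argmax_share_def iff)
qed

text \<open>
  The two sides of the hypothesis agree at \<open>t = 0\<close>, so their derivatives at \<open>0\<close> are ordered in the same way.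
\<close>

lemma tangent_slope_le:
  fixes p d :: "'b \<Rightarrow> real"
  assumes fin: "finite S" and p: "(\<Sum>s\<in>S. p s) = 1"
    and le: "\<And>t. 0 < t \<Longrightarrow> t < 1 \<Longrightarrow> exp (t * l) \<le> (\<Sum>s\<in>S. p s * exp (t * d s))"
  shows "l \<le> (\<Sum>s\<in>S. p s * d s)"
proof (rule ccontr)
  assume "\<not> l \<le> (\<Sum>s\<in>S. p s * d s)"
  define \<phi> where "\<phi> t = (\<Sum>s\<in>S. p s * exp (t * d s)) - exp (t * l)" for t
  have "DERIV \<phi> 0 :> (\<Sum>s\<in>S. p s * d s) - l"
    unfolding \<phi>_def by (auto intro!: derivative_eq_intros sum.cong)
  moreover have "(\<Sum>s\<in>S. p s * d s) - l < 0" using \<open>\<not> _\<close> by simp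
  ultimately obtain r where r: "0 < r" "\<And>h. 0 < h \<Longrightarrow> h < r \<Longrightarrow> \<phi> (0 + h) < \<phi> 0"
    using DERIV_neg_dec_right by blast
  define h where "h = min (r / 2) (1 / 2)"
  have "0 < h" "h < r" "h < 1" using r(1) by (auto simp: h_def)
  moreover have "\<phi> 0 = 0" using p by (simp add: \<phi>_def)
  ultimately show False using r(2)[of h] le[of h] by (simp add: \<phi>_def)
qed

text \<open>
  Up to normalization, the mass that the moment measure of \<open>affine_sup S a\<close> gives to the slope \<open>s\<close>.
\<close>

definition cell_weight :: "(real ^ 'n) set \<Rightarrow> (real ^ 'n \<Rightarrow> real) \<Rightarrow> real ^ 'n \<Rightarrow> real" where
  "cell_weight S a s = (\<integral>y. argmax_share S a s y * exp (- real_of_ereal (affine_sup S a y)) \<partial>lborel)"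

locale finite_affine_sup =
  fixes S :: "(real ^ 'n) set" and a :: "real ^ 'n \<Rightarrow> real" and Z :: real
  assumes finite_S: "finite S" and S_ne: "S \<noteq> {}" and Z: "0 < Z"
    and int_Z: "int_exp_neg (affine_sup S a) = ennreal Z"
begin

definition M :: "real ^ 'n \<Rightarrow> real" where
  "M y = real_of_ereal (affine_sup S a y)"

lemma affine_sup_M: "affine_sup S a y = ereal (M y)"
  unfolding M_def by (rule affine_sup_finite[OF finite_S S_ne])

lemma measurable_M [measurable]: "M \<in> borel_measurable borel"
  unfolding M_def
  using borel_measurable_lower_semicont[OF lower_semicont_affine_sup[of S a]] by measurable

lemmas [measurable] = borel_measurable_argmax_share[OF finite_S, of a]

lemma integral_exp_M: "integrable lborel (\<lambda>y. exp (- M y))" "(\<integral>y. exp (- M y) \<partial>lborel) = Z"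
proof -
  have "(\<integral>\<^sup>+y. ennreal (exp (- M y)) \<partial>lborel) = ennreal Z"
    using int_Z by (simp add: int_exp_neg_def affine_sup_M)
  then show "integrable lborel (\<lambda>y. exp (- M y))" "(\<integral>y. exp (- M y) \<partial>lborel) = Z"
    using Z by (auto intro!: integrableI_nonneg simp: integral_eq_nn_integral)
qed

lemma argmax_share_le_1: "argmax_share S a s y \<le> 1"
proof (cases "s \<in> argmax S a y")
  case True
  moreover have "finite (argmax S a y)" using finite_S by (simp add: argmax_def)
  ultimately have "1 \<le> card (argmax S a y)" by (auto simp: Suc_le_eq card_gt_0_iff)
  then show ?thesis by (simp add: argmax_share_def)
qed (simp add: argmax_share_def)

lemma integrable_cell: "integrable lborel (\<lambda>y. argmax_share S a s y * exp (- M y))"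
  by (rule Bochner_Integration.integrable_bound[OF integral_exp_M(1)])
    (auto simp: abs_mult argmax_share_nonneg argmax_share_le_1 mult_left_le_one_le)

lemma cell_weight_M: "cell_weight S a s = (\<integral>y. argmax_share S a s y * exp (- M y) \<partial>lborel)"
  by (simp add: cell_weight_def M_def)

lemma cell_weight_nonneg: "0 \<le> cell_weight S a s"
  unfolding cell_weight_M by (intro Bochner_Integration.integral_nonneg) (simp add: argmax_share_nonneg)

lemma sum_cell_weight: "(\<Sum>s\<in>S. cell_weight S a s) = Z"
proof -
  have "(\<Sum>s\<in>S. cell_weight S a s) = (\<integral>y. (\<Sum>s\<in>S. argmax_share S a s y * exp (- M y)) \<partial>lborel)"
    unfolding cell_weight_M using integrable_cell by simp
  also have "\<dots> = Z"
    using sum_argmax_share[OF finite_S S_ne] by (simp add: sum_distrib_right[symmetric] integral_exp_M)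
  finally show ?thesis .
qed

lemma cell_weight_eq_0_AE:
  assumes "cell_weight S a s = 0"
  shows "AE y in lborel. argmax_share S a s y = 0"
proof -
  have "AE y in lborel. argmax_share S a s y * exp (- M y) = 0"
    using assms integral_nonneg_eq_0_iff_AE[OF integrable_cell[of s]]
    by (simp add: cell_weight_M argmax_share_nonneg)
  then show ?thesis by eventually_elim auto
qed

text \<open>
  Log-concavity along the segment from \<open>a\<close> to \<open>g\<close>.  Points at which \<open>g\<close> is infinite drop out of the maximum as soon as
  \<open>t > 0\<close>, whence the smaller set \<open>T\<close>.
\<close>

lemma prekopa_leindler_towards:
  assumes g: "g \<in> convex_funs" and t: "0 < t" "t < 1"
    and q: "0 < q" "ennreal q < int_exp_neg (legendre g)"
    and T: "T = {s \<in> S. g s \<noteq> \<infinity>}"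
  shows "ennreal (Z powr (1 - t) * q powr t)
    \<le> int_exp_neg (affine_sup T (\<lambda>s. (1 - t) * a s + t * real_of_ereal (g s)))" (is "_ \<le> int_exp_neg ?h")
proof -
  have gs: "legendre g \<in> convex_funs" by (rule legendre_convex_funs[OF g])
  note [measurable] = convex_funsD(5)[OF gs] borel_measurable_lower_semicont[OF lower_semicont_affine_sup]
  have le: "ennreal (\<alpha> powr (1 - t) * q powr t) \<le> int_exp_neg ?h" if \<alpha>: "0 < \<alpha>" "\<alpha> < Z" for \<alpha>
    unfolding int_exp_neg_def
  proof (rule prekopa_leindler[OF _ _ _ t _ \<alpha>(1) q(1)])
    show "ennreal \<alpha> < (\<integral>\<^sup>+y. exp_neg (affine_sup S a y) \<partial>lborel)"
      "ennreal q < (\<integral>\<^sup>+y. exp_neg (legendre g y) \<partial>lborel)"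
      using \<alpha> q int_Z by (simp_all add: int_exp_neg_def ennreal_less_iff)
    fix x y and \<alpha> \<beta> :: real
    assume *: "0 < \<alpha>" "0 < \<beta>" "ennreal \<alpha> < exp_neg (affine_sup S a x)" "ennreal \<beta> < exp_neg (legendre g y)"
    have "\<alpha> < exp (- M x)" using * by (simp add: affine_sup_M ennreal_less_iff)
    obtain G where G: "legendre g y = ereal G"
      using *(4) convex_funsD(1)[OF gs, of y] by (cases "legendre g y") auto
    then have "\<beta> < exp (- G)" using * by (simp add: ennreal_less_iff)
    have "?h ((1 - t) *\<^sub>R x + t *\<^sub>R y) \<le> ereal ((1 - t) * M x + t * G)"
      unfolding affine_sup_le_iff
    proof
      fix s assume s: "s \<in> T"
      have "s \<bullet> x - a s \<le> M x" using affine_sup_upper[of s S x a] s T affine_sup_M[of x] by simp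
      then have "(1 - t) * (s \<bullet> x - a s) \<le> (1 - t) * M x" using t by (intro mult_left_mono) auto
      moreover have "s \<bullet> y \<le> real_of_ereal (g s) + G"
        using legendre_upper[of s y g] s T G convex_funsD(1)[OF g, of s] by (cases "g s") auto
      then have "t * (s \<bullet> y - real_of_ereal (g s)) \<le> t * G" using t by (intro mult_left_mono) auto
      ultimately show "ereal (s \<bullet> ((1 - t) *\<^sub>R x + t *\<^sub>R y) - ((1 - t) * a s + t * real_of_ereal (g s)))
          \<le> ereal ((1 - t) * M x + t * G)"
        by (simp add: inner_add_right right_diff_distrib)
    qed
    then have "ennreal (exp (- ((1 - t) * M x + t * G))) \<le> exp_neg (?h ((1 - t) *\<^sub>R x + t *\<^sub>R y))"
      by (metis exp_neg_antimono exp_neg_ereal)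
    moreover have "\<alpha> powr (1 - t) * \<beta> powr t \<le> exp (- ((1 - t) * M x + t * G))"
    proof -
      have "\<alpha> powr (1 - t) * \<beta> powr t \<le> exp (- M x) powr (1 - t) * exp (- G) powr t"
        using \<open>\<alpha> < exp (- M x)\<close> \<open>\<beta> < exp (- G)\<close> * t by (intro mult_mono powr_mono2) auto
      also have "\<dots> = exp (- ((1 - t) * M x + t * G))"
        by (simp add: powr_def exp_add[symmetric] algebra_simps)
      finally show ?thesis .
    qed
    ultimately show "ennreal (\<alpha> powr (1 - t) * \<beta> powr t) \<le> exp_neg (?h ((1 - t) *\<^sub>R x + t *\<^sub>R y))"
      by (meson ennreal_leI order_trans)
  qed simp_all
  \<comment> \<open>\<open>prekopa_leindler\<close> needs a strict lower bound \<open>\<alpha>\<close> for the integral \<open>Z\<close>; let \<open>\<alpha>\<close> tend to \<open>Z\<close>.\<close>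
  show ?thesis
  proof (rule tendsto_upperbound)
    show "((\<lambda>\<alpha>. ennreal (\<alpha> powr (1 - t) * q powr t)) \<longlongrightarrow> ennreal (Z powr (1 - t) * q powr t)) (at_left Z)"
      using Z by (intro tendsto_intros) auto
    show "\<forall>\<^sub>F \<alpha> in at_left Z. ennreal (\<alpha> powr (1 - t) * q powr t) \<le> int_exp_neg ?h"
      using eventually_at_left_real[OF Z] by eventually_elim (auto intro: le)
  qed simp
qed

text \<open>
  The first-order upper bound that turns convexity into a tangent inequality.  On the cell of \<open>s\<close> the
  perturbed maximum is at least its old value minus \<open>\<delta> s\<close>, simply because \<open>s\<close> still competes; no
  differentiation under the integral is involved.  The removed points have cells of measure zero.
\<close>

lemma int_exp_neg_towards_le:
  assumes T: "T \<subseteq> S" "\<And>s. s \<in> S - T \<Longrightarrow> cell_weight S a s = 0"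
  shows "int_exp_neg (affine_sup T (\<lambda>s. a s + \<delta> s)) \<le> ennreal (\<Sum>s\<in>T. cell_weight S a s * exp (\<delta> s))"
proof -
  have finT: "finite T" using T finite_S finite_subset by blast
  have "AE y in lborel. \<forall>s\<in>S - T. argmax_share S a s y = 0"
    using T(2) finite_S by (intro AE_finite_allI cell_weight_eq_0_AE) auto
  then have "AE y in lborel. exp_neg (affine_sup T (\<lambda>s. a s + \<delta> s) y)
      \<le> (\<Sum>s\<in>T. ennreal (argmax_share S a s y * exp (- M y) * exp (\<delta> s)))"
  proof eventually_elim
    case (elim y)
    let ?h = "exp_neg (affine_sup T (\<lambda>s. a s + \<delta> s) y)"
    have "(\<Sum>s\<in>T. argmax_share S a s y) = (\<Sum>s\<in>S. argmax_share S a s y)"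
      using elim T(1) finite_S by (intro sum.mono_neutral_left) auto
    then have one: "(\<Sum>s\<in>T. argmax_share S a s y) = 1"
      by (simp add: sum_argmax_share[OF finite_S S_ne])
    have "?h = (\<Sum>s\<in>T. ennreal (argmax_share S a s y)) * ?h"
      by (simp add: sum_ennreal argmax_share_nonneg one)
    also have "\<dots> = (\<Sum>s\<in>T. ennreal (argmax_share S a s y) * ?h)" by (rule sum_distrib_right)
    also have "\<dots> \<le> (\<Sum>s\<in>T. ennreal (argmax_share S a s y * exp (- M y) * exp (\<delta> s)))"
    proof (intro sum_mono)
      fix s assume s: "s \<in> T"
      show "ennreal (argmax_share S a s y) * ?h \<le> ennreal (argmax_share S a s y * exp (- M y) * exp (\<delta> s))"
      proof (cases "s \<in> argmax S a y")
        case True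
        then have "M y = s \<bullet> y - a s" using affine_sup_argmax[OF True] by (simp add: affine_sup_M)
        then have "ereal (M y - \<delta> s) \<le> affine_sup T (\<lambda>s. a s + \<delta> s) y"
          using affine_sup_upper[OF s, of y "\<lambda>s. a s + \<delta> s"] by (simp add: diff_diff_eq)
        then have "?h \<le> ennreal (exp (- M y) * exp (\<delta> s))"
          using exp_neg_antimono[of "ereal (M y - \<delta> s)"] by (simp add: exp_add[symmetric])
        then have "ennreal (argmax_share S a s y) * ?h
            \<le> ennreal (argmax_share S a s y) * ennreal (exp (- M y) * exp (\<delta> s))"
          by (rule mult_left_mono) simp
        also have "\<dots> = ennreal (argmax_share S a s y * exp (- M y) * exp (\<delta> s))"
          by (simp add: ennreal_mult'[symmetric] mult.assoc argmax_share_nonneg)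
        finally show ?thesis .
      qed (simp add: argmax_share_def)
    qed
    finally show ?case .
  qed
  then have "int_exp_neg (affine_sup T (\<lambda>s. a s + \<delta> s))
      \<le> (\<integral>\<^sup>+y. (\<Sum>s\<in>T. ennreal (argmax_share S a s y * exp (- M y) * exp (\<delta> s))) \<partial>lborel)"
    unfolding int_exp_neg_def by (rule nn_integral_mono_AE)
  also have "\<dots> = (\<Sum>s\<in>T. \<integral>\<^sup>+y. ennreal (argmax_share S a s y * exp (- M y) * exp (\<delta> s)) \<partial>lborel)"
    by (rule nn_integral_sum) simp
  also have "\<dots> = (\<Sum>s\<in>T. ennreal (cell_weight S a s * exp (\<delta> s)))"
  proof (intro sum.cong refl)
    fix s
    have "(\<integral>\<^sup>+y. ennreal (argmax_share S a s y * exp (- M y) * exp (\<delta> s)) \<partial>lborel)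
        = ennreal (\<integral>y. argmax_share S a s y * exp (- M y) * exp (\<delta> s) \<partial>lborel)"
      using integrable_cell[of s] by (intro nn_integral_eq_integral) (auto simp: argmax_share_nonneg)
    then show "(\<integral>\<^sup>+y. ennreal (argmax_share S a s y * exp (- M y) * exp (\<delta> s)) \<partial>lborel)
        = ennreal (cell_weight S a s * exp (\<delta> s))"
      by (simp add: cell_weight_M)
  qed
  also have "\<dots> = ennreal (\<Sum>s\<in>T. cell_weight S a s * exp (\<delta> s))"
    by (intro sum_ennreal) (simp add: cell_weight_nonneg)
  finally show ?thesis .
qed

text \<open>
  The tangent inequality: for the probability weights \<open>p s = cell_weight S a s / Z\<close> it says
  \<open>\<Sum> p s * g s - ln \<integral>exp (-g\<^sup>*) \<ge> \<Sum> p s * a s - ln Z\<close>, so \<open>a\<close> minimizes the left-hand side.  Both bounds above along the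
  segment from \<open>a\<close> to \<open>g\<close> give \<open>exp (t ln (q / Z)) \<le> \<Sum> p s * exp (t d s)\<close> for every \<open>q\<close>
  below the integral and \<open>0 < t < 1\<close>; now differentiate at \<open>t = 0\<close>.
\<close>

lemma int_exp_neg_legendre_le:
  assumes g: "g \<in> convex_funs" and fin: "\<And>s. s \<in> S \<Longrightarrow> 0 < cell_weight S a s \<Longrightarrow> g s \<noteq> \<infinity>"
  shows "int_exp_neg (legendre g)
    \<le> ennreal (Z * exp (\<Sum>s\<in>S. cell_weight S a s / Z * (real_of_ereal (g s) - a s)))" (is "_ \<le> ennreal ?R")
proof (rule ccontr)
  assume "\<not> ?thesis"
  then have "ennreal ?R < int_exp_neg (legendre g)" by simp
  then obtain q' where q': "ennreal ?R < q'" "q' < int_exp_neg (legendre g)" using dense by blast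
  then obtain q where q: "q' = ennreal q" "?R < q"
    using Z by (cases q') (auto simp: ennreal_less_iff top_unique)
  have "0 < ?R" using Z by simp
  then have q0: "0 < q" using q by linarith
  define T where "T = {s \<in> S. g s \<noteq> \<infinity>}"
  have zero: "cell_weight S a s = 0" if "s \<in> S - T" for s
    using that fin[of s] cell_weight_nonneg[of s] by (auto simp: T_def less_le)
  have TS: "T \<subseteq> S" by (auto simp: T_def)
  have restrict: "(\<Sum>s\<in>S. cell_weight S a s / Z * F s) = (\<Sum>s\<in>T. cell_weight S a s / Z * F s)" for F :: "_ \<Rightarrow> real"
    using zero finite_S TS by (intro sum.mono_neutral_right) auto
  define d where "d s = real_of_ereal (g s) - a s" for s
  have "ln (q / Z) \<le> (\<Sum>s\<in>T. cell_weight S a s / Z * d s)"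
  proof (rule tangent_slope_le)
    show "finite T" using TS finite_S finite_subset by blast
    show "(\<Sum>s\<in>T. cell_weight S a s / Z) = 1"
      using restrict[of "\<lambda>_. 1"] sum_cell_weight Z by (simp add: sum_divide_distrib[symmetric])
    fix t :: real assume t: "0 < t" "t < 1"
    have eq: "(\<lambda>s. (1 - t) * a s + t * real_of_ereal (g s)) = (\<lambda>s. a s + t * d s)"
      by (auto simp: d_def algebra_simps)
    have "ennreal (Z powr (1 - t) * q powr t) \<le> int_exp_neg (affine_sup T (\<lambda>s. a s + t * d s))"
      using prekopa_leindler_towards[OF g t q0 _ T_def] q q' unfolding eq by simp
    also have "\<dots> \<le> ennreal (\<Sum>s\<in>T. cell_weight S a s * exp (t * d s))"
      by (rule int_exp_neg_towards_le[OF TS zero])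
    finally have "Z powr (1 - t) * q powr t \<le> (\<Sum>s\<in>T. cell_weight S a s * exp (t * d s))"
      by (subst (asm) ennreal_le_iff) (auto intro!: sum_nonneg simp: cell_weight_nonneg)
    then have "Z powr (1 - t) * q powr t / Z \<le> (\<Sum>s\<in>T. cell_weight S a s * exp (t * d s)) / Z"
      using Z by (intro divide_right_mono) auto
    moreover have "Z powr (1 - t) * q powr t / Z = exp (t * ln (q / Z))"
      using Z q0 by (simp add: powr_def ln_div exp_diff exp_add algebra_simps)
    ultimately show "exp (t * ln (q / Z)) \<le> (\<Sum>s\<in>T. cell_weight S a s / Z * exp (t * d s))"
      by (simp add: sum_divide_distrib)
  qed
  then have "ln (q / Z) \<le> (\<Sum>s\<in>S. cell_weight S a s / Z * (real_of_ereal (g s) - a s))"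
    unfolding restrict d_def .
  then have "q / Z \<le> exp (\<Sum>s\<in>S. cell_weight S a s / Z * (real_of_ereal (g s) - a s))"
    using q0 Z by (metis divide_pos_pos exp_le_cancel_iff exp_ln)
  then have "q \<le> ?R" using Z by (simp add: field_simps)
  then show False using q(2) by linarith
qed

end

section \<open>Finitely supported moment measures\<close>

definition atoms :: "(real ^ 'n) set \<Rightarrow> (real ^ 'n \<Rightarrow> real) \<Rightarrow> (real ^ 'n) measure" where
  "atoms S p = distr (point_measure S (\<lambda>s. ennreal (p s))) borel (\<lambda>x. x)"

lemma measurable_point_measure: "f \<in> space M \<rightarrow> space N \<Longrightarrow> M = point_measure S p \<Longrightarrow> f \<in> measurable M N"
  by (simp add: point_measure_def measurable_def)

lemma nn_integral_atoms:
  assumes "finite S" and [measurable]: "f \<in> borel_measurable borel"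
  shows "(\<integral>\<^sup>+x. f x \<partial>atoms S p) = (\<Sum>s\<in>S. ennreal (p s) * f s)"
  unfolding atoms_def using assms
  by (subst nn_integral_distr) (auto simp: nn_integral_point_measure_finite intro: measurable_point_measure)

lemma sets_atoms [simp, measurable_cong]: "sets (atoms S p) = sets borel"
  and space_atoms [simp]: "space (atoms S p) = UNIV"
  by (simp_all add: atoms_def)

lemma emeasure_atoms:
  assumes "finite S" "A \<in> sets borel"
  shows "emeasure (atoms S p) A = (\<Sum>s\<in>S. ennreal (p s) * indicator A s)"
  using nn_integral_atoms[OF assms(1), of "indicator A" p] assms(2) by simp

lemma integrable_atoms:
  fixes f :: "real ^ 'n \<Rightarrow> real"
  assumes "finite S" and [measurable]: "f \<in> borel_measurable borel"
  shows "integrable (atoms S p) f"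
  unfolding atoms_def using assms
  by (subst integrable_distr_eq) (auto simp: integrable_point_measure_finite intro: measurable_point_measure)

lemma integral_atoms:
  fixes f :: "real ^ 'n \<Rightarrow> real"
  assumes "finite S" "\<And>s. s \<in> S \<Longrightarrow> 0 \<le> p s" and [measurable]: "f \<in> borel_measurable borel"
  shows "(\<integral>x. f x \<partial>atoms S p) = (\<Sum>s\<in>S. p s * f s)"
  unfolding atoms_def using assms
  by (subst integral_distr) (auto simp: lebesgue_integral_point_measure_finite intro: measurable_point_measure)

lemma ext_integral_atoms:
  assumes fin: "finite S" and p: "\<And>s. s \<in> S \<Longrightarrow> 0 \<le> p s" and g [measurable]: "g \<in> borel_measurable borel"
    and gfin: "\<And>s. s \<in> S \<Longrightarrow> 0 < p s \<Longrightarrow> g s = ereal (real_of_ereal (g s))"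
  shows "ext_integral (atoms S p) g = ereal (\<Sum>s\<in>S. p s * real_of_ereal (g s))"
proof -
  have "AE x in atoms S p. g x = ereal (real_of_ereal (g x))"
    unfolding atoms_def using gfin
    by (subst AE_distr_iff) (auto simp: AE_point_measure intro: measurable_point_measure)
  from ext_integral_eq[OF integrable_atoms[OF fin] this]
  show ?thesis by (simp add: integral_atoms[OF fin p])
qed

lemma ext_integral_atoms_infinite:
  assumes fin: "finite S" and g [measurable]: "g \<in> borel_measurable borel"
    and s: "s \<in> S" "0 < p s" "g s = \<infinity>"
  shows "ext_integral (atoms S p) g = \<infinity>"
proof -
  have "(\<integral>\<^sup>+x. e2ennreal (g x) \<partial>atoms S p) = (\<Sum>s\<in>S. ennreal (p s) * e2ennreal (g s))"
    by (rule nn_integral_atoms[OF fin]) simp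
  also have "\<dots> = \<infinity>"
  proof -
    have "ennreal (p s) * e2ennreal (g s) = \<infinity>" using s by (simp add: ennreal_mult_top)
    moreover have "ennreal (p s) * e2ennreal (g s) \<le> (\<Sum>s\<in>S. ennreal (p s) * e2ennreal (g s))"
      using fin s(1) by (intro member_le_sum) auto
    ultimately show ?thesis by (simp add: top_unique)
  qed
  finally show ?thesis by (simp add: ext_integral_def)
qed

lemma atoms_P1_inv_compact:
  assumes fin: "finite S" and p: "\<And>s. s \<in> S \<Longrightarrow> 0 \<le> p s" "(\<Sum>s\<in>S. p s) = 1"
    and E: "sign_group E" and inv: "\<And>e s. e \<in> E \<Longrightarrow> s \<in> S \<Longrightarrow> sign_flip e s \<in> S \<and> p (sign_flip e s) = p s"
  shows "atoms S p \<in> compact_probs \<inter> P1_inv E"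
proof -
  have "emeasure (atoms S p) UNIV = (\<Sum>s\<in>S. ennreal (p s))"
    using emeasure_atoms[OF fin, of UNIV p] by simp
  also have "\<dots> = 1" using p by (simp add: sum_ennreal)
  finally have prob: "prob_space (atoms S p)" by (intro prob_spaceI) simp
  then have bp: "atoms S p \<in> borel_probs" by (simp add: borel_probs_def)
  moreover have "integrable (atoms S p) (\<lambda>x. norm x)" by (rule integrable_atoms[OF fin]) simp
  ultimately have P1: "atoms S p \<in> P1" by (simp add: P1_def)
  have "measure_support (atoms S p) \<subseteq> S"
  proof
    fix x assume x: "x \<in> measure_support (atoms S p)"
    show "x \<in> S"
    proof (rule ccontr)
      assume "x \<notin> S"
      moreover have "open (- S)" using fin by (simp add: finite_imp_closed open_Compl)
      ultimately have "0 < emeasure (atoms S p) (- S)" using x by (auto simp: measure_support_def)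
      moreover have "emeasure (atoms S p) (- S) = 0"
        using fin by (subst emeasure_atoms) (auto simp: borel_open finite_imp_closed open_Compl)
      ultimately show False by simp
    qed
  qed
  then have "compact (measure_support (atoms S p))"
    using fin finite_imp_compact finite_subset by blast
  with bp have "atoms S p \<in> compact_probs" by (simp add: compact_probs_def)
  moreover have "distr (atoms S p) borel (sign_flip e) = atoms S p" if e: "e \<in> E" for e
  proof (rule measure_eqI)
    note es = sign_groupD(2)[OF E e]
    fix A assume "A \<in> sets (distr (atoms S p) borel (sign_flip e))"
    then have A [measurable]: "A \<in> sets borel" by simp
    have meas: "sign_flip e -` A \<in> sets borel" using measurable_sets[OF borel_measurable_sign_flip A, of e] by simp
    have "emeasure (distr (atoms S p) borel (sign_flip e)) A = emeasure (atoms S p) (sign_flip e -` A)"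
      by (subst emeasure_distr) auto
    also have "\<dots> = (\<Sum>s\<in>S. ennreal (p s) * indicator A (sign_flip e s))"
      using emeasure_atoms[OF fin meas, of p] by (simp add: indicator_def vimage_def)
    also have "\<dots> = (\<Sum>s\<in>S. ennreal (p s) * indicator A s)"
      by (rule sum.reindex_bij_witness[of _ "sign_flip e" "sign_flip e"]) (use inv[OF e] es in auto)
    also have "\<dots> = emeasure (atoms S p) A" by (rule emeasure_atoms[OF fin A, symmetric])
    finally show "emeasure (distr (atoms S p) borel (sign_flip e)) A = emeasure (atoms S p) A" .
  qed simp
  ultimately show ?thesis using P1 by (simp add: P1_inv_def)
qed

lemma cell_weight_sign_flip:
  assumes fin: "finite S" and e: "e \<in> sign_vectors"
    and S: "\<And>s. s \<in> S \<Longrightarrow> sign_flip e s \<in> S \<and> a (sign_flip e s) = a s"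
  shows "cell_weight S a (sign_flip e s) = cell_weight S a s"
proof -
  let ?F = "\<lambda>s y. argmax_share S a s y * exp (- real_of_ereal (affine_sup S a y))"
  note [measurable] = borel_measurable_argmax_share[OF fin, of a]
    borel_measurable_lower_semicont[OF lower_semicont_affine_sup[of S a]]
  have "cell_weight S a (sign_flip e s) = (\<integral>y. ?F (sign_flip e s) y \<partial>distr lborel borel (sign_flip e))"
    unfolding cell_weight_def distr_lborel_sign_flip[OF e] ..
  also have "\<dots> = (\<integral>y. ?F (sign_flip e s) (sign_flip e y) \<partial>lborel)"
    by (rule integral_distr) measurable
  also have "\<dots> = cell_weight S a s"
    unfolding cell_weight_def
    by (intro Bochner_Integration.integral_cong refl)
      (simp add: affine_sup_sign_flip[OF e S] argmax_share_sign_flip[OF e S])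
  finally show ?thesis .
qed

text \<open>
  The measure with the normalized cell weights as masses almost attains the conjugate at \<open>f\<close>: the tangent
  inequality bounds the integral of the exponential for each competitor \<open>g\<close> in the transport cost, and the Gibbs lower bound turns
  this into a bound for \<open>\<eta>\<close>.
\<close>

lemma discrete_moment_measure:
  fixes f :: "real ^ 'n \<Rightarrow> ereal"
  assumes E: "sign_group E" and f: "f \<in> convex_funs_inv E"
    and S: "finite S" "S \<noteq> {}" "\<And>s. s \<in> S \<Longrightarrow> f s \<noteq> \<infinity>" "\<And>e s. e \<in> E \<Longrightarrow> s \<in> S \<Longrightarrow> sign_flip e s \<in> S"
    and Z: "0 < Z" "int_exp_neg (affine_sup S (\<lambda>s. real_of_ereal (f s))) = ennreal Z"
  obtains \<nu> m where "\<nu> \<in> compact_probs \<inter> P1_inv E" "ext_integral \<nu> f = ereal m"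
    "\<And>\<eta>. \<eta> \<in> P1 \<Longrightarrow> ereal (m - ln Z) \<le> transport_cost \<nu> \<eta> + entropy_Leb \<eta>"
proof -
  define a where "a = (\<lambda>s. real_of_ereal (f s))"
  interpret finite_affine_sup S a Z
    using S Z by unfold_locales (simp_all add: a_def)
  have conv: "f \<in> convex_funs" and finv: "\<And>e x. e \<in> E \<Longrightarrow> f (sign_flip e x) = f x"
    using f by (auto simp: convex_funs_inv_def)
  define p where "p s = cell_weight S a s / Z" for s
  have p0: "0 \<le> p s" for s using cell_weight_nonneg Z by (simp add: p_def)
  have p1: "(\<Sum>s\<in>S. p s) = 1"
    using sum_cell_weight Z by (simp add: p_def sum_divide_distrib[symmetric])
  have p_pos: "0 < cell_weight S a s \<longleftrightarrow> 0 < p s" for s using Z by (simp add: p_def zero_less_divide_iff)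
  have Sinv: "sign_flip e s \<in> S \<and> a (sign_flip e s) = a s" if "e \<in> E" "s \<in> S" for e s
    using S(4) finv that by (simp add: a_def)
  have "p (sign_flip e s) = p s" if "e \<in> E" "s \<in> S" for e s
    unfolding p_def
    using cell_weight_sign_flip[OF S(1) sign_groupD(2)[OF E that(1)] Sinv[OF that(1)]] by simp
  with S(4) have \<nu>: "atoms S p \<in> compact_probs \<inter> P1_inv E"
    by (intro atoms_P1_inv_compact S(1) p0 p1 E conjI)
  define m where "m = (\<Sum>s\<in>S. p s * a s)"
  have real: "g s = ereal (real_of_ereal (g s))" if "g \<in> convex_funs" "g s \<noteq> \<infinity>"
    for g :: "real ^ 'n \<Rightarrow> ereal" and s
    using convex_funsD(1)[OF that(1), of s] that(2) by (cases "g s") auto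
  have ext_f: "ext_integral (atoms S p) f = ereal m"
    unfolding m_def a_def using S(3) real[OF conv]
    by (intro ext_integral_atoms S(1) p0 convex_funsD(5)[OF conv]) auto
  have "ereal (m - ln Z) \<le> transport_cost (atoms S p) \<eta> + entropy_Leb \<eta>" if \<eta>: "\<eta> \<in> P1" for \<eta>
  proof (cases "entropy_Leb \<eta>")
    case (real h)
    have "ereal (m - ln Z - h) \<le> transport_cost (atoms S p) \<eta>"
      unfolding transport_cost_def
    proof (rule INF_greatest)
      fix g :: "real ^ 'n \<Rightarrow> ereal" assume g: "g \<in> convex_funs"
      show "ereal (m - ln Z - h) \<le> ext_integral (atoms S p) g + ext_integral \<eta> (legendre g)"
      proof (cases "\<exists>s\<in>S. 0 < p s \<and> g s = \<infinity>")
        case True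
        then have "ext_integral (atoms S p) g = \<infinity>"
          using ext_integral_atoms_infinite[OF S(1) convex_funsD(5)[OF g]] by blast
        then show ?thesis by simp
      next
        case False
        define r where "r = (\<Sum>s\<in>S. p s * real_of_ereal (g s))"
        have ext_g: "ext_integral (atoms S p) g = ereal r"
          unfolding r_def using False \<open>\<And>s g. g \<in> convex_funs \<Longrightarrow> g s \<noteq> \<infinity> \<Longrightarrow> g s = ereal (real_of_ereal (g s))\<close>[OF g]
          by (intro ext_integral_atoms S(1) p0 convex_funsD(5)[OF g]) auto
        have "int_exp_neg (legendre g) \<le> ennreal (Z * exp (\<Sum>s\<in>S. p s * (real_of_ereal (g s) - a s)))"
          unfolding p_def using False by (intro int_exp_neg_legendre_le g) (auto simp: p_pos)
        also have "(\<Sum>s\<in>S. p s * (real_of_ereal (g s) - a s)) = r - m"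
          by (simp add: r_def m_def right_diff_distrib sum_subtractf)
        also have "Z * exp (r - m) = exp (r - m + ln Z)" using Z by (simp add: exp_add)
        finally have le: "int_exp_neg (legendre g) \<le> ennreal (exp (r - m + ln Z))" .
        have gs: "legendre g \<in> convex_funs" by (rule legendre_convex_funs[OF g])
        obtain y b where "\<And>x. ereal (y \<bullet> x - b) \<le> legendre g x"
          using convex_funs_affine_minorant[OF gs] by metis
        from gibbs_lower[OF \<eta> convex_funsD(5)[OF gs] this le]
        have "ereal (- (r - m + ln Z)) \<le> ext_integral \<eta> (legendre g) + ereal h" by (simp add: real)
        then show ?thesis unfolding ext_g
          by (cases "ext_integral \<eta> (legendre g)") auto
      qed
    qed
    then show ?thesis unfolding real by (cases "transport_cost (atoms S p) \<eta>") auto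
  next
    case PInf
    then show ?thesis by simp
  next
    case MInf
    then show ?thesis using entropy_not_minf[OF \<eta>] by simp
  qed
  then show ?thesis using that[OF \<nu> ext_f] by blast
qed

section \<open>From the transport-entropy inequality to the reverse Santalo inequality\<close>

lemma nn_integral_lborel_translate:
  fixes g :: "'a::euclidean_space \<Rightarrow> ennreal"
  assumes [measurable]: "g \<in> borel_measurable borel"
  shows "(\<integral>\<^sup>+x. g (v + x) \<partial>lborel) = (\<integral>\<^sup>+x. g x \<partial>lborel)"
  by (subst (2) lborel_distr_plus[of v, symmetric]) (simp add: nn_integral_distr)

text \<open>
  The integral over a half-space \<open>v \<bullet> x > r\<close> cannot decrease when the half-space is shifted in
  the direction \<open>v\<close>, although it shrinks.  As the integrals are finite, the strip in between carries no mass, and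
  countably many strips cover the space.
\<close>

lemma nn_integral_increasing_direction_zero:
  fixes g :: "'a::euclidean_space \<Rightarrow> ennreal"
  assumes [measurable]: "g \<in> borel_measurable borel" and v: "v \<noteq> 0"
    and mono: "\<And>x. g x \<le> g (v + x)" and fin: "(\<integral>\<^sup>+x. g x \<partial>lborel) < \<infinity>"
  shows "(\<integral>\<^sup>+x. g x \<partial>lborel) = 0"
proof -
  define w where "w = v \<bullet> v"
  have w: "0 < w" using v by (simp add: w_def)
  define H where "H r = {x. r < v \<bullet> x}" for r
  have [measurable]: "H r \<in> sets borel" for r
    unfolding H_def by (intro borel_open open_Collect_less continuous_intros)
  have strip: "AE x in lborel. x \<notin> H r - H (r + w) \<or> g x = 0" for r
  proof -
    let ?G = "\<lambda>r. \<integral>\<^sup>+x. g x * indicator (H r) x \<partial>lborel"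
    let ?D = "\<integral>\<^sup>+x. g x * indicator (H r - H (r + w)) x \<partial>lborel"
    have "?G r \<le> (\<integral>\<^sup>+x. g (v + x) * indicator (H (r + w)) (v + x) \<partial>lborel)"
      using mono by (intro nn_integral_mono) (auto simp: indicator_def H_def w_def inner_add_right)
    also have "\<dots> = ?G (r + w)"
      by (rule nn_integral_lborel_translate) simp
    finally have "?G r \<le> ?G (r + w)" .
    moreover have "?G r = ?D + ?G (r + w)"
      using w by (subst nn_integral_add[symmetric])
        (auto intro!: nn_integral_cong simp: indicator_def H_def)
    moreover have "?G (r + w) < \<infinity>"
      using fin by (rule le_less_trans[rotated]) (auto intro!: nn_integral_mono simp: indicator_def)
    ultimately have "?D = 0"
      by (cases "?G (r + w)"; cases ?D) (auto simp: top_unique simp flip: ennreal_plus)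
    then have "AE x in lborel. g x * indicator (H r - H (r + w)) x = 0"
      by (subst (asm) nn_integral_0_iff_AE) auto
    then show ?thesis by eventually_elim (auto simp: indicator_def)
  qed
  have "AE x in lborel. \<forall>k :: int. x \<notin> H (of_int k * w) - H (of_int k * w + w) \<or> g x = 0"
    unfolding AE_all_countable using strip by blast
  then have "AE x in lborel. g x = 0"
  proof eventually_elim
    case (elim x)
    \<comment> \<open>The index of the strip of width \<open>w\<close> that contains \<open>x\<close>; strips are open below and closed above.\<close>
    define k where "k = \<lceil>v \<bullet> x / w\<rceil> - 1"
    have "of_int k < v \<bullet> x / w" "v \<bullet> x / w \<le> of_int k + 1" unfolding k_def by linarith+
    then have "x \<in> H (of_int k * w) - H (of_int k * w + w)"
      using w by (auto simp: H_def field_simps)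
    then show ?case using elim by blast
  qed
  then show ?thesis by (simp add: nn_integral_0_iff_AE)
qed

lemma convex_separate_interior_zero:
  fixes D :: "'a::euclidean_space set"
  assumes D: "convex D" and "0 \<notin> interior D"
  obtains v where "v \<noteq> 0" "\<And>x. x \<in> D \<Longrightarrow> v \<bullet> x \<le> 0"
proof (cases "interior D = {}")
  case True
  then obtain a b where ab: "a \<noteq> 0" "D \<subseteq> {x. a \<bullet> x = b}"
    using empty_interior_subset_hyperplane[OF D] by metis
  show ?thesis
  proof (cases "b \<le> 0")
    case True
    then show ?thesis using ab by (intro that[of a]) auto
  next
    case False
    then show ?thesis using ab by (intro that[of "- a"]) auto
  qed
next
  case False
  obtain a where a: "a \<noteq> 0" "\<And>x. x \<in> interior D \<Longrightarrow> 0 \<le> a \<bullet> x"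
    using separating_hyperplane_set_0[of "interior D"] assms convex_interior by blast
  have "closure (interior D) \<subseteq> {x. 0 \<le> a \<bullet> x}"
    using a by (intro closure_minimal closed_Collect_le continuous_intros) auto
  then have "D \<subseteq> {x. 0 \<le> a \<bullet> x}"
    using convex_closure_interior[OF D False] closure_subset[of D] by blast
  then show ?thesis using a(1) by (intro that[of "- a"]) auto
qed

text \<open>
  If \<open>0\<close> were not interior to the domain of \<open>f\<close>, some \<open>v \<noteq> 0\<close> would satisfy \<open>v \<bullet> x \<le> 0\<close> on the domain, and the
  conjugate would not increase in the direction \<open>v\<close>.  An integral that is finite would then have to vanish.
\<close>

lemma ball_in_domain:
  fixes f :: "real ^ 'n \<Rightarrow> ereal"
  assumes f: "f \<in> convex_funs" and pos: "0 < int_exp_neg (legendre f)" and fin: "int_exp_neg (legendre f) < \<infinity>"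
  obtains d where "0 < d" "\<And>x. norm x \<le> d \<Longrightarrow> f x \<noteq> \<infinity>"
proof -
  let ?D = "{x. f x \<noteq> \<infinity>}"
  have conv: "convex ?D"
  proof (rule convexI)
    fix x y and u v :: real
    assume *: "x \<in> ?D" "y \<in> ?D" "0 \<le> u" "0 \<le> v" "u + v = 1"
    then have "f (u *\<^sub>R x + v *\<^sub>R y) \<le> ereal u * f x + ereal v * f y"
      using convex_funsD(3)[OF f] by (simp add: convex_ereal_def)
    also have "\<dots> < \<infinity>"
      using * convex_funsD(1)[OF f, of x] convex_funsD(1)[OF f, of y] by (cases "f x"; cases "f y") auto
    finally show "u *\<^sub>R x + v *\<^sub>R y \<in> ?D" by simp
  qed
  have "0 \<in> interior ?D"
  proof (rule ccontr)
    assume "0 \<notin> interior ?D"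
    then obtain v where v: "v \<noteq> 0" "\<And>x. x \<in> ?D \<Longrightarrow> v \<bullet> x \<le> 0"
      using convex_separate_interior_zero[OF conv] by metis
    have "legendre f (v + y) \<le> legendre f y" for y
      unfolding legendre_le_iff
    proof
      fix x
      show "ereal (x \<bullet> (v + y)) - f x \<le> legendre f y"
      proof (cases "f x = \<infinity>")
        case False
        then have "x \<bullet> (v + y) \<le> x \<bullet> y" using v(2)[of x] by (simp add: inner_add_right inner_commute)
        then have "ereal (x \<bullet> (v + y)) - f x \<le> ereal (x \<bullet> y) - f x" by (intro ereal_minus_mono) auto
        also have "\<dots> \<le> legendre f y" by (rule legendre_upper)
        finally show ?thesis .
      qed simp
    qed
    then have "int_exp_neg (legendre f) = 0"
      unfolding int_exp_neg_def
      using fin v(1) convex_funsD(5)[OF legendre_convex_funs[OF f]]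
      by (intro nn_integral_increasing_direction_zero[of _ v])
        (auto intro: exp_neg_antimono simp: int_exp_neg_def)
    then show False using pos by simp
  qed
  then obtain r where r: "0 < r" "cball 0 r \<subseteq> ?D" by (metis mem_interior_cball)
  show ?thesis using r by (intro that[of r]) auto
qed

text \<open>
  Linear growth in every direction comes from the slopes \<open>\<plusminus> d b\<close> along the coordinate axes alone.
\<close>

lemma affine_sup_coercive:
  fixes S :: "(real ^ 'n) set"
  assumes d: "0 < d" and S: "finite S" "S \<noteq> {}"
    and axes: "\<And>b. b \<in> Basis \<Longrightarrow> d *\<^sub>R b \<in> S \<and> - (d *\<^sub>R b) \<in> S"
    and C: "\<And>b. b \<in> Basis \<Longrightarrow> a (d *\<^sub>R b) \<le> C \<and> a (- (d *\<^sub>R b)) \<le> C"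
  shows "ereal (d / CARD('n) * norm y - C) \<le> affine_sup S a y"
proof -
  obtain M where M: "affine_sup S a y = ereal M"
    using affine_sup_finite[OF S, of a y] by metis
  have le: "d * \<bar>y \<bullet> b\<bar> - C \<le> M" if "b \<in> Basis" for b
    using affine_sup_upper[of "d *\<^sub>R b" S y a] affine_sup_upper[of "- (d *\<^sub>R b)" S y a]
      axes[OF that] C[OF that] d M by (auto simp: abs_if inner_commute)
  have "d * norm y \<le> d * (\<Sum>b\<in>Basis. \<bar>y \<bullet> b\<bar>)"
    using d norm_le_l1[of y] by simp
  also have "\<dots> = (\<Sum>b\<in>Basis. d * \<bar>y \<bullet> b\<bar>)" by (rule sum_distrib_left)
  also have "\<dots> \<le> (\<Sum>b\<in>(Basis :: (real ^ 'n) set). M + C)"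
    using le by (intro sum_mono) (smt (verit))
  also have "\<dots> = real CARD('n) * (M + C)" by simp
  finally show ?thesis unfolding M by (simp add: field_simps)
qed

lemma tendsto_exp_neg:
  assumes "(u \<longlongrightarrow> L) F" "L \<noteq> -\<infinity>" "\<And>k. u k = ereal (M k)"
  shows "((\<lambda>k. exp_neg (u k)) \<longlongrightarrow> exp_neg L) F"
proof (cases L)
  case (real l)
  have "u = (\<lambda>k. ereal (M k))" using assms(3) by (rule ext)
  then have "(M \<longlongrightarrow> l) F" using assms(1) real by simp
  then have "((\<lambda>k. ennreal (exp (- M k))) \<longlongrightarrow> ennreal (exp (- l))) F" by (intro tendsto_intros)
  then show ?thesis using real assms(3) by simp
next
  case PInf
  have "u = (\<lambda>k. ereal (M k))" using assms(3) by (rule ext)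
  then have "filterlim M at_top F" using assms(1) PInf by (simp add: tendsto_PInfty_eq_at_top)
  then have "filterlim (\<lambda>k. - M k) at_bot F" by (simp add: filterlim_uminus_at_top)
  then have "((\<lambda>k. exp (- M k)) \<longlongrightarrow> 0) F" by (rule filterlim_compose[OF exp_at_bot])
  then have "((\<lambda>k. ennreal (exp (- M k))) \<longlongrightarrow> ennreal 0) F" by (rule tendsto_ennrealI)
  then show ?thesis using PInf assms(3) by simp
qed (use assms in auto)

text \<open>
  Density of the points in the graph, and not just in the domain, is what is required: a lower semicontinuous
  function is not determined by its values on a dense part of its domain.
\<close>

lemma countable_dense_graph:
  fixes f :: "real ^ 'n \<Rightarrow> ereal"
  assumes f: "f \<in> convex_funs"
  obtains D :: "nat \<Rightarrow> real ^ 'n" where "\<And>k. f (D k) \<noteq> \<infinity>"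
    "\<And>y l. l < legendre f y \<Longrightarrow> \<exists>k. l < ereal (D k \<bullet> y - real_of_ereal (f (D k)))"
proof -
  define \<Gamma> where "\<Gamma> = (\<lambda>x. (x, real_of_ereal (f x))) ` {x. f x \<noteq> \<infinity>}"
  obtain T where T: "countable T" "T \<subseteq> \<Gamma>" "\<Gamma> \<subseteq> closure T" by (rule separable)
  have "\<Gamma> \<noteq> {}" using convex_funsD(2)[OF f] by (auto simp: \<Gamma>_def)
  then have T_ne: "T \<noteq> {}" using T(3) by auto
  define D where "D k = fst (from_nat_into T k)" for k
  have D: "from_nat_into T k = (D k, real_of_ereal (f (D k)))" "f (D k) \<noteq> \<infinity>" for k
    using from_nat_into[OF T_ne, of k] T(2) by (auto simp: D_def \<Gamma>_def)
  show ?thesis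
  proof (rule that[of D])
    fix y l assume "l < legendre f y"
    then obtain x where x: "f x \<noteq> \<infinity>" "l < ereal (x \<bullet> y - real_of_ereal (f x))"
      unfolding legendre_eq_affine_sup[OF convex_funsD(1)[OF f]] affine_sup_def less_SUP_iff by blast
    define W where "W = {p :: (real ^ 'n) \<times> real. l < ereal (fst p \<bullet> y - snd p)}"
    have "open W" unfolding W_def by (intro open_Collect_less continuous_intros)
    moreover have "(x, real_of_ereal (f x)) \<in> W \<inter> closure T"
      using x T(3) by (auto simp: W_def \<Gamma>_def)
    ultimately obtain p where p: "p \<in> W" "p \<in> T" using open_Int_closure_eq_empty[of W T] by blast
    then obtain k where "p = from_nat_into T k" using from_nat_into_surj[OF T(1)] by metis
    then show "\<exists>k. l < ereal (D k \<bullet> y - real_of_ereal (f (D k)))"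
      using p(1) D(1)[of k] by (auto simp: W_def)
  qed (rule D)
qed

text \<open>
  The set \<open>S k\<close> consists of the orbits under \<open>E\<close> of the first \<open>k\<close> points of a dense sequence and of the
  points \<open>\<plusminus> d b\<close> on the coordinate axes.  The latter make the maxima coercive uniformly in \<open>k\<close>, which
  provides an integrable bound for dominated convergence.
\<close>

lemma finite_affine_sup_approximation:
  fixes f :: "real ^ 'n \<Rightarrow> ereal"
  assumes E: "sign_group E" and f: "f \<in> convex_funs_inv E" and pos: "0 < int_exp_neg (legendre f)"
    and z: "int_exp_neg (legendre f) < ennreal z"
  obtains S Z where "finite S" "S \<noteq> {}" "\<And>s. s \<in> S \<Longrightarrow> f s \<noteq> \<infinity>"
    "\<And>e s. e \<in> E \<Longrightarrow> s \<in> S \<Longrightarrow> sign_flip e s \<in> S" "0 < Z" "Z < z"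
    "int_exp_neg (affine_sup S (\<lambda>s. real_of_ereal (f s))) = ennreal Z"
proof -
  have conv: "f \<in> convex_funs" and finv: "\<And>e x. e \<in> E \<Longrightarrow> f (sign_flip e x) = f x"
    using f by (auto simp: convex_funs_inv_def)
  have gs: "legendre f \<in> convex_funs" by (rule legendre_convex_funs[OF conv])
  note [measurable] = convex_funsD(5)[OF gs] borel_measurable_lower_semicont[OF lower_semicont_affine_sup]
  have "int_exp_neg (legendre f) < \<infinity>" using z by (auto intro: less_trans)
  from ball_in_domain[OF conv pos this]
  obtain d where d: "0 < d" "\<And>x. norm x \<le> d \<Longrightarrow> f x \<noteq> \<infinity>" by metis
  obtain D :: "nat \<Rightarrow> real ^ 'n" where D: "\<And>k. f (D k) \<noteq> \<infinity>"
    "\<And>y l. l < legendre f y \<Longrightarrow> \<exists>k. l < ereal (D k \<bullet> y - real_of_ereal (f (D k)))"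
    using countable_dense_graph[OF conv] by metis
  define a where "a = (\<lambda>s. real_of_ereal (f s))"
  define S0 where "S0 = (\<lambda>b. d *\<^sub>R b) ` Basis \<union> (\<lambda>b. - (d *\<^sub>R b)) ` (Basis :: (real ^ 'n) set)"
  define C where "C = Max (a ` S0)"
  have S0: "finite S0" "S0 \<noteq> {}" by (auto simp: S0_def)
  have C: "a s \<le> C" if "s \<in> S0" for s unfolding C_def using that S0 by simp
  define S where "S k = (\<Union>e\<in>E. sign_flip e ` (S0 \<union> D ` {..<k}))" for k
  have base: "S0 \<union> D ` {..<k} \<subseteq> S k" for k
    unfolding S_def using sign_groupD(3)[OF E] by (force intro: rev_image_eqI)
  have Sk: "finite (S k)" "S k \<noteq> {}" for k
    using base[of k] S0 sign_groupD(1)[OF E] by (auto simp: S_def)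
  have Sdom: "f s \<noteq> \<infinity>" if s: "s \<in> S k" for s k
  proof -
    obtain e x where ex: "e \<in> E" "x \<in> S0 \<union> D ` {..<k}" "s = sign_flip e x"
      using s unfolding S_def by blast
    have "f x \<noteq> \<infinity>" using ex(2) D(1) d by (auto simp: S0_def)
    then show ?thesis using ex finv by simp
  qed
  have Sinv: "sign_flip e s \<in> S k" if e: "e \<in> E" and s: "s \<in> S k" for e s k
  proof -
    obtain e' x where ex: "e' \<in> E" "x \<in> S0 \<union> D ` {..<k}" "s = sign_flip e' x"
      using s unfolding S_def by blast
    then have "sign_flip e s = sign_flip (sign_flip e e') x" by (simp add: sign_flip_sign_flip)
    then show ?thesis using sign_groupD(4)[OF E e ex(1)] ex(2) unfolding S_def by blast
  qed
  define u where "u k = affine_sup (S k) a" for k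
  have u_real: "u k y = ereal (real_of_ereal (u k y))" for k y
    unfolding u_def by (rule affine_sup_finite[OF Sk])
  have [measurable]: "u k \<in> borel_measurable borel" for k unfolding u_def by measurable
  have u_le: "u k y \<le> legendre f y" for k y
    unfolding u_def affine_sup_le_iff legendre_eq_affine_sup[OF convex_funsD(1)[OF conv]] a_def
    using Sdom by (auto intro!: affine_sup_upper)
  have u_lim: "(\<lambda>k. u k y) \<longlonglongrightarrow> legendre f y" for y
  proof (rule order_tendstoI)
    fix l assume "l < legendre f y"
    then obtain j where j: "l < ereal (D j \<bullet> y - a (D j))" using D(2) by (auto simp: a_def)
    have "l < u k y" if "Suc j \<le> k" for k
    proof -
      have "D j \<in> S k" using base[of k] that by auto
      then have "ereal (D j \<bullet> y - a (D j)) \<le> u k y" unfolding u_def by (rule affine_sup_upper)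
      with j show ?thesis by (rule less_le_trans)
    qed
    then show "\<forall>\<^sub>F k in sequentially. l < u k y" by (rule eventually_sequentiallyI)
  next
    fix l assume "legendre f y < l"
    then show "\<forall>\<^sub>F k in sequentially. u k y < l"
      using u_le by (intro always_eventually allI) (blast intro: le_less_trans)
  qed
  define \<delta> where "\<delta> = d / CARD('n)"
  have \<delta>: "0 < \<delta>" using d by (simp add: \<delta>_def)
  have coercive: "ereal (\<delta> * norm y - C) \<le> u k y" for k y
    unfolding u_def \<delta>_def
  proof (rule affine_sup_coercive[OF d(1) Sk])
    fix b :: "real ^ 'n" assume "b \<in> Basis"
    then have "d *\<^sub>R b \<in> S0" "- (d *\<^sub>R b) \<in> S0" by (auto simp: S0_def)
    then show "d *\<^sub>R b \<in> S k \<and> - (d *\<^sub>R b) \<in> S k" "a (d *\<^sub>R b) \<le> C \<and> a (- (d *\<^sub>R b)) \<le> C"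
      using base[of k] C by auto
  qed
  define w where "w y = ennreal (exp C) * ennreal (exp (- \<delta> * norm y))" for y :: "real ^ 'n"
  have [measurable]: "w \<in> borel_measurable borel" unfolding w_def by measurable
  have exp_le: "exp_neg (u k y) \<le> w y" for k y
    using exp_neg_antimono[OF coercive[of y k]]
    by (simp add: w_def ennreal_mult'[symmetric] exp_add[symmetric])
  have "(\<integral>\<^sup>+y. w y \<partial>lborel) = ennreal (exp C) * (\<integral>\<^sup>+y. ennreal (exp (- \<delta> * norm (y :: real ^ 'n))) \<partial>lborel)"
    unfolding w_def by (rule nn_integral_cmult) simp
  also have "\<dots> < \<infinity>" using nn_integral_exp_norm_finite[OF \<delta>, where ?'a = "real ^ 'n"] by (simp add: ennreal_mult_less_top)
  finally have w_fin: "(\<integral>\<^sup>+y. w y \<partial>lborel) < \<infinity>" .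
  have "(\<lambda>k. int_exp_neg (u k)) \<longlonglongrightarrow> int_exp_neg (legendre f)"
    unfolding int_exp_neg_def
  proof (rule nn_integral_dominated_convergence[where w = w])
    show "AE y in lborel. (\<lambda>k. exp_neg (u k y)) \<longlonglongrightarrow> exp_neg (legendre f y)"
      using tendsto_exp_neg[OF u_lim convex_funsD(1)[OF gs] u_real] by simp
  qed (use w_fin exp_le in auto)
  from order_tendstoD(2)[OF this z] obtain k where k: "int_exp_neg (u k) < ennreal z"
    by (auto simp: eventually_sequentially)
  have "0 < int_exp_neg (u k)"
  proof (rule int_exp_neg_pos[where d = 1 and ?x0.0 = 0])
    show "u k (0 + w) \<noteq> \<infinity>" for w using u_real[of k "0 + w"] by (metis PInfty_neq_ereal(1))
  qed simp_all
  with k obtain Z where Z: "int_exp_neg (u k) = ennreal Z" "0 < Z" "Z < z"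
    by (cases "int_exp_neg (u k)") (auto simp: ennreal_less_iff)
  show ?thesis
  proof (rule that[of "S k" Z])
    show "int_exp_neg (affine_sup (S k) (\<lambda>s. real_of_ereal (f s))) = ennreal Z"
      using Z(1) unfolding u_def a_def .
  qed (use Sk Sdom Sinv Z in auto)
qed

lemma transport_entropy_imp_reverse_santalo:
  fixes E :: "(real ^ 'n) set"
  assumes E: "sign_group E" and c: "0 < c"
    and TE: "transport_entropy_ineq (compact_probs \<inter> P1_inv E) (P1_inv E) c"
  shows "reverse_santalo (convex_funs_inv E) c"
  unfolding reverse_santalo_def
proof (intro ballI impI)
  fix f :: "real ^ 'n \<Rightarrow> ereal" assume f: "f \<in> convex_funs_inv E"
    and pos: "0 < int_exp_neg f" "0 < int_exp_neg (legendre f)"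
  have conv: "f \<in> convex_funs" using f by (simp add: convex_funs_inv_def)
  have fs: "legendre f \<in> convex_funs_inv E" by (rule legendre_convex_funs_inv[OF E f])
  have ff: "legendre (legendre f) = f" by (rule fenchel_moreau[OF conv])
  define K where "K = c ^ CARD('n)"
  have K: "0 < K" using c by (simp add: K_def)
  have key: "K \<le> z * w" if zw: "int_exp_neg (legendre f) < ennreal z" "int_exp_neg f < ennreal w" for z w
  proof -
    obtain S1 Z1 where S1: "finite S1" "S1 \<noteq> {}" "\<And>s. s \<in> S1 \<Longrightarrow> f s \<noteq> \<infinity>"
      "\<And>e s. e \<in> E \<Longrightarrow> s \<in> S1 \<Longrightarrow> sign_flip e s \<in> S1" "0 < Z1" "Z1 < z"
      "int_exp_neg (affine_sup S1 (\<lambda>s. real_of_ereal (f s))) = ennreal Z1"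
      using finite_affine_sup_approximation[OF E f pos(2) zw(1)] by metis
    obtain \<nu>1 m1 where 1: "\<nu>1 \<in> compact_probs \<inter> P1_inv E" "ext_integral \<nu>1 f = ereal m1"
      "\<And>\<eta>. \<eta> \<in> P1 \<Longrightarrow> ereal (m1 - ln Z1) \<le> transport_cost \<nu>1 \<eta> + entropy_Leb \<eta>"
      using discrete_moment_measure[OF E f S1(1-5) S1(7)] by metis
    have "0 < int_exp_neg (legendre (legendre f))" "int_exp_neg (legendre (legendre f)) < ennreal w"
      using pos zw by (simp_all add: ff)
    then obtain S2 Z2 where S2: "finite S2" "S2 \<noteq> {}" "\<And>s. s \<in> S2 \<Longrightarrow> legendre f s \<noteq> \<infinity>"
      "\<And>e s. e \<in> E \<Longrightarrow> s \<in> S2 \<Longrightarrow> sign_flip e s \<in> S2" "0 < Z2" "Z2 < w"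
      "int_exp_neg (affine_sup S2 (\<lambda>s. real_of_ereal (legendre f s))) = ennreal Z2"
      using finite_affine_sup_approximation[OF E fs] by metis
    obtain \<nu>2 m2 where 2: "\<nu>2 \<in> compact_probs \<inter> P1_inv E" "ext_integral \<nu>2 (legendre f) = ereal m2"
      "\<And>\<eta>. \<eta> \<in> P1 \<Longrightarrow> ereal (m2 - ln Z2) \<le> transport_cost \<nu>2 \<eta> + entropy_Leb \<eta>"
      using discrete_moment_measure[OF E fs S2(1-5) S2(7)] by metis
    have "ereal (m1 - ln Z1) + ereal (m2 - ln Z2)
        \<le> (INF \<eta>\<in>P1_inv E. transport_cost \<nu>1 \<eta> + entropy_Leb \<eta>)
          + (INF \<eta>\<in>P1_inv E. transport_cost \<nu>2 \<eta> + entropy_Leb \<eta>)"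
      using 1(3) 2(3) P1_invD(1) by (intro add_mono INF_greatest) blast+
    also have "\<dots> \<le> ereal (- real CARD('n) * ln c) + transport_cost \<nu>1 \<nu>2"
      using TE 1(1) 2(1) unfolding transport_entropy_ineq_def by blast
    also have "transport_cost \<nu>1 \<nu>2 \<le> ext_integral \<nu>1 f + ext_integral \<nu>2 (legendre f)"
      unfolding transport_cost_def by (rule INF_lower[OF conv])
    finally have "ereal (m1 - ln Z1) + ereal (m2 - ln Z2)
        \<le> ereal (- real CARD('n) * ln c) + (ereal m1 + ereal m2)"
      unfolding 1(2) 2(2) by (simp add: add_left_mono)
    then have "ln K \<le> ln (Z1 * Z2)"
      using c S1(5) S2(5) by (simp add: K_def ln_realpow ln_mult)
    then have "K \<le> Z1 * Z2" using K S1(5) S2(5) by simp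
    also have "\<dots> \<le> z * w" using S1(5,6) S2(5,6) by (intro mult_mono) auto
    finally show ?thesis .
  qed
  show "ennreal (c ^ CARD('n)) \<le> int_exp_neg f * int_exp_neg (legendre f)"
    unfolding K_def[symmetric]
  proof (cases "int_exp_neg f"; cases "int_exp_neg (legendre f)")
    fix i j assume i: "int_exp_neg f = ennreal i" "0 \<le> i" and j: "int_exp_neg (legendre f) = ennreal j" "0 \<le> j"
    have "((\<lambda>\<epsilon>. (j + \<epsilon>) * (i + \<epsilon>)) \<longlongrightarrow> (j + 0) * (i + 0)) (at_right 0)"
      by (intro tendsto_intros)
    moreover have "\<forall>\<^sub>F \<epsilon> in at_right (0 :: real). K \<le> (j + \<epsilon>) * (i + \<epsilon>)"
      using eventually_at_right_less[of "0 :: real"]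
      by eventually_elim (use i j in \<open>auto intro!: key simp: ennreal_less_iff simp del: ennreal_plus\<close>)
    ultimately have "K \<le> (j + 0) * (i + 0)" by (rule tendsto_lowerbound) simp
    then show "ennreal K \<le> int_exp_neg f * int_exp_neg (legendre f)"
      using i j by (simp add: ennreal_mult'[symmetric] mult.commute ennreal_leI)
  qed (use pos in \<open>simp_all add: ennreal_mult_top ennreal_top_mult\<close>)
qed

section \<open>The three symmetry classes\<close>

text \<open>
  By the Lindelof property the complement of the support is a null set, so a compact support bounds the norm
  almost everywhere.
\<close>

lemma compact_probs_subset_P1: "compact_probs \<subseteq> P1"
proof
  fix \<nu> :: "(real ^ 'n) measure" assume \<nu>: "\<nu> \<in> compact_probs"
  then have "prob_space \<nu>" and sets [measurable_cong]: "sets \<nu> = sets borel"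
    and compact: "compact (measure_support \<nu>)"
    by (auto simp: compact_probs_def borel_probs_def)
  interpret prob_space \<nu> by fact
  define F where "F = {U. open U \<and> emeasure \<nu> U = 0}"
  obtain F' where F': "F' \<subseteq> F" "countable F'" "\<Union>F' = \<Union>F"
    using Lindelof[of F] by (auto simp: F_def)
  have "(\<Union>U\<in>F'. U) \<in> null_sets \<nu>"
    using F'(1,2) by (intro null_sets_UN') (auto simp: F_def null_sets_def sets)
  then have "AE x in \<nu>. x \<notin> \<Union>F" using F'(3) AE_not_in by force
  moreover have "- \<Union>F \<subseteq> measure_support \<nu>"
    by (auto simp: F_def measure_support_def zero_less_iff_neq_zero)
  moreover obtain B where "\<And>x. x \<in> measure_support \<nu> \<Longrightarrow> norm x \<le> B"
    using compact compact_imp_bounded bounded_iff by metis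
  ultimately have "AE x in \<nu>. norm (norm x) \<le> B"
    by (auto elim!: eventually_mono)
  then have "integrable \<nu> (\<lambda>x. norm x)" by (rule integrable_const_bound) simp
  with \<nu> show "\<nu> \<in> P1" by (simp add: P1_def compact_probs_def)
qed

lemma finite_sign_vectors: "finite (sign_vectors :: (real ^ 'n) set)"
proof (rule finite_subset)
  show "(sign_vectors :: (real ^ 'n) set) \<subseteq> (\<lambda>g. \<chi> i. g i) ` (UNIV \<rightarrow>\<^sub>E ({-1, 1} :: real set))"
  proof
    fix e :: "real ^ 'n" assume "e \<in> sign_vectors"
    then show "e \<in> (\<lambda>g. \<chi> i. g i) ` (UNIV \<rightarrow>\<^sub>E ({-1, 1} :: real set))"
      by (intro image_eqI[of _ _ "\<lambda>i. e $ i"]) (auto simp: sign_vectors_def)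
  qed
  show "finite ((\<lambda>g. \<chi> i. g i) ` (UNIV \<rightarrow>\<^sub>E ({-1, 1} :: real set)) :: (real ^ 'n) set)"
    by (intro finite_imageI finite_PiE) auto
qed

lemma sign_flip_minus_one: "sign_flip (- 1) = uminus"
  by (auto simp: vec_eq_iff)

lemma sign_group_trivial: "sign_group {1}"
  by (simp add: sign_group_def sign_vectors_def)

lemma sign_group_pm: "sign_group {1, - 1}"
  by (simp add: sign_group_def sign_vectors_def sign_flip_minus_one)

lemma sign_group_all: "sign_group (sign_vectors :: (real ^ 'n) set)"
proof -
  have "sign_flip d e \<in> sign_vectors" if "d \<in> sign_vectors" "e \<in> sign_vectors" for d e :: "real ^ 'n"
    unfolding sign_vectors_def
  proof (intro CollectI allI)
    fix i
    have "d $ i \<in> {-1, 1}" "e $ i \<in> {-1, 1}" using that by (auto simp: sign_vectors_def)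
    then show "sign_flip d e $ i \<in> {-1, 1}" by auto
  qed
  moreover have "(1 :: real ^ 'n) \<in> sign_vectors" by (simp add: sign_vectors_def)
  ultimately show ?thesis using finite_sign_vectors by (simp add: sign_group_def)
qed

lemma convex_funs_inv_eq:
  "convex_funs_inv {1} = convex_funs" "convex_funs_inv {1, - 1} = convex_funs_sym"
  "convex_funs_inv sign_vectors = convex_funs_uncond"
  by (auto simp: convex_funs_inv_def convex_funs_sym_def convex_funs_uncond_def sign_flip_minus_one)

lemma distr_sign_flip_one:
  fixes \<nu> :: "(real ^ 'n) measure"
  assumes "\<nu> \<in> P1"
  shows "distr \<nu> borel (sign_flip 1) = \<nu>"
proof -
  have "sign_flip 1 = (\<lambda>x :: real ^ 'n. x)" by (rule ext) simp
  then show ?thesis using distr_id2[OF P1D(2)[OF assms, symmetric]] by simp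
qed

lemma P1_inv_eq:
  "P1_inv {1} = P1" "P1_inv {1, - 1} = P1_sym" "P1_inv sign_vectors = P1_uncond"
  using distr_sign_flip_one
  by (auto simp: P1_inv_def P1_sym_def P1_uncond_def sign_flip_minus_one)

lemma reverse_santalo_iff_transport_entropy:
  assumes "sign_group E" "0 < c"
  shows "reverse_santalo (convex_funs_inv E) c \<longleftrightarrow> transport_entropy_ineq (P1_inv E) (P1_inv E) c"
    and "reverse_santalo (convex_funs_inv E) c
      \<longleftrightarrow> transport_entropy_ineq (compact_probs \<inter> P1_inv E) (P1_inv E) c"
proof -
  have "transport_entropy_ineq (compact_probs \<inter> P1_inv E) (P1_inv E) c"
    if "transport_entropy_ineq (P1_inv E) (P1_inv E) c"
    using that unfolding transport_entropy_ineq_def by blast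
  then show "reverse_santalo (convex_funs_inv E) c \<longleftrightarrow> transport_entropy_ineq (P1_inv E) (P1_inv E) c"
    "reverse_santalo (convex_funs_inv E) c
      \<longleftrightarrow> transport_entropy_ineq (compact_probs \<inter> P1_inv E) (P1_inv E) c"
    using reverse_santalo_imp_transport_entropy[OF assms] transport_entropy_imp_reverse_santalo[OF assms]
    by blast+
qed

theorem corollary2:
  fixes c :: real
  assumes "c > 0"
  shows
    "(reverse_santalo (convex_funs :: (real ^ 'n \<Rightarrow> ereal) set) c
        \<longleftrightarrow> transport_entropy_ineq (P1 :: (real ^ 'n) measure set) P1 c) \<and>
     (reverse_santalo (convex_funs :: (real ^ 'n \<Rightarrow> ereal) set) c
        \<longleftrightarrow> transport_entropy_ineq (compact_probs :: (real ^ 'n) measure set) P1 c) \<and>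
     (reverse_santalo (convex_funs_uncond :: (real ^ 'n \<Rightarrow> ereal) set) c
        \<longleftrightarrow> transport_entropy_ineq (P1_uncond :: (real ^ 'n) measure set) P1_uncond c) \<and>
     (reverse_santalo (convex_funs_uncond :: (real ^ 'n \<Rightarrow> ereal) set) c
        \<longleftrightarrow> transport_entropy_ineq (compact_probs \<inter> P1_uncond :: (real ^ 'n) measure set) P1_uncond c) \<and>
     (reverse_santalo (convex_funs_sym :: (real ^ 'n \<Rightarrow> ereal) set) c
        \<longleftrightarrow> transport_entropy_ineq (P1_sym :: (real ^ 'n) measure set) P1_sym c) \<and>
     (reverse_santalo (convex_funs_sym :: (real ^ 'n \<Rightarrow> ereal) set) c
        \<longleftrightarrow> transport_entropy_ineq (compact_probs \<inter> P1_sym :: (real ^ 'n) measure set) P1_sym c)"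
proof -
  have "compact_probs \<inter> P1 = (compact_probs :: (real ^ 'n) measure set)"
    using compact_probs_subset_P1 by blast
  then show ?thesis
    using reverse_santalo_iff_transport_entropy[OF sign_group_trivial assms, where ?'a = 'n]
      reverse_santalo_iff_transport_entropy[OF sign_group_pm assms, where ?'a = 'n]
      reverse_santalo_iff_transport_entropy[OF sign_group_all assms, where ?'a = 'n]
    unfolding convex_funs_inv_eq P1_inv_eq by simp
qed

end
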